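(* Let $d=1$, let $\theta\in C_c^\infty(\mathbb{R}^2)$ with $\theta=1$ on $B(0,R)$ for some $R>0$, and let $F(x,v)=\theta(x,v)\,\mathrm{sign}(x)\,|x|^\alpha$ with $\alpha\in(\tfrac12,1)$. Then the system $$x'=v,\qquad v'=F(x,v),\qquad (x(0),v(0))=(x_0,v_0)$$ has a unique local solution on any domain not containing the origin, for every initial condition. For every $t_0>0$ (small enough with respect to $R$), the two initial conditions $(At_0^\beta,\,-A\beta t_0^{\beta-1})$ with $(\beta,A)$ given by $$\beta=\frac{2}{1-\alpha},\qquad A=\pm\Big(\frac{1}{\beta(\beta-1)}\Big)^{\frac1{1-\alpha}}=\pm\Big(\frac{(1-\alpha)^2}{2(1+\alpha)}\Big)^{\frac1{1-\alpha}}$$ produce the solution $$(x_t,v_t)=\big(A(t_0-t)^\beta,\ -A\beta(t_0-t)^{\beta-1}\big)$$ for $t\in[0,t_0]$, and $(x_{t_0},v_{t_0})=(0,0)$. As a consequence, the transport equation $$D_tf+v\cdot D_xf+F\cdot D_vf=0,\qquad f|_{t=0}=f_0,$$ with any smooth $f_0$ such that $f_0(At_0^\beta,\,-A\beta t_0^{\beta-1})\neq f_0(-At_0^\beta,\,A\beta t_0^{\beta-1})$ for some $t_0>0$, has a solution with a discontinuity at time $t_0$ at position $(x,v)=(0,0)$.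
   Context: Here $\mathrm{sign}(x)$ is the sign of the real number $x$, $B(0,R)$ is the ball of radius $R$ centred at the origin of $\mathbb{R}^2$, and $C_c^\infty(\mathbb{R}^2)$ is the space of infinitely differentiable real functions on $\mathbb{R}^2$ with compact support. The unknown of the transport equation is a real function $f=f(t,x,v)$ of time $t$ and $(x,v)\in\mathbb{R}^2$; $D_t,D_x,D_v$ denote the derivatives in $t$, $x$, $v$. *)

theory Defs
  imports "HOL-Analysis.Analysis"
begin

primrec C_diff :: "nat \<Rightarrow> (real \<times> real \<Rightarrow> real) \<Rightarrow> bool" where
  "C_diff 0 f \<longleftrightarrow> continuous_on UNIV f"
| "C_diff (Suc k) f \<longleftrightarrow>
     (\<forall>z. f differentiable (at z)) \<and> (\<forall>h. C_diff k (\<lambda>z. frechet_derivative f (at z) h))"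

definition smooth :: "(real \<times> real \<Rightarrow> real) \<Rightarrow> bool" where
  "smooth f \<longleftrightarrow> (\<forall>k. C_diff k f)"

definition smooth_compactly_supported :: "(real \<times> real \<Rightarrow> real) \<Rightarrow> bool" where
  "smooth_compactly_supported f \<longleftrightarrow> smooth f \<and> compact (closure {z. f z \<noteq> 0})"

text \<open>The system \<open>x' = v\<close>, \<open>v' = F (x, v)\<close> on a time set \<open>J\<close>; derivatives are one-sided
  at the end points that belong to \<open>J\<close>.\<close>

definition solves_system ::
  "(real \<times> real \<Rightarrow> real) \<Rightarrow> real set \<Rightarrow> (real \<Rightarrow> real) \<Rightarrow> (real \<Rightarrow> real) \<Rightarrow> bool" where
  "solves_system F J x v \<longleftrightarrow>
     (\<forall>t\<in>J. (x has_real_derivative v t) (at t within J) \<and>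
             (v has_real_derivative F (x t, v t)) (at t within J))"

text \<open>Existence near time \<open>0\<close>, and uniqueness for as long as two solutions are defined
  and stay in \<open>D\<close>. The interval \<open>J\<close> may be one- or two-sided around \<open>0\<close>.\<close>

definition unique_local_solutions_on :: "(real \<times> real \<Rightarrow> real) \<Rightarrow> (real \<times> real) set \<Rightarrow> bool" where
  "unique_local_solutions_on F D \<longleftrightarrow>
     (\<forall>x0 v0. (x0, v0) \<in> D \<longrightarrow>
        (\<exists>\<epsilon>>0. \<exists>x v. solves_system F {-\<epsilon><..<\<epsilon>} x v \<and> x 0 = x0 \<and> v 0 = v0 \<and>
            (\<forall>t\<in>{-\<epsilon><..<\<epsilon>}. (x t, v t) \<in> D)) \<and>
        (\<forall>J x v y w. is_interval J \<and> 0 \<in> J \<and>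
            solves_system F J x v \<and> x 0 = x0 \<and> v 0 = v0 \<and> (\<forall>t\<in>J. (x t, v t) \<in> D) \<and>
            solves_system F J y w \<and> y 0 = x0 \<and> w 0 = v0 \<and> (\<forall>t\<in>J. (y t, w t) \<in> D) \<longrightarrow>
            (\<forall>t\<in>J. x t = y t \<and> v t = w t)))"

text \<open>Weak solutions on \<open>[0, \<infinity>)\<close> of \<open>D\<^sub>t f + v \<cdot> D\<^sub>x f + F \<cdot> D\<^sub>v f = 0\<close>, \<open>f (0) = f0\<close>: locally bounded
  functions satisfying the equation tested against every \<open>\<phi>\<close> in \<open>C\<^sub>c\<^sup>\<infinity>\<close>. The operator in the
  time integral is the negative of the formal adjoint of \<open>v \<cdot> D\<^sub>x + F \<cdot> D\<^sub>v\<close>; it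
  is \<open>D\<^sub>v (F \<phi>)\<close> and not \<open>F \<cdot> D\<^sub>v \<phi>\<close> that appears, since \<open>F\<close> depends on \<open>v\<close>.
  As the identity is required at every time, it determines each slice \<open>f t\<close> up to a null set
  once \<open>f\<close> is known at almost every time.\<close>

definition weak_transport_solution ::
  "(real \<times> real \<Rightarrow> real) \<Rightarrow> (real \<times> real \<Rightarrow> real) \<Rightarrow> (real \<Rightarrow> real \<times> real \<Rightarrow> real) \<Rightarrow> bool" where
  "weak_transport_solution F f0 f \<longleftrightarrow>
     set_borel_measurable borel ({0..} \<times> UNIV) (\<lambda>(t, z). f t z) \<and>
     (\<forall>T r. \<exists>M. \<forall>t\<in>{0..T}. \<forall>z\<in>cball 0 r. \<bar>f t z\<bar> \<le> M) \<and>
     f 0 = f0 \<and>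
     (\<forall>\<phi>. smooth_compactly_supported \<phi> \<longrightarrow>
       (\<forall>t\<ge>0. (LBINT z. f t z * \<phi> z) = (LBINT z. f0 z * \<phi> z) +
          (LBINT s:{0..t}. LBINT z. f s z *
             (snd z * deriv (\<lambda>x. \<phi> (x, snd z)) (fst z)
              + deriv (\<lambda>v. F (fst z, v) * \<phi> (fst z, v)) (snd z)))))"

text \<open>Weak solutions are determined only up to null sets, so a discontinuity has to persist
  for every function that agrees with \<open>g\<close> almost everywhere.\<close>

definition essentially_discontinuous_at :: "(real \<times> real \<Rightarrow> real) \<Rightarrow> real \<times> real \<Rightarrow> bool" where
  "essentially_discontinuous_at g z \<longleftrightarrow> \<not> (\<exists>h. (AE y in lborel. h y = g y) \<and> isCont h z)"

end

(*
  Let f (t, z) = f0 (Phi_{-t} z), where Phi is the flow of the system. Weak solvability is obtained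
  by approximating the backward flow by a semi-implicit Euler scheme: each step is a composition of
  two maps changing one coordinate, so it has an explicit Jacobian and the transported functions
  satisfy an exact discrete weak form. By compactness the scheme started at z converges as soon as
  one solution through z avoids the origin, because solutions avoiding the origin are unique; and
  this happens for almost every z, since the points whose discrete path comes delta-close to the
  origin have measure O(delta). Dominated convergence gives the weak form of the equation.

  Finally the two explicit solutions reach the origin at time t0. At time t0 the function f is close
  to f0 (q t0) near the points q s with s > 0 small, where q is either of the two time-reversed
  explicit solutions; as s tends to 0 this gives two different limits at the origin.
*)
theory Submission
  imports Defs "HOL-Complex_Analysis.Great_Picard"
begin

section \<open>The semi-implicit Euler scheme\<close>

text \<open>The field (v, F) is only Hoelder continuous across the line x = 0, so classical theory
  supplies neither a unique flow nor its Jacobian. Two features make up for this. The singular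
  factor of F depends on x alone, so the divergence of the field, which is D_v F, is continuous and
  bounded: areas are distorted by bounded factors although F has no bounded x-derivative. And at (0,
  v) with v nonzero the field crosses the singular line transversally, which restores uniqueness.
  Only the origin remains, where velocity and force vanish together. There a particle at rest may
  depart along x = A u^\<beta>: in x'' = sgn(x) |x|^\<alpha> the exponents match if \<alpha> \<beta>
  = \<beta> - 2, the coefficients if |A|^\<alpha> = |A| \<beta> (\<beta> - 1), and both signs of A
  are possible because the force is odd. The same curves traversed in reverse arrive at rest in
  finite time, so two different pasts merge at the origin and f inherits a value of f0 from
  each.\<close>

lemma nat_floor_divide_bounds:
  fixes t h :: real
  assumes "0 \<le> t" "0 < h"
  shows "real (nat \<lfloor>t / h\<rfloor>) * h \<le> t" "t - h < real (nat \<lfloor>t / h\<rfloor>) * h"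
proof -
  have "0 \<le> t / h" using assms by simp
  then have e: "real (nat \<lfloor>t / h\<rfloor>) = of_int \<lfloor>t / h\<rfloor>" by (simp add: of_nat_nat)
  have "of_int \<lfloor>t / h\<rfloor> \<le> t / h" "t / h < of_int \<lfloor>t / h\<rfloor> + 1" by linarith+
  then show "real (nat \<lfloor>t / h\<rfloor>) * h \<le> t" "t - h < real (nat \<lfloor>t / h\<rfloor>) * h"
    using assms unfolding e pos_le_divide_eq[OF assms(2)] pos_divide_less_eq[OF assms(2)]
    by (auto simp: algebra_simps)
qed

lemma nat_floor_divide_mono:
  fixes s t h :: real
  assumes "s \<le> t" "0 < h"
  shows "nat \<lfloor>s / h\<rfloor> \<le> nat \<lfloor>t / h\<rfloor>"
  using assms by (intro nat_mono floor_mono divide_right_mono) auto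

text \<open>Compares a discrete path with uniform motion of velocity c per step. With c = 0 it
  yields the Lipschitz bound for the iterates, with c a multiple of the field frozen at one point it
  yields the differential equation of their limit.\<close>

lemma telescoping_bound:
  fixes a :: "nat \<Rightarrow> 'a::real_normed_vector"
  assumes "k \<le> l" "\<And>j. k \<le> j \<Longrightarrow> j < l \<Longrightarrow> norm (a (Suc j) - a j - c) \<le> e"
  shows "norm (a l - a k - real (l - k) *\<^sub>R c) \<le> real (l - k) * e"
  using assms
proof (induction l rule: dec_induct)
  case base
  then show ?case by simp
next
  case (step l)
  have "a (Suc l) - a k - real (Suc l - k) *\<^sub>R c
      = (a l - a k - real (l - k) *\<^sub>R c) + (a (Suc l) - a l - c)"
    using step.hyps by (simp add: Suc_diff_le algebra_simps)
  then have "norm (a (Suc l) - a k - real (Suc l - k) *\<^sub>R c) \<le> real (l - k) * e + e"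
    using step.IH step.prems step.hyps by (smt (verit) less_Suc_eq norm_triangle_ineq)
  then show ?case using step.hyps by (simp add: Suc_diff_le algebra_simps)
qed

text \<open>\<open>Fv\<close> is the divergence of (v, F) in the phase plane, so its bound controls
  the change of area. Nothing is assumed about x-derivatives of F, which blow up at x = 0 in the
  intended application.\<close>

locale kinetic_field =
  fixes F Fv :: "real \<times> real \<Rightarrow> real" and M :: real
  assumes cont_F: "continuous_on UNIV F"
    and cont_Fv: "continuous_on UNIV Fv"
    and F_bound: "\<bar>F z\<bar> \<le> M" and Fv_bound: "\<bar>Fv z\<bar> \<le> M"
    and F_deriv: "((\<lambda>v. F (x, v)) has_real_derivative Fv (x, v)) (at v)"
begin

definition G :: "real \<times> real \<Rightarrow> real \<times> real" where
  "G z = (snd z, F z)"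

text \<open>The semi-implicit Euler step: unlike the explicit one, it is a composition of two maps that
  change a single coordinate, so that its Jacobian is the exact factor \<open>1 + h * Fv z\<close>.\<close>

definition step :: "real \<Rightarrow> real \<times> real \<Rightarrow> real \<times> real" where
  "step h z = (fst z + h * (snd z + h * F z), snd z + h * F z)"

text \<open>The sign \<sigma> = 1 or -1 selects the direction of time, so that backward paths are
  also parametrised by {0..T} and share all lemmas with forward ones.\<close>

definition sol :: "real \<Rightarrow> real \<Rightarrow> (real \<Rightarrow> real \<times> real) \<Rightarrow> bool" where
  "sol \<sigma> T y \<longleftrightarrow> (\<forall>t\<in>{0..T}. (y has_vector_derivative \<sigma> *\<^sub>R G (y t)) (at t within {0..T}))"

section \<open>A priori bounds for the iterates\<close>

lemma M_nonneg: "0 \<le> M"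
  using F_bound[of 0] by linarith

lemma abs_snd_iter: "\<bar>snd ((step h ^^ k) z)\<bar> \<le> \<bar>snd z\<bar> + real k * \<bar>h\<bar> * M"
proof (induction k)
  case (Suc k)
  have "\<bar>h * F ((step h ^^ k) z)\<bar> \<le> \<bar>h\<bar> * M"
    by (simp add: abs_mult F_bound mult_left_mono)
  moreover have "snd ((step h ^^ Suc k) z) = snd ((step h ^^ k) z) + h * F ((step h ^^ k) z)"
    by (simp add: step_def)
  moreover have "real (Suc k) * \<bar>h\<bar> * M = real k * \<bar>h\<bar> * M + \<bar>h\<bar> * M"
    by (simp add: algebra_simps)
  ultimately show ?case using Suc by linarith
qed simp

lemma abs_fst_iter:
  "\<bar>fst ((step h ^^ k) z)\<bar> \<le> \<bar>fst z\<bar> + real k * \<bar>h\<bar> * (\<bar>snd z\<bar> + real k * \<bar>h\<bar> * M)"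
proof (induction k)
  case (Suc k)
  define c where "c = \<bar>snd z\<bar> + real (Suc k) * \<bar>h\<bar> * M"
  have e: "fst ((step h ^^ Suc k) z) = fst ((step h ^^ k) z) + h * snd ((step h ^^ Suc k) z)"
    by (simp add: step_def)
  have "\<bar>h * snd ((step h ^^ Suc k) z)\<bar> \<le> \<bar>h\<bar> * c"
    unfolding abs_mult c_def by (intro mult_left_mono abs_snd_iter) simp
  moreover have "real k * \<bar>h\<bar> * (\<bar>snd z\<bar> + real k * \<bar>h\<bar> * M) \<le> real k * \<bar>h\<bar> * c"
    unfolding c_def using M_nonneg by (intro mult_left_mono add_left_mono mult_right_mono) auto
  moreover have "real (Suc k) * \<bar>h\<bar> * c = real k * \<bar>h\<bar> * c + \<bar>h\<bar> * c"
    by (simp add: algebra_simps)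
  ultimately show ?case
    using Suc e unfolding c_def[symmetric] by linarith
qed simp

text \<open>The scheme differs from the explicit Euler step only by h * h * F in the position, a
  second-order error; the rest is the cost of freezing the field at the reference point p.\<close>

lemma step_error:
  "norm (step h w - w - h *\<^sub>R G p) \<le> \<bar>h\<bar> * (norm (G w - G p) + \<bar>h\<bar> * M)"
proof -
  have e: "step h w - w - h *\<^sub>R G p = h *\<^sub>R (G w - G p) + (h * (h * F w), 0)"
    by (auto simp: step_def G_def prod_eq_iff algebra_simps)
  have "norm (h *\<^sub>R (G w - G p) + (h * (h * F w), 0::real))
      \<le> norm (h *\<^sub>R (G w - G p)) + norm (h * (h * F w), 0::real)"
    by (rule norm_triangle_ineq)
  also have "norm (h * (h * F w), 0::real) = \<bar>h\<bar> * (\<bar>h\<bar> * \<bar>F w\<bar>)"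
    by (simp add: norm_Pair abs_mult)
  also have "\<dots> \<le> \<bar>h\<bar> * (\<bar>h\<bar> * M)"
    by (intro mult_left_mono F_bound) auto
  finally show ?thesis unfolding e by (simp add: distrib_left)
qed

lemma norm_step_diff: "norm (step h z - z) \<le> \<bar>h\<bar> * (\<bar>snd (step h z)\<bar> + M)"
proof -
  have "step h z - z = (h * snd (step h z), h * F z)"
    by (simp add: step_def prod_eq_iff)
  moreover have "norm (h * snd (step h z), h * F z) \<le> \<bar>h * snd (step h z)\<bar> + \<bar>h * F z\<bar>"
    by (metis norm_Pair_le real_norm_def)
  moreover have "\<bar>h\<bar> * \<bar>F z\<bar> \<le> \<bar>h\<bar> * M" by (intro mult_left_mono F_bound) auto
  ultimately show ?thesis by (simp only: abs_mult distrib_left)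
qed

text \<open>Up to time T the velocity is at most \<bar>snd z\<bar> + T * M, and the force
  contributes one further M, whence the factor T + 1. The constant does not depend on h, which is
  what compactness requires.\<close>

lemma iter_lipschitz:
  assumes "k \<le> l" "real l * \<bar>h\<bar> \<le> T"
  shows "norm ((step h ^^ l) z - (step h ^^ k) z)
    \<le> real (l - k) * \<bar>h\<bar> * (\<bar>snd z\<bar> + (T + 1) * M)"
proof -
  have "norm ((step h ^^ l) z - (step h ^^ k) z - real (l - k) *\<^sub>R 0)
      \<le> real (l - k) * (\<bar>h\<bar> * (\<bar>snd z\<bar> + (T + 1) * M))"
  proof (rule telescoping_bound[OF assms(1)])
    fix j assume j: "k \<le> j" "j < l"
    have "real (Suc j) * \<bar>h\<bar> * M \<le> T * M"
    proof (intro mult_right_mono M_nonneg)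
      have "real (Suc j) * \<bar>h\<bar> \<le> real l * \<bar>h\<bar>" using j by (intro mult_right_mono) auto
      then show "real (Suc j) * \<bar>h\<bar> \<le> T" using assms by linarith
    qed
    then have "\<bar>snd (step h ((step h ^^ j) z))\<bar> + M \<le> \<bar>snd z\<bar> + (T + 1) * M"
      using abs_snd_iter[where k = "Suc j" and h = h and z = z] by (simp add: algebra_simps)
    then have "\<bar>h\<bar> * (\<bar>snd (step h ((step h ^^ j) z))\<bar> + M) \<le> \<bar>h\<bar> * (\<bar>snd z\<bar> + (T + 1) * M)"
      by (intro mult_left_mono) auto
    then show "norm ((step h ^^ Suc j) z - (step h ^^ j) z - 0) \<le> \<bar>h\<bar> * (\<bar>snd z\<bar> + (T + 1) * M)"
      using norm_step_diff[of h "(step h ^^ j) z"] by simp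
  qed
  then show ?thesis by (simp add: mult.assoc)
qed

text \<open>Peano's argument in the Arzela-Ascoli style, for paths that are piecewise constant in
  time: extract on a countable dense set of times, extend by equicontinuity, then identify the limit
  through the consistency of the step. The starting points may vary with n, which later gives
  locally uniform convergence.\<close>

lemma scheme_subsequence_converges:
  fixes h :: "nat \<Rightarrow> real"
  assumes T: "0 \<le> T" and \<sigma>: "\<bar>\<sigma>\<bar> = 1"
    and h: "\<And>n. 0 < h n" "h \<longlonglongrightarrow> 0" and zs: "zs \<longlonglongrightarrow> z"
  obtains k y where "strict_mono (k :: nat \<Rightarrow> nat)" "sol \<sigma> T y" "y 0 = z"
    "\<And>t. t \<in> {0..T} \<Longrightarrow>
      (\<lambda>n. (step (\<sigma> * h (k n)) ^^ nat \<lfloor>t / h (k n)\<rfloor>) (zs (k n))) \<longlonglongrightarrow> y t"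
proof -
  define Y where "Y n t = (step (\<sigma> * h n) ^^ nat \<lfloor>t / h n\<rfloor>) (zs n)" for n t
  have ah: "\<bar>\<sigma> * h n\<bar> = h n" for n using \<sigma> h(1)[of n] by (simp add: abs_mult)
  obtain B where B: "\<And>n. norm (zs n) \<le> B"
    using convergent_imp_bounded[OF zs] unfolding bounded_iff by auto
  obtain H where H: "\<And>n. norm (h n) \<le> H"
    using convergent_imp_bounded[OF h(2)] unfolding bounded_iff by auto
  have sB: "\<bar>snd (zs n)\<bar> \<le> B" for n
    using order_trans[OF _ B[of n], of "\<bar>snd (zs n)\<bar>"] norm_snd_le[of "snd (zs n)" "fst (zs n)"] by simp
  define L where "L = B + (T + 1) * M"
  have "0 \<le> B" using B[of 0] norm_ge_zero order_trans by blast
  then have L0: "0 \<le> L" unfolding L_def using T M_nonneg by simp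
  have lipS: "norm ((step (\<sigma> * h n) ^^ l) (zs n) - (step (\<sigma> * h n) ^^ k) (zs n)) \<le> real (l - k) * h n * L"
    if "k \<le> l" "real l * h n \<le> T" for n k l
  proof -
    have "norm ((step (\<sigma> * h n) ^^ l) (zs n) - (step (\<sigma> * h n) ^^ k) (zs n))
        \<le> real (l - k) * h n * (\<bar>snd (zs n)\<bar> + (T + 1) * M)"
      using iter_lipschitz[of k l "\<sigma> * h n" T "zs n"] that unfolding ah by simp
    also have "\<dots> \<le> real (l - k) * h n * L"
      unfolding L_def using sB h(1)[of n] by (intro mult_left_mono) auto
    finally show ?thesis .
  qed
  \<comment> \<open>Times are rounded down to the grid, so the paths are equicontinuous only up to
    one mesh width; this suffices because h tends to 0.\<close>
  have lip: "norm (Y n t - Y n s) \<le> L * (t - s + h n)" if "0 \<le> s" "s \<le> t" "t \<le> T" for n s t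
  proof -
    let ?k = "nat \<lfloor>s / h n\<rfloor>" and ?l = "nat \<lfloor>t / h n\<rfloor>"
    have kl: "?k \<le> ?l" using that h by (intro nat_floor_divide_mono) auto
    have "real ?l * h n \<le> t" "s - h n < real ?k * h n"
      using nat_floor_divide_bounds that h(1)[of n] by auto
    then have "real (?l - ?k) * h n \<le> t - s + h n"
      using kl by (simp add: of_nat_diff algebra_simps)
    moreover have "norm (Y n t - Y n s) \<le> real (?l - ?k) * h n * L"
      unfolding Y_def using kl \<open>real ?l * h n \<le> t\<close> that by (intro lipS) auto
    ultimately show ?thesis
      using mult_right_mono[OF _ L0] by (smt (verit) mult.commute)
  qed
  have Y0: "Y n 0 = zs n" for n by (simp add: Y_def)
  have Ybound: "norm (Y n t) \<le> B + L * (T + H)" if "t \<in> {0..T}" for n t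
  proof -
    have "norm (Y n t - Y n 0) \<le> L * (t - 0 + h n)" using that by (intro lip) auto
    also have "\<dots> \<le> L * (T + H)" using that H[of n] L0 by (intro mult_left_mono) auto
    finally show ?thesis using B[of n] norm_triangle_sub[of "Y n t" "Y n 0"] unfolding Y0 by linarith
  qed
  \<comment> \<open>T is added because times are approximated from the right and T may be
    irrational.\<close>
  define S where "S = insert T (\<rat> \<inter> {0..T})"
  have "countable S" unfolding S_def by (simp add: countable_rat countable_Int1)
  moreover have "norm (Y n x) \<le> B + L * (T + H)" if "x \<in> S" for n x
    using that T unfolding S_def by (intro Ybound) auto
  ultimately obtain k where k: "strict_mono (k::nat\<Rightarrow>nat)"
      "\<And>x. x \<in> S \<Longrightarrow> \<exists>l. (\<lambda>n. Y (k n) x) \<longlonglongrightarrow> l"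
    using function_convergent_subsequence[of S Y] by metis
  have hk: "(\<lambda>n. h (k n)) \<longlonglongrightarrow> 0"
    using LIMSEQ_subseq_LIMSEQ[OF h(2) k(1)] by (simp add: o_def)
  have zk: "(\<lambda>n. zs (k n)) \<longlonglongrightarrow> z"
    using LIMSEQ_subseq_LIMSEQ[OF zs k(1)] by (simp add: o_def)
  have conv: "\<exists>l. (\<lambda>n. Y (k n) t) \<longlonglongrightarrow> l" if t: "t \<in> {0..T}" for t
  proof (rule Cauchy_convergent[unfolded convergent_def])
    show "Cauchy (\<lambda>n. Y (k n) t)"
    proof (rule metric_CauchyI)
      fix e :: real assume e: "0 < e"
      \<comment> \<open>Replacing t by q costs at most L * (d + d), hence e / 4, on each of two
        paths; L + 1 avoids dividing by L = 0.\<close>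
      define d where "d = e / (8 * (L + 1))"
      have d: "0 < d" "L * d \<le> e / 8" using e L0 by (auto simp: d_def field_simps)
      obtain q where q: "q \<in> S" "t \<le> q" "q < t + d" "q \<le> T"
      proof (cases "t = T")
        case True
        then show ?thesis using that[of T] d by (auto simp: S_def)
      next
        case False
        then have "t < min T (t + d)" using t d by auto
        then obtain q where "q \<in> \<rat>" "t < q" "q < min T (t + d)" using Rats_dense_in_real by blast
        then show ?thesis using that[of q] t by (auto simp: S_def)
      qed
      have "Cauchy (\<lambda>n. Y (k n) q)" using k(2)[OF q(1)] by (auto intro: LIMSEQ_imp_Cauchy)
      then obtain N1 where N1: "\<And>m n. m \<ge> N1 \<Longrightarrow> n \<ge> N1 \<Longrightarrow> dist (Y (k m) q) (Y (k n) q) < e / 4"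
        using e by (meson metric_CauchyD zero_less_divide_iff zero_less_numeral)
      obtain N2 where N2: "\<And>n. n \<ge> N2 \<Longrightarrow> h (k n) < d"
        using order_tendstoD(2)[OF hk d(1)] unfolding eventually_sequentially by auto
      have near: "dist (Y (k n) q) (Y (k n) t) \<le> e / 4" if "n \<ge> N2" for n
      proof -
        have "dist (Y (k n) q) (Y (k n) t) \<le> L * (q - t + h (k n))"
          unfolding dist_norm using t q by (intro lip) auto
        also have "\<dots> \<le> L * (d + d)" using q N2[OF that] L0 by (intro mult_left_mono) auto
        finally show ?thesis using d by (simp add: algebra_simps)
      qed
      show "\<exists>N. \<forall>m\<ge>N. \<forall>n\<ge>N. dist (Y (k m) t) (Y (k n) t) < e"
      proof (intro exI[of _ "max N1 N2"] allI impI)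
        fix m n assume "m \<ge> max N1 N2" "n \<ge> max N1 N2"
        then have "dist (Y (k m) q) (Y (k n) q) < e / 4"
          "dist (Y (k n) q) (Y (k n) t) \<le> e / 4" "dist (Y (k m) q) (Y (k m) t) \<le> e / 4"
          using N1 near by auto
        then show "dist (Y (k m) t) (Y (k n) t) < e"
          using dist_triangle[of "Y (k m) t" "Y (k n) t" "Y (k m) q"]
            dist_triangle[of "Y (k m) q" "Y (k n) t" "Y (k n) q"] e
          by (simp add: dist_commute)
      qed
    qed
  qed
  define y where "y t = lim (\<lambda>n. Y (k n) t)" for t
  have y: "(\<lambda>n. Y (k n) t) \<longlonglongrightarrow> y t" if "t \<in> {0..T}" for t
    using conv[OF that] unfolding y_def by (simp add: convergent_LIMSEQ_iff[symmetric] convergent_def)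
  have y0: "y 0 = z"
    using y[of 0] T zk LIMSEQ_unique unfolding Y0 by auto
  \<comment> \<open>A straddling form of differentiability: the slope at s controls every chord from
    a to b with s in between. Taking a = s or b = s gives the two one-sided derivatives at once,
    also at the end points.\<close>
  have key: "\<exists>d>0. \<forall>a b. 0 \<le> a \<and> a \<le> s \<and> s \<le> b \<and> b \<le> T \<and> b - a < d \<longrightarrow>
      norm (y b - y a - (b - a) *\<^sub>R (\<sigma> *\<^sub>R G (y s))) \<le> e * (b - a)"
    if s: "s \<in> {0..T}" and e: "0 < e" for s e
  proof -
    have "isCont G (y s)"
      using cont_F unfolding G_def continuous_on_eq_continuous_at[OF open_UNIV]
      by (intro continuous_intros) (auto simp del: split_paired_All)
    then obtain \<delta> where \<delta>: "0 < \<delta>" "\<And>w. dist w (y s) < \<delta> \<Longrightarrow> dist (G w) (G (y s)) < e / 2"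
      using e unfolding continuous_at_eps_delta by (meson half_gt_zero)
    define d where "d = \<delta> / (4 * (L + 1))"
    have d: "0 < d" "L * d \<le> \<delta> / 4" using \<delta> L0 by (auto simp: d_def field_simps)
    have "norm (y b - y a - (b - a) *\<^sub>R (\<sigma> *\<^sub>R G (y s))) \<le> e * (b - a)"
      if ab: "0 \<le> a" "a \<le> s" "s \<le> b" "b \<le> T" "b - a < d" for a b
    proof -
      define K where "K n t = nat \<lfloor>t / h (k n)\<rfloor>" for n t
      have Kh: "real (K n t) * h (k n) \<le> t" "t - h (k n) < real (K n t) * h (k n)" if "0 \<le> t" for n t
        using nat_floor_divide_bounds[OF that h(1)] by (auto simp: K_def)
      have Klim: "(\<lambda>n. real (K n t) * h (k n)) \<longlonglongrightarrow> t" if "0 \<le> t" for t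
      proof (rule tendsto_sandwich)
        show "(\<lambda>n. t - h (k n)) \<longlonglongrightarrow> t" using tendsto_diff[OF tendsto_const hk] by simp
        show "(\<lambda>n. t) \<longlonglongrightarrow> t" by simp
      qed (use Kh[OF that] in \<open>auto intro!: always_eventually less_imp_le\<close>)
      have Kmono: "K n a \<le> K n s" "K n s \<le> K n b" "K n a \<le> K n b" for n
        using ab h(1) unfolding K_def by (auto intro!: nat_floor_divide_mono)
      have 1: "\<forall>\<^sub>F n in sequentially. h (k n) < d"
        by (rule order_tendstoD(2)[OF hk d(1)])
      have "(\<lambda>n. h (k n) * M) \<longlonglongrightarrow> 0 * M" by (intro tendsto_intros hk)
      then have 2: "\<forall>\<^sub>F n in sequentially. h (k n) * M < e / 2"
        using order_tendstoD(2)[of _ "0 * M" sequentially "e / 2"] e by simp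
      have 3: "\<forall>\<^sub>F n in sequentially. dist (Y (k n) s) (y s) < \<delta> / 4"
        using tendstoD[OF y[OF s], of "\<delta> / 4"] \<delta>(1) by simp
      have ev: "\<forall>\<^sub>F n in sequentially. norm (Y (k n) b - Y (k n) a -
          (real (K n b) * h (k n) - real (K n a) * h (k n)) *\<^sub>R (\<sigma> *\<^sub>R G (y s)))
          \<le> (real (K n b) * h (k n) - real (K n a) * h (k n)) * e"
        using 1 2 3
      proof eventually_elim
        case (elim n)
        let ?S = "\<lambda>j. (step (\<sigma> * h (k n)) ^^ j) (zs (k n))"
        \<comment> \<open>For large n all iterates between the indices of a and b lie within
          \<delta> of y s: they are at most 2 * d * L away from the iterate at time s, which is
          closer than \<delta> / 4 to y s. There the field varies by less than e / 2, and the
          second-order error of the step uses the other half of e.\<close>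
        have "norm (?S (K n b) - ?S (K n a) - real (K n b - K n a) *\<^sub>R ((\<sigma> * h (k n)) *\<^sub>R G (y s)))
            \<le> real (K n b - K n a) * (h (k n) * e)"
        proof (rule telescoping_bound[OF Kmono(3)])
          fix j assume j: "K n a \<le> j" "j < K n b"
          have jl: "real l * h (k n) \<le> T" if "l \<le> K n b" for l
          proof -
            have "real l * h (k n) \<le> real (K n b) * h (k n)"
              using that h(1)[of "k n"] by (intro mult_right_mono) auto
            then show ?thesis using Kh(1)[of b n] ab by linarith
          qed
          have Kab: "real (K n b) * h (k n) - real (K n a) * h (k n) \<le> 2 * d"
            using Kh(1)[of b n] Kh(2)[of a n] ab elim by linarith
          have "norm (?S j - ?S (K n s)) \<le> L * (2 * d)"
          proof (cases "j \<le> K n s")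
            case True
            have "norm (?S (K n s) - ?S j) \<le> real (K n s - j) * h (k n) * L"
              using True jl Kmono by (intro lipS) auto
            also have "\<dots> \<le> real (K n b - K n a) * h (k n) * L"
              using j Kmono[of n] h(1)[of "k n"] L0 by (intro mult_right_mono) auto
            also have "\<dots> \<le> (2 * d) * L"
              using Kab Kmono[of n] L0 by (intro mult_right_mono) (auto simp: of_nat_diff algebra_simps)
            finally show ?thesis by (simp add: norm_minus_commute mult.commute)
          next
            case False
            have "norm (?S j - ?S (K n s)) \<le> real (j - K n s) * h (k n) * L"
              using False jl j by (intro lipS) auto
            also have "\<dots> \<le> real (K n b - K n a) * h (k n) * L"
              using j Kmono[of n] h(1)[of "k n"] L0 by (intro mult_right_mono) auto
            also have "\<dots> \<le> (2 * d) * L"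
              using Kab Kmono[of n] L0 by (intro mult_right_mono) (auto simp: of_nat_diff algebra_simps)
            finally show ?thesis by (simp add: mult.commute)
          qed
          then have "dist (?S j) (Y (k n) s) \<le> \<delta> / 2"
            using d unfolding Y_def dist_norm K_def by simp
          then have "dist (?S j) (y s) < \<delta>"
            using elim(3) dist_triangle[of "?S j" "y s" "Y (k n) s"] \<delta>(1) by linarith
          then have "norm (G (?S j) - G (y s)) < e / 2" using \<delta>(2) by (simp add: dist_norm)
          then have "norm (G (?S j) - G (y s)) + h (k n) * M \<le> e" using elim(2) by linarith
          then have "h (k n) * (norm (G (?S j) - G (y s)) + h (k n) * M) \<le> h (k n) * e"
            using h(1)[of "k n"] by (intro mult_left_mono) auto
          then show "norm (?S (Suc j) - ?S j - (\<sigma> * h (k n)) *\<^sub>R G (y s)) \<le> h (k n) * e"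
            using step_error[of "\<sigma> * h (k n)" "?S j" "y s"] unfolding ah by simp
        qed
        then show ?case
          using Kmono[of n] unfolding Y_def K_def[symmetric]
          by (simp add: of_nat_diff algebra_simps)
      qed
      have l1: "(\<lambda>n. norm (Y (k n) b - Y (k n) a -
          (real (K n b) * h (k n) - real (K n a) * h (k n)) *\<^sub>R (\<sigma> *\<^sub>R G (y s))))
          \<longlonglongrightarrow> norm (y b - y a - (b - a) *\<^sub>R (\<sigma> *\<^sub>R G (y s)))"
        using ab by (intro tendsto_intros y Klim) auto
      have l2: "(\<lambda>n. (real (K n b) * h (k n) - real (K n a) * h (k n)) * e) \<longlonglongrightarrow> (b - a) * e"
        using ab by (intro tendsto_intros Klim) auto
      show ?thesis
        using tendsto_le[OF _ l2 l1 ev] by (simp add: mult.commute)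
    qed
    then show ?thesis using d(1) by blast
  qed
  have "sol \<sigma> T y"
    unfolding sol_def has_vector_derivative_def has_derivative_within_alt
  proof (intro ballI conjI allI impI)
    fix s and e :: real assume s: "s \<in> {0..T}" and e: "0 < e"
    obtain d where d: "d > 0" "\<And>a b. 0 \<le> a \<Longrightarrow> a \<le> s \<Longrightarrow> s \<le> b \<Longrightarrow> b \<le> T \<Longrightarrow> b - a < d \<Longrightarrow>
      norm (y b - y a - (b - a) *\<^sub>R (\<sigma> *\<^sub>R G (y s))) \<le> e * (b - a)"
      using key[OF s e] by blast
    show "\<exists>d>0. \<forall>t\<in>{0..T}. norm (t - s) < d \<longrightarrow>
        norm (y t - y s - (t - s) *\<^sub>R (\<sigma> *\<^sub>R G (y s))) \<le> e * norm (t - s)"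
    proof (intro exI[of _ d] conjI ballI impI d(1))
      fix t assume t: "t \<in> {0..T}" "norm (t - s) < d"
      show "norm (y t - y s - (t - s) *\<^sub>R (\<sigma> *\<^sub>R G (y s))) \<le> e * norm (t - s)"
      proof (cases "s \<le> t")
        case True
        then show ?thesis using d(2)[of s t] t s by auto
      next
        case False
        have "y t - y s - (t - s) *\<^sub>R (\<sigma> *\<^sub>R G (y s)) = - (y s - y t - (s - t) *\<^sub>R (\<sigma> *\<^sub>R G (y s)))"
          by (simp add: algebra_simps)
        then show ?thesis using d(2)[of t s] t s False by (simp only: norm_minus_cancel) auto
      qed
    qed
  qed (auto intro!: bounded_linear_intros)
  then show ?thesis using that[of k y] k(1) y0 y unfolding Y_def by blast
qed

end

section \<open>Change of variables\<close>

text \<open>A derivative bounded below by b > 0 makes \<kappa> an increasing bijection of the line,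
  so preimages of intervals are intervals and the fundamental theorem of calculus gives their
  weighted length. A measure with the right values on intervals is \<open>lborel\<close>.\<close>

lemma distr_density_has_real_derivative:
  fixes \<kappa> \<kappa>' :: "real \<Rightarrow> real"
  assumes d: "\<And>v. (\<kappa> has_real_derivative \<kappa>' v) (at v)"
    and c: "continuous_on UNIV \<kappa>'" and b: "0 < b" "\<And>v. b \<le> \<kappa>' v"
  shows "distr (density lborel (\<lambda>v. ennreal (\<kappa>' v))) borel \<kappa> = lborel"
proof (rule lborel_eqI[symmetric])
  have pos: "0 < \<kappa>' v" for v using b(1) b(2)[of v] by linarith
  have mono: "\<kappa> x < \<kappa> y" if "x < y" for x y
    by (rule DERIV_pos_imp_increasing[OF that]) (use d pos in blast)
  have mono_iff: "\<kappa> x < \<kappa> y \<longleftrightarrow> x < y" for x y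
    using mono[of x y] mono[of y x] by (cases x y rule: linorder_cases) auto
  have cont: "continuous_on S \<kappa>" for S
    by (rule DERIV_continuous_on[where D = \<kappa>']) (rule DERIV_subset[OF d], simp)
  have [measurable]: "\<kappa> \<in> borel_measurable borel" "\<kappa>' \<in> borel_measurable borel"
    using cont c by (auto intro: borel_measurable_continuous_onI)
  have growth: "b * (y - x) \<le> \<kappa> y - \<kappa> x" if xy: "x < y" for x y
  proof -
    obtain w where "\<kappa> y - \<kappa> x = (y - x) * \<kappa>' w" using MVT2[OF xy, of \<kappa> \<kappa>'] d by auto
    then show ?thesis using mult_left_mono[OF b(2)[of w], of "y - x"] xy by (simp add: mult.commute)
  qed
  have surj: "\<exists>a. \<kappa> a = w" for w
  proof -
    \<comment> \<open>Growth at rate at least b carries \<kappa> from \<kappa> 0 past w within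
      distance t on either side; the 1 makes t positive.\<close>
    define t where "t = (\<bar>w - \<kappa> 0\<bar> + 1) / b"
    have t: "0 < t" "b * t = \<bar>w - \<kappa> 0\<bar> + 1" using b(1) by (auto simp: t_def)
    then have "\<kappa> (-t) \<le> w" "w \<le> \<kappa> t" using growth[of "-t" 0] growth[of 0 t] by auto
    then show ?thesis using IVT'[of \<kappa> "-t" w t] t cont by auto
  qed
  fix l u :: real assume lu: "\<And>b. b \<in> Basis \<Longrightarrow> l \<bullet> b \<le> u \<bullet> b"
  then have "l \<le> u" by auto
  obtain p q where pq: "\<kappa> p = l" "\<kappa> q = u" using surj[of l] surj[of u] by auto
  have "p \<le> q" using \<open>l \<le> u\<close> mono_iff[of q p] pq by linarith
  have [measurable]: "\<kappa> -` {l<..<u} \<in> sets borel"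
    using measurable_sets[of \<kappa> borel borel "{l<..<u}"] by simp
  have e: "emeasure (distr (density lborel (\<lambda>v. ennreal (\<kappa>' v))) borel \<kappa>) (box l u)
      = (\<integral>\<^sup>+v. ennreal (\<kappa>' v) * indicator {l<..<u} (\<kappa> v) \<partial>lborel)"
    by (simp add: emeasure_distr emeasure_density box_real indicator_vimage)
  also have "\<dots> = (\<integral>\<^sup>+v. ennreal (\<kappa>' v) * indicator {p..q} v \<partial>lborel)"
  proof (rule nn_integral_cong_AE)
    show "AE v in lborel. ennreal (\<kappa>' v) * indicator {l<..<u} (\<kappa> v) = ennreal (\<kappa>' v) * indicator {p..q} v"
      using AE_lborel_singleton[of p] AE_lborel_singleton[of q]
      by eventually_elim (auto simp: pq[symmetric] mono_iff indicator_def)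
  qed
  also have "\<dots> = ennreal (\<kappa> q - \<kappa> p)"
    using \<open>p \<le> q\<close> d pos by (intro nn_integral_FTC_Icc) (auto intro: less_imp_le DERIV_subset)
  finally show "emeasure (distr (density lborel (\<lambda>v. ennreal (\<kappa>' v))) borel \<kappa>) (box l u)
      = (\<Prod>b\<in>Basis. (u - l) \<bullet> b)"
    using pq by simp
qed simp

context kinetic_field
begin

lemma F_measurable [measurable]: "F \<in> borel_measurable borel"
  and Fv_measurable [measurable]: "Fv \<in> borel_measurable borel"
  using cont_F cont_Fv by (auto intro: borel_measurable_continuous_onI)

lemma continuous_on_step: "continuous_on UNIV (step h)"
  unfolding step_def by (intro continuous_intros cont_F)

lemma continuous_on_iter: "continuous_on UNIV (step h ^^ k)"
  by (induction k) (auto intro!: continuous_on_compose2[OF continuous_on_step] continuous_on_id)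

lemma iter_measurable [measurable]: "(step h ^^ k) \<in> borel_measurable borel"
  by (rule borel_measurable_continuous_onI[OF continuous_on_iter])

lemma step_measurable [measurable]: "step h \<in> borel_measurable borel"
  by (rule borel_measurable_continuous_onI[OF continuous_on_step])

lemma jacobian_bounds:
  assumes "\<bar>h\<bar> * M \<le> 1 / 2"
  shows "1 - \<bar>h\<bar> * M \<le> 1 + h * Fv z" "1 / 2 \<le> 1 + h * Fv z"
proof -
  have "\<bar>h * Fv z\<bar> \<le> \<bar>h\<bar> * M" unfolding abs_mult by (intro mult_left_mono Fv_bound) auto
  then show "1 - \<bar>h\<bar> * M \<le> 1 + h * Fv z" "1 / 2 \<le> 1 + h * Fv z"
    using assms by linarith+
qed

text \<open>The step is a kick in v at fixed x followed by a drift in x at fixed v. Tonelli in the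
  order x outside, v inside turns the kick into a one-dimensional substitution with density 1 + h *
  Fv; in the opposite order the drift is a translation. No x-derivative of F ever enters.\<close>

lemma nn_integral_step:
  assumes h: "\<bar>h\<bar> * M \<le> 1 / 2" and [measurable]: "u \<in> borel_measurable borel"
  shows "(\<integral>\<^sup>+z. ennreal (1 + h * Fv z) * u (step h z) \<partial>lborel) = (\<integral>\<^sup>+z. u z \<partial>lborel)"
proof -
  have slice: "continuous_on UNIV (\<lambda>v. f (x, v))" if "continuous_on UNIV f"
    for f :: "real \<times> real \<Rightarrow> real" and x
    by (intro continuous_on_compose2[OF that] continuous_intros) auto
  have [measurable]: "(\<lambda>v. F (x, v)) \<in> borel_measurable borel" "(\<lambda>v. Fv (x, v)) \<in> borel_measurable borel" for x
    using slice cont_F cont_Fv by (auto intro: borel_measurable_continuous_onI)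
  have kick: "(\<integral>\<^sup>+v. ennreal (1 + h * Fv (x, v)) * w (v + h * F (x, v)) \<partial>lborel) = (\<integral>\<^sup>+v. w v \<partial>lborel)"
    if [measurable]: "w \<in> borel_measurable borel" for w x
  proof -
    have "distr (density lborel (\<lambda>v. ennreal (1 + h * Fv (x, v)))) borel (\<lambda>v. v + h * F (x, v)) = lborel"
    proof (rule distr_density_has_real_derivative[of _ _ "1 / 2"])
      show "((\<lambda>v. v + h * F (x, v)) has_real_derivative 1 + h * Fv (x, v)) (at v)" for v
        by (auto intro!: derivative_eq_intros F_deriv)
      show "continuous_on UNIV (\<lambda>v. 1 + h * Fv (x, v))"
        by (intro continuous_intros slice cont_Fv)
    qed (use jacobian_bounds[OF h] in auto)
    then have "(\<integral>\<^sup>+v. w v \<partial>lborel) =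
        (\<integral>\<^sup>+v. w v \<partial>distr (density lborel (\<lambda>v. ennreal (1 + h * Fv (x, v)))) borel (\<lambda>v. v + h * F (x, v)))"
      by simp
    then show ?thesis by (simp add: nn_integral_distr nn_integral_density)
  qed
  have shift: "(\<integral>\<^sup>+x. w (x + c) \<partial>lborel) = (\<integral>\<^sup>+x. w x \<partial>lborel)"
    if [measurable]: "w \<in> borel_measurable borel" for w and c :: real
    using nn_integral_distr[of "(+) c" lborel borel w] by (simp add: lborel_distr_plus add.commute)
  have split: "(\<integral>\<^sup>+z. w z \<partial>lborel) = (\<integral>\<^sup>+x. \<integral>\<^sup>+v. w (x, v) \<partial>lborel \<partial>lborel)"
    "(\<integral>\<^sup>+z. w z \<partial>lborel) = (\<integral>\<^sup>+v. \<integral>\<^sup>+x. w (x, v) \<partial>lborel \<partial>lborel)"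
    if [measurable]: "w \<in> borel_measurable borel" for w :: "real \<times> real \<Rightarrow> ennreal"
  proof -
    have m: "w \<in> borel_measurable (lborel \<Otimes>\<^sub>M lborel)" by (simp add: lborel_prod)
    show "(\<integral>\<^sup>+z. w z \<partial>lborel) = (\<integral>\<^sup>+x. \<integral>\<^sup>+v. w (x, v) \<partial>lborel \<partial>lborel)"
      using lborel.nn_integral_fst[OF m] by (simp add: lborel_prod)
    show "(\<integral>\<^sup>+z. w z \<partial>lborel) = (\<integral>\<^sup>+v. \<integral>\<^sup>+x. w (x, v) \<partial>lborel \<partial>lborel)"
      using lborel_pair.nn_integral_snd[OF m] by (simp add: lborel_prod)
  qed
  have m1: "(\<lambda>z. ennreal (1 + h * Fv z) * u (step h z)) \<in> borel_measurable borel"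
    by (intro borel_measurable_times_ennreal measurable_compose[OF step_measurable assms(2)]
      measurable_compose[OF _ measurable_ennreal] borel_measurable_add borel_measurable_times
      borel_measurable_const Fv_measurable)
  have "(\<lambda>z::real \<times> real. (fst z + h * snd z, snd z)) \<in> borel_measurable borel"
    by (intro borel_measurable_continuous_onI continuous_intros)
  from measurable_compose[OF this assms(2)]
  have m2: "(\<lambda>z. u (fst z + h * snd z, snd z)) \<in> borel_measurable borel" .
  have ux: "(\<lambda>x. u (x, v)) \<in> borel_measurable borel" for v
    by (rule measurable_compose[OF _ assms(2)]) (intro borel_measurable_continuous_onI continuous_intros)
  have uv: "(\<lambda>v. u (x + h * v, v)) \<in> borel_measurable borel" for x
    by (rule measurable_compose[OF _ assms(2)]) (intro borel_measurable_continuous_onI continuous_intros)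
  have "(\<integral>\<^sup>+z. ennreal (1 + h * Fv z) * u (step h z) \<partial>lborel)
      = (\<integral>\<^sup>+x. \<integral>\<^sup>+v. ennreal (1 + h * Fv (x, v)) * u (x + h * (v + h * F (x, v)), v + h * F (x, v)) \<partial>lborel \<partial>lborel)"
    unfolding split(1)[OF m1] by (simp only: step_def fst_conv snd_conv)
  also have "\<dots> = (\<integral>\<^sup>+x. \<integral>\<^sup>+v. u (x + h * v, v) \<partial>lborel \<partial>lborel)"
    by (rule nn_integral_cong, rule kick[OF uv])
  also have "\<dots> = (\<integral>\<^sup>+z. u (fst z + h * snd z, snd z) \<partial>lborel)"
    unfolding split(1)[OF m2] by (simp only: fst_conv snd_conv)
  also have "\<dots> = (\<integral>\<^sup>+v. \<integral>\<^sup>+x. u (x + h * v, v) \<partial>lborel \<partial>lborel)"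
    unfolding split(2)[OF m2] by (simp only: fst_conv snd_conv)
  also have "\<dots> = (\<integral>\<^sup>+v. \<integral>\<^sup>+x. u (x, v) \<partial>lborel \<partial>lborel)"
    by (rule nn_integral_cong, rule shift[OF ux])
  also have "\<dots> = (\<integral>\<^sup>+z. u z \<partial>lborel)"
    by (rule split(2)[OF assms(2), symmetric])
  finally show ?thesis .
qed

lemma integral_step:
  fixes u :: "real \<times> real \<Rightarrow> real"
  assumes h: "\<bar>h\<bar> * M \<le> 1 / 2" and [measurable]: "u \<in> borel_measurable borel"
  shows "(\<integral>z. (1 + h * Fv z) * u (step h z) \<partial>lborel) = (\<integral>z. u z \<partial>lborel)"
proof -
  have "distr (density lborel (\<lambda>z. ennreal (1 + h * Fv z))) borel (step h) = lborel" (is "?D = _")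
  proof (rule measure_eqI)
    fix A assume "A \<in> sets ?D"
    then have [measurable]: "A \<in> sets borel" by simp
    have [measurable]: "step h -` A \<in> sets borel"
      using measurable_sets[OF step_measurable, of A h] by simp
    have "emeasure ?D A = (\<integral>\<^sup>+z. ennreal (1 + h * Fv z) * indicator A (step h z) \<partial>lborel)"
      by (simp add: emeasure_distr emeasure_density indicator_vimage)
    then show "emeasure ?D A = emeasure lborel A" by (simp add: nn_integral_step[OF h])
  qed simp
  then have "(\<integral>z. u z \<partial>lborel) = (\<integral>z. u z \<partial>?D)" by simp
  also have "\<dots> = (\<integral>z. u (step h z) \<partial>density lborel (\<lambda>z. ennreal (1 + h * Fv z)))"
    by (rule integral_distr) simp_all
  also have "\<dots> = (\<integral>z. (1 + h * Fv z) *\<^sub>R u (step h z) \<partial>lborel)"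
    by (rule integral_density) (auto intro!: AE_I2 order_trans[OF _ jacobian_bounds(2)[OF h]])
  finally show ?thesis by simp
qed

text \<open>The inverse Jacobian of one step is at most exp (2 * M * \<bar>h\<bar>), and k steps
  multiply these factors, so the distortion depends only on the elapsed time k *
  \<bar>h\<bar>.\<close>

lemma emeasure_iter_vimage:
  assumes h: "\<bar>h\<bar> * M \<le> 1 / 2" and B: "B \<in> sets borel"
  shows "emeasure lborel ((step h ^^ k) -` B) \<le> ennreal (exp (2 * M * (real k * \<bar>h\<bar>))) * emeasure lborel B"
proof (induction k)
  case 0
  then show ?case by simp
next
  case (Suc k)
  define P where "P = (step h ^^ k) -` B"
  have P [measurable]: "P \<in> sets borel"
    unfolding P_def using measurable_sets[OF iter_measurable B] by simp
  have P' [measurable]: "step h -` P \<in> sets borel"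
    using measurable_sets[OF step_measurable P] by simp
  define e where "e = exp (2 * M * \<bar>h\<bar>)"
  have "1 \<le> e * (1 + h * Fv z)" for z
  proof -
    have x: "0 \<le> \<bar>h\<bar> * M" using M_nonneg by simp
    \<comment> \<open>With a = \<bar>h\<bar> * M the product is 1 + a * (1 - 2 * a), at least 1 for
      0 \<le> a \<le> 1 / 2; this is the origin of the 2 in the exponent.\<close>
    have "1 \<le> (1 + 2 * (\<bar>h\<bar> * M)) * (1 - \<bar>h\<bar> * M)"
      using mult_left_mono[OF h x] by (simp add: algebra_simps)
    also have "\<dots> \<le> e * (1 + h * Fv z)"
      using exp_ge_add_one_self[of "2 * M * \<bar>h\<bar>"] jacobian_bounds[OF h, of z] h
      unfolding e_def by (intro mult_mono) (auto simp: algebra_simps)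
    finally show ?thesis .
  qed
  then have "ennreal 1 \<le> ennreal (e * (1 + h * Fv z))" for z
    by (rule ennreal_leI)
  then have one: "1 \<le> ennreal e * ennreal (1 + h * Fv z)" for z
    by (simp only: e_def ennreal_1 ennreal_mult'[OF exp_ge_zero])
  have "emeasure lborel (step h -` P) = (\<integral>\<^sup>+z. indicator P (step h z) \<partial>lborel)"
    by (subst indicator_vimage[where f = "step h", symmetric]) (rule nn_integral_indicator[symmetric], simp)
  also have "\<dots> \<le> (\<integral>\<^sup>+z. ennreal e * (ennreal (1 + h * Fv z) * indicator P (step h z)) \<partial>lborel)"
  proof (intro nn_integral_mono)
    fix z show "indicator P (step h z) \<le> ennreal e * (ennreal (1 + h * Fv z) * indicator P (step h z))"
      using one[of z] by (auto simp: indicator_def)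
  qed
  also have "\<dots> = ennreal e * emeasure lborel P"
    by (simp add: nn_integral_cmult nn_integral_step[OF h])
  also have "\<dots> \<le> ennreal e * (ennreal (exp (2 * M * (real k * \<bar>h\<bar>))) * emeasure lborel B)"
    using Suc unfolding P_def by (intro mult_left_mono) auto
  also have "\<dots> = ennreal (exp (2 * M * (real (Suc k) * \<bar>h\<bar>))) * emeasure lborel B"
  proof -
    have "exp (2 * M * (real (Suc k) * \<bar>h\<bar>)) = e * exp (2 * M * (real k * \<bar>h\<bar>))"
      unfolding e_def exp_add[symmetric] by (simp add: algebra_simps)
    then show ?thesis by (simp add: e_def ennreal_mult' mult.assoc)
  qed
  also have "step h -` P = (step h ^^ Suc k) -` B"
    unfolding P_def by (simp add: funpow_Suc_right vimage_comp del: funpow.simps)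
  finally show ?case .
qed

end

section \<open>Almost every path avoids the origin\<close>

context kinetic_field
begin

text \<open>Squares instead of balls: membership splits into the two coordinates, matching the
  separate estimates for position and velocity.\<close>

definition square :: "real \<Rightarrow> (real \<times> real) set" where
  "square d = {-d..d} \<times> {-d..d}"

lemma mem_square: "z \<in> square d \<longleftrightarrow> \<bar>fst z\<bar> \<le> d \<and> \<bar>snd z\<bar> \<le> d"
  by (cases z) (auto simp: square_def)

lemma square_measurable [measurable]: "square d \<in> sets borel"
  unfolding square_def by (intro borel_closed closed_Times) auto

lemma emeasure_square: "0 \<le> d \<Longrightarrow> emeasure lborel (square d) = ennreal (4 * d\<^sup>2)"
  unfolding square_def lborel_prod[symmetric]
  by (subst lborel.emeasure_pair_measure_Times)
    (auto simp: ennreal_mult[symmetric] power2_eq_square)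

definition visits :: "real \<Rightarrow> real \<Rightarrow> real \<Rightarrow> real \<Rightarrow> (real \<times> real) set" where
  "visits T r \<delta> h = {z \<in> square r. \<exists>k. real k * \<bar>h\<bar> \<le> T \<and> (step h ^^ k) z \<in> square \<delta>}"

lemma visits_measurable [measurable]: "visits T r \<delta> h \<in> sets borel"
proof -
  have "visits T r \<delta> h = square r \<inter> (\<Union>k\<in>{k. real k * \<bar>h\<bar> \<le> T}. (step h ^^ k) -` square \<delta>)"
    by (auto simp: visits_def)
  moreover have "(step h ^^ k) -` square \<delta> \<in> sets borel" for k
    using measurable_sets[OF iter_measurable square_measurable] by simp
  ultimately show ?thesis by (auto intro!: sets.countable_UN'')
qed

text \<open>A path of bounded speed that comes \<open>\<delta>\<close>-close to the origin is still \<open>O(\<delta>)\<close>-close to it at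
  one of the \<open>O(1 / \<delta>)\<close> sampling times that are \<open>\<delta>\<close> apart; each of these events has measure
  \<open>O(\<delta>\<^sup>2)\<close> because the step map distorts areas by a bounded factor.\<close>

lemma emeasure_visits:
  assumes h: "\<bar>h\<bar> * M \<le> 1 / 2" "h \<noteq> 0" "\<bar>h\<bar> \<le> \<delta>" and \<delta>: "\<delta> \<le> 1" and T: "0 \<le> T" and r: "0 \<le> r"
  shows "emeasure lborel (visits T r \<delta> h)
    \<le> ennreal ((T + 1) * exp (2 * M * T) * (4 * (1 + 2 * (r + (T + 1) * M))\<^sup>2) * \<delta>)"
proof -
  define L where "L = r + (T + 1) * M"
  \<comment> \<open>The number m is chosen so that m steps take a time between \<delta> and 2 *
    \<delta>. The last sampling time before a visit is then at most 2 * \<delta> earlier, and at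
    speed L the path is still within \<delta> + 2 * \<delta> * L of the origin in each
    coordinate.\<close>
  define d where "d = \<delta> * (1 + 2 * L)"
  define m where "m = nat \<lceil>\<delta> / \<bar>h\<bar>\<rceil>"
  define J where "J = nat \<lfloor>T / \<delta>\<rfloor>"
  have L0: "0 \<le> L" unfolding L_def using r T M_nonneg by simp
  have \<delta>0: "0 < \<delta>" using h by linarith
  have d0: "0 \<le> d" unfolding d_def using L0 \<delta>0 by simp
  have mreal: "real m = of_int \<lceil>\<delta> / \<bar>h\<bar>\<rceil>"
    unfolding m_def using h \<delta>0 by (simp add: of_nat_nat order_less_imp_le)
  have "\<delta> / \<bar>h\<bar> \<le> real m" "real m < \<delta> / \<bar>h\<bar> + 1" unfolding mreal by linarith+
  then have m: "\<delta> \<le> real m * \<bar>h\<bar>" "real m * \<bar>h\<bar> < \<delta> + \<bar>h\<bar>"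
    using h(2) by (auto simp: field_simps)
  have m0: "0 < m" using m(1) \<delta>0 by (cases m) auto
  define I where "I = {j. j \<le> J \<and> real (j * m) * \<bar>h\<bar> \<le> T}"
  have [simp]: "finite I" unfolding I_def by auto
  have sub: "visits T r \<delta> h \<subseteq> (\<Union>j\<in>I. (step h ^^ (j * m)) -` square d)"
  proof
    fix z assume "z \<in> visits T r \<delta> h"
    then obtain k where z: "z \<in> square r" and k: "real k * \<bar>h\<bar> \<le> T" "(step h ^^ k) z \<in> square \<delta>"
      by (auto simp: visits_def)
    define j where "j = k div m"
    have jk: "j * m \<le> k" "k - j * m \<le> m"
      using m0 by (auto simp: j_def minus_div_mult_eq_mod less_imp_le)
    have "real (j * m) * \<bar>h\<bar> \<le> real k * \<bar>h\<bar>"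
      by (intro mult_right_mono of_nat_mono jk) auto
    then have jT: "real (j * m) * \<bar>h\<bar> \<le> T" using k by linarith
    \<comment> \<open>Sampling times are at least \<delta> apart, so at most J + 1 of them fit below
      T.\<close>
    have "real j * \<delta> \<le> real j * (real m * \<bar>h\<bar>)" using m by (intro mult_left_mono) auto
    then have "real j * \<delta> \<le> T" using jT by (simp add: mult.assoc)
    then have "j \<le> J" unfolding J_def using \<delta>0 by (simp add: le_nat_floor field_simps)
    then have "j \<in> I" using jT by (simp add: I_def)
    have "norm ((step h ^^ k) z - (step h ^^ (j * m)) z)
        \<le> real (k - j * m) * \<bar>h\<bar> * (\<bar>snd z\<bar> + (T + 1) * M)"
      by (rule iter_lipschitz[OF jk(1) k(1)])
    also have "\<dots> \<le> (2 * \<delta>) * L"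
    proof (rule mult_mono)
      have "real (k - j * m) * \<bar>h\<bar> \<le> real m * \<bar>h\<bar>"
        by (intro mult_right_mono of_nat_mono jk) auto
      then show "real (k - j * m) * \<bar>h\<bar> \<le> 2 * \<delta>" using m h by linarith
      show "\<bar>snd z\<bar> + (T + 1) * M \<le> L" using z by (simp add: L_def mem_square)
    qed (use \<delta>0 T M_nonneg in auto)
    finally have n: "norm ((step h ^^ k) z - (step h ^^ (j * m)) z) \<le> 2 * \<delta> * L" .
    have "\<bar>fst ((step h ^^ k) z - (step h ^^ (j * m)) z)\<bar> \<le> 2 * \<delta> * L"
      "\<bar>snd ((step h ^^ k) z - (step h ^^ (j * m)) z)\<bar> \<le> 2 * \<delta> * L"
      using n norm_fst_le[of "fst w" "snd w" for w :: "real \<times> real"]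
        norm_snd_le[of "snd w" "fst w" for w :: "real \<times> real"]
      by (metis order_trans prod.collapse real_norm_def)+
    then have "(step h ^^ (j * m)) z \<in> square d"
      using k(2) unfolding mem_square d_def fst_diff snd_diff distrib_left
      by (auto simp: mult.assoc mult.left_commute)
    then show "z \<in> (\<Union>j\<in>I. (step h ^^ (j * m)) -` square d)" using \<open>j \<in> I\<close> by auto
  qed
  have V: "(step h ^^ k) -` square d \<in> sets lborel" for k
    using measurable_sets[OF iter_measurable square_measurable] by simp
  have "emeasure lborel (visits T r \<delta> h) \<le> emeasure lborel (\<Union>j\<in>I. (step h ^^ (j * m)) -` square d)"
    by (intro emeasure_mono sub sets.finite_UN V) simp
  also have "\<dots> \<le> (\<Sum>j\<in>I. emeasure lborel ((step h ^^ (j * m)) -` square d))"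
    by (intro emeasure_subadditive_finite) (use V in auto)
  also have "\<dots> \<le> (\<Sum>j\<in>I. ennreal (exp (2 * M * T) * (4 * d\<^sup>2)))"
  proof (rule sum_mono)
    fix j assume j: "j \<in> I"
    have "exp (2 * M * (real (j * m) * \<bar>h\<bar>)) \<le> exp (2 * M * T)"
      using j M_nonneg unfolding I_def by (auto intro!: mult_left_mono)
    then have "ennreal (exp (2 * M * (real (j * m) * \<bar>h\<bar>))) * ennreal (4 * d\<^sup>2)
        \<le> ennreal (exp (2 * M * T)) * ennreal (4 * d\<^sup>2)"
      by (intro mult_right_mono ennreal_leI) auto
    then show "emeasure lborel ((step h ^^ (j * m)) -` square d) \<le> ennreal (exp (2 * M * T) * (4 * d\<^sup>2))"
      using emeasure_iter_vimage[OF h(1) square_measurable, of "j * m" d]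
      unfolding emeasure_square[OF d0] by (simp add: ennreal_mult')
  qed
  also have "\<dots> = ennreal (real (card I) * (exp (2 * M * T) * (4 * d\<^sup>2)))"
    by (simp add: ennreal_of_nat_eq_real_of_nat ennreal_mult')
  also have "\<dots> \<le> ennreal ((T + 1) * exp (2 * M * T) * (4 * (1 + 2 * L)\<^sup>2) * \<delta>)"
  proof (rule ennreal_leI)
    \<comment> \<open>The area contributes \<delta> twice. One factor pays for the number of
      samples, at most T / \<delta> + 1, where \<delta> \<le> 1 turns the product into T + 1; the
      other survives in the bound.\<close>
    have "card I \<le> card {..J}" by (rule card_mono) (auto simp: I_def)
    then have "real (card I) * \<delta> \<le> (real J + 1) * \<delta>" using \<delta>0 by (intro mult_right_mono) auto
    also have "\<dots> \<le> T + 1"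
      using nat_floor_divide_bounds(1)[OF T \<delta>0] \<delta> by (simp add: J_def algebra_simps)
    finally have c: "real (card I) * \<delta> \<le> T + 1" .
    have "real (card I) * (exp (2 * M * T) * (4 * d\<^sup>2))
        = (real (card I) * \<delta>) * (exp (2 * M * T) * (4 * (1 + 2 * L)\<^sup>2) * \<delta>)"
      by (simp add: d_def power2_eq_square algebra_simps)
    also have "\<dots> \<le> (T + 1) * (exp (2 * M * T) * (4 * (1 + 2 * L)\<^sup>2) * \<delta>)"
      using c \<delta>0 by (intro mult_right_mono) auto
    finally show "real (card I) * (exp (2 * M * T) * (4 * d\<^sup>2))
        \<le> (T + 1) * exp (2 * M * T) * (4 * (1 + 2 * L)\<^sup>2) * \<delta>"
      by (simp add: mult.assoc)
  qed
  finally show ?thesis unfolding L_def .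
qed

text \<open>Dividing by 2 * M + 1 ensures \<open>mesh n * M \<le> 1 / 2\<close>, which keeps the
  Jacobian at least 1 / 2, and \<open>mesh n \<le> 1\<close>, also when M = 0.\<close>

definition mesh :: "nat \<Rightarrow> real" where
  "mesh n = inverse (real (Suc n)) / (2 * M + 1)"

lemma mesh_pos: "0 < mesh n"
  using M_nonneg by (simp add: mesh_def)

lemma mesh_le_1: "mesh n \<le> 1"
proof -
  have "inverse (real (Suc n)) \<le> 1" by (simp add: field_simps)
  then have "inverse (real (Suc n)) \<le> 2 * M + 1" using M_nonneg by linarith
  then show ?thesis using M_nonneg unfolding mesh_def by (subst divide_le_eq_1_pos) auto
qed

lemma mesh_le: "mesh n * M \<le> 1 / 2"
proof -
  have "mesh n * M \<le> 1 / (2 * M + 1) * M"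
    unfolding mesh_def using M_nonneg
    by (intro mult_right_mono divide_right_mono) (auto simp: field_simps)
  also have "\<dots> \<le> 1 / 2" using M_nonneg by (simp add: field_simps)
  finally show ?thesis .
qed

lemma mesh_lim: "mesh \<longlonglongrightarrow> 0"
  unfolding mesh_def using tendsto_divide[OF LIMSEQ_inverse_real_of_nat tendsto_const, of "2 * M + 1"] M_nonneg
  by simp

text \<open>The estimate for visits holds for the discrete paths, not for solutions, which need not
  be unique at this stage. It is carried over by choosing, for almost every z, meshes along which
  the discrete path keeps a fixed distance from the origin, and passing to a limit.\<close>

lemma AE_sol_avoids_origin:
  assumes \<sigma>: "\<bar>\<sigma>\<bar> = 1" and T: "0 \<le> T"
  shows "AE z in lborel. \<exists>y. sol \<sigma> T y \<and> y 0 = z \<and> (\<forall>t\<in>{0..T}. y t \<noteq> 0)"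
proof -
  define \<delta> where "\<delta> i = inverse (real (Suc i))" for i
  define V where "V r i n = visits T (real r) (\<delta> i) (\<sigma> * mesh n)" for r i n
  \<comment> \<open>The lower limit of the sets V r i n: starting points whose path visits the small
    square for all late n. Each intersection is contained in a single late V r i n, so its measure
    is O(\<delta> i) and no summability in n is required.\<close>
  define N where "N r i = (\<Union>k. \<Inter>n\<in>{k..}. V r i n)" for r i
  have \<delta>: "0 < \<delta> i" "\<delta> i \<le> 1" for i by (auto simp: \<delta>_def field_simps)
  have ah: "\<bar>\<sigma> * mesh n\<bar> = mesh n" for n using \<sigma> mesh_pos[of n] by (simp add: abs_mult)
  have Vm [measurable]: "V r i n \<in> sets lborel" for r i n unfolding V_def by simp
  have Im: "(\<Inter>n\<in>{k..}. V r i n) \<in> sets lborel" for r i k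
    by (intro sets.countable_INT'' Vm) auto
  have Nm: "N r i \<in> sets lborel" for r i
    unfolding N_def using Im by (intro sets.countable_UN) auto
  have null: "(\<Inter>i. N r i) \<in> null_sets lborel" for r
  proof (rule null_setsI)
    show "(\<Inter>i. N r i) \<in> sets lborel" using Nm by (intro sets.countable_INT) auto
    define C where "C = (T + 1) * exp (2 * M * T) * (4 * (1 + 2 * (real r + (T + 1) * M))\<^sup>2)"
    have N: "emeasure lborel (N r i) \<le> ennreal (C * \<delta> i)" for i
    proof -
      obtain n0 where n0: "\<And>n. n \<ge> n0 \<Longrightarrow> mesh n < \<delta> i"
        using order_tendstoD(2)[OF mesh_lim \<delta>(1)] unfolding eventually_sequentially by auto
      have "emeasure lborel (N r i) = (SUP k. emeasure lborel (\<Inter>n\<in>{k..}. V r i n))"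
        unfolding N_def using Im by (intro SUP_emeasure_incseq[symmetric]) (auto simp: incseq_def)
      also have "\<dots> \<le> ennreal (C * \<delta> i)"
      proof (rule SUP_least)
        fix k
        have "emeasure lborel (\<Inter>n\<in>{k..}. V r i n) \<le> emeasure lborel (V r i (max k n0))"
          by (intro emeasure_mono Vm) auto
        also have "\<dots> \<le> ennreal (C * \<delta> i)"
          unfolding V_def C_def using n0[of "max k n0"] mesh_le mesh_pos[of "max k n0"] \<delta> T \<sigma>
          by (intro emeasure_visits) (auto simp: ah)
        finally show "emeasure lborel (\<Inter>n\<in>{k..}. V r i n) \<le> ennreal (C * \<delta> i)" .
      qed
      finally show ?thesis .
    qed
    have "(\<lambda>i. ennreal (C * \<delta> i)) \<longlonglongrightarrow> ennreal (C * 0)"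
      unfolding \<delta>_def by (intro tendsto_ennrealI tendsto_mult tendsto_const LIMSEQ_inverse_real_of_nat)
    moreover have "emeasure lborel (\<Inter>i. N r i) \<le> ennreal (C * \<delta> i)" for i
      using N[of i] by (rule order_trans[rotated]) (intro emeasure_mono Nm INT_lower, auto)
    ultimately have "emeasure lborel (\<Inter>i. N r i) \<le> ennreal (C * 0)"
      by (intro LIMSEQ_le_const) auto
    then show "emeasure lborel (\<Inter>i. N r i) = 0" by simp
  qed
  have "AE z in lborel. \<forall>r. z \<notin> (\<Inter>i. N r i)"
    unfolding AE_all_countable using null by (blast intro: AE_not_in)
  then show ?thesis
  proof (rule AE_mp, intro AE_I2 impI)
    fix z :: "real \<times> real" assume z: "\<forall>r. z \<notin> (\<Inter>i. N r i)"
    obtain r :: nat where r: "norm z \<le> real r" using real_arch_simple by blast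
    obtain i where "z \<notin> N r i" using z by blast
    then have "\<exists>n\<ge>k. z \<notin> V r i n" for k unfolding N_def by auto
    \<comment> \<open>Outside the lower limit only infinitely many meshes are good, which is enough
      since compactness passes to a subsequence anyway.\<close>
    then have "infinite {n. z \<notin> V r i n}"
      unfolding infinite_nat_iff_unbounded_le by auto
    then obtain p :: "nat \<Rightarrow> nat" where p: "strict_mono p" "\<And>n. z \<notin> V r i (p n)"
      using infinite_enumerate[of "{n. z \<notin> V r i n}"] by auto
    have ml: "(\<lambda>n. mesh (p n)) \<longlonglongrightarrow> 0"
      using LIMSEQ_subseq_LIMSEQ[OF mesh_lim p(1)] by (simp add: o_def)
    obtain k y where ky: "strict_mono (k :: nat \<Rightarrow> nat)" "sol \<sigma> T y" "y 0 = z"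
      "\<And>t. t \<in> {0..T} \<Longrightarrow>
        (\<lambda>n. (step (\<sigma> * mesh (p (k n))) ^^ nat \<lfloor>t / mesh (p (k n))\<rfloor>) z) \<longlonglongrightarrow> y t"
      using scheme_subsequence_converges[OF T \<sigma>, of "\<lambda>n. mesh (p n)" "\<lambda>_. z" z, OF mesh_pos ml tendsto_const] by blast
    have "y t \<noteq> 0" if t: "t \<in> {0..T}" for t
    proof
      assume "y t = 0"
      then have "\<forall>\<^sub>F n in sequentially.
          dist ((step (\<sigma> * mesh (p (k n))) ^^ nat \<lfloor>t / mesh (p (k n))\<rfloor>) z) 0 < \<delta> i"
        using tendstoD[OF ky(4)[OF t] \<delta>(1)] by simp
      then obtain n where n: "norm ((step (\<sigma> * mesh (p (k n))) ^^ nat \<lfloor>t / mesh (p (k n))\<rfloor>) z) < \<delta> i"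
        by (auto dest: eventually_happens)
      define w where "w = (step (\<sigma> * mesh (p (k n))) ^^ nat \<lfloor>t / mesh (p (k n))\<rfloor>) z"
      have sq: "u \<in> square e" if "norm u \<le> e" for u e
        using norm_fst_le[of "fst u" "snd u"] norm_snd_le[of "snd u" "fst u"] that
        unfolding mem_square by simp
      have "w \<in> square (\<delta> i)" using n by (intro sq) (simp add: w_def)
      moreover have "real (nat \<lfloor>t / mesh (p (k n))\<rfloor>) * mesh (p (k n)) \<le> T"
        using nat_floor_divide_bounds(1)[OF _ mesh_pos, of t "p (k n)"] t by auto
      ultimately have "z \<in> V r i (p (k n))"
        unfolding V_def visits_def w_def using sq[OF r] by (auto simp: ah)
      then show False using p(2) by auto
    qed
    then show "\<exists>y. sol \<sigma> T y \<and> y 0 = z \<and> (\<forall>t\<in>{0..T}. y t \<noteq> 0)" using ky(2,3) by blast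
  qed
qed

end

section \<open>Transport along the backward flow\<close>

context kinetic_field
begin

lemma sol_restrict: "sol \<sigma> T y \<Longrightarrow> t \<le> T \<Longrightarrow> sol \<sigma> t y"
  unfolding sol_def by (meson atLeastatMost_subset_iff has_vector_derivative_within_subset order_refl subsetD)

lemma sol_continuous_on: "sol \<sigma> T y \<Longrightarrow> continuous_on {0..T} y"
  unfolding sol_def by (intro continuous_on_vector_derivative) blast

text \<open>The bounded force confines all discrete paths up to time T to one square independent of
  h; a continuous f0 is bounded there, uniformly in the mesh.\<close>

lemma iter_in_square:
  assumes "z \<in> square r" "real k * \<bar>h\<bar> \<le> T"
  shows "(step h ^^ k) z \<in> square (r + (T + 1) * (r + T * M))"
proof -
  define c where "c = \<bar>snd z\<bar> + real k * \<bar>h\<bar> * M"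
  have kM: "real k * \<bar>h\<bar> * M \<le> T * M" by (intro mult_right_mono assms M_nonneg)
  have c: "c \<le> r + T * M" "0 \<le> c" unfolding c_def using assms(1) kM M_nonneg by (auto simp: mem_square)
  have T0: "0 \<le> T" using assms(2) by (smt (verit) abs_ge_zero of_nat_0_le_iff mult_nonneg_nonneg)
  have "real k * \<bar>h\<bar> * c \<le> T * (r + T * M)" using assms(2) c T0 by (intro mult_mono) auto
  then have "\<bar>fst ((step h ^^ k) z)\<bar> \<le> r + T * (r + T * M)"
    using abs_fst_iter[where k = k and h = h and z = z] assms(1) unfolding c_def mem_square by linarith
  moreover have "\<bar>snd ((step h ^^ k) z)\<bar> \<le> r + T * M"
    using abs_snd_iter[where k = k and h = h and z = z] c unfolding c_def by linarith
  moreover have "0 \<le> r" "0 \<le> T * (r + T * M)" "0 \<le> r + T * M"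
    using assms(1) c T0 by (auto simp: mem_square)
  ultimately show ?thesis unfolding mem_square distrib_right by simp
qed

lemma integrable_square:
  fixes u :: "real \<times> real \<Rightarrow> real"
  assumes [measurable]: "u \<in> borel_measurable borel"
    and "\<And>z. z \<in> square r \<Longrightarrow> \<bar>u z\<bar> \<le> C" "\<And>z. z \<notin> square r \<Longrightarrow> u z = 0"
  shows "integrable lborel u"
proof (rule integrableI_bounded_set[where A = "square r" and B = C])
  have "square r \<subseteq> square \<bar>r\<bar>" by (auto simp: mem_square)
  then have "emeasure lborel (square r) \<le> emeasure lborel (square \<bar>r\<bar>)" by (intro emeasure_mono) auto
  then show "emeasure lborel (square r) < \<infinity>"
    unfolding emeasure_square[OF abs_ge_zero] using ennreal_less_top le_less_trans infinity_ennreal_def by metis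
qed (use assms in auto)

end

text \<open>Only \<open>y1\<close> has to avoid the origin. This asymmetry is essential for
  compactness arguments, where nothing of the kind is known about the limit that plays the role of
  \<open>y2\<close>.\<close>

locale kinetic_flow = kinetic_field +
  assumes unique: "\<bar>\<sigma>\<bar> = 1 \<Longrightarrow> 0 \<le> T \<Longrightarrow> sol \<sigma> T y1 \<Longrightarrow> sol \<sigma> T y2 \<Longrightarrow> y1 0 = y2 0 \<Longrightarrow>
    (\<And>t. t \<in> {0..T} \<Longrightarrow> y1 t \<noteq> 0) \<Longrightarrow> y1 T = y2 T"
begin

text \<open>A subsequence staying away from y T would have a further subsequence converging to some
  solution from y 0, and uniqueness identifies that solution with y.\<close>

lemma scheme_converges:
  fixes h :: "nat \<Rightarrow> real"
  assumes \<sigma>: "\<bar>\<sigma>\<bar> = 1" and T: "0 \<le> T" and y: "sol \<sigma> T y" "\<And>t. t \<in> {0..T} \<Longrightarrow> y t \<noteq> 0"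
    and h: "\<And>n. 0 < h n" "h \<longlonglongrightarrow> 0" and zs: "zs \<longlonglongrightarrow> y 0"
  shows "(\<lambda>n. (step (\<sigma> * h n) ^^ nat \<lfloor>T / h n\<rfloor>) (zs n)) \<longlonglongrightarrow> y T" (is "?a \<longlonglongrightarrow> _")
proof (rule tendstoI, rule ccontr)
  fix e :: real assume e: "0 < e" and "\<not> (\<forall>\<^sub>F n in sequentially. dist (?a n) (y T) < e)"
  then have "infinite {n. \<not> dist (?a n) (y T) < e}"
    unfolding infinite_nat_iff_unbounded_le eventually_sequentially by auto
  then obtain p :: "nat \<Rightarrow> nat" where p: "strict_mono p" "\<And>n. \<not> dist (?a (p n)) (y T) < e"
    using infinite_enumerate[of "{n. \<not> dist (?a n) (y T) < e}"] by auto
  have hp: "(\<lambda>n. h (p n)) \<longlonglongrightarrow> 0" "(\<lambda>n. zs (p n)) \<longlonglongrightarrow> y 0"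
    using LIMSEQ_subseq_LIMSEQ[OF h(2) p(1)] LIMSEQ_subseq_LIMSEQ[OF zs p(1)] by (simp_all add: o_def)
  obtain k y' where ky: "strict_mono (k :: nat \<Rightarrow> nat)" "sol \<sigma> T y'" "y' 0 = y 0"
    "\<And>t. t \<in> {0..T} \<Longrightarrow>
      (\<lambda>n. (step (\<sigma> * h (p (k n))) ^^ nat \<lfloor>t / h (p (k n))\<rfloor>) (zs (p (k n)))) \<longlonglongrightarrow> y' t"
    using scheme_subsequence_converges[OF T \<sigma>, of "\<lambda>n. h (p n)" "\<lambda>n. zs (p n)" "y 0", OF h(1) hp] by blast
  have "y T = y' T" using unique[OF \<sigma> T y(1) ky(2)] ky(3) y(2) by simp
  then have "\<forall>\<^sub>F n in sequentially. dist (?a (p (k n))) (y T) < e"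
    using tendstoD[OF ky(4)[of T] e] T by simp
  then show False using p(2) by (auto dest: eventually_happens)
qed

section \<open>The transported function as a limit of the scheme\<close>

definition scheme :: "(real \<times> real \<Rightarrow> real) \<Rightarrow> nat \<Rightarrow> real \<Rightarrow> real \<times> real \<Rightarrow> real" where
  "scheme f0 n s z = f0 ((step (- mesh n) ^^ nat \<lfloor>s / mesh n\<rfloor>) z)"

text \<open>A limit of the discrete functions rather than a composition with a flow: it is defined
  at every point, also where backward paths branch, and joint measurability in (s, z) is inherited
  from the scheme.\<close>

definition transported :: "(real \<times> real \<Rightarrow> real) \<Rightarrow> real \<Rightarrow> real \<times> real \<Rightarrow> real" where
  "transported f0 s z = lim (\<lambda>n. scheme f0 n s z)"

context
  fixes f0 :: "real \<times> real \<Rightarrow> real"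
  assumes f0: "continuous_on UNIV f0"
begin

lemma f0_measurable [measurable]: "f0 \<in> borel_measurable borel"
  using f0 by (rule borel_measurable_continuous_onI)

text \<open>The mesh index p n and the starting point zs n vary together, as in the diagonal choices
  that prove convergence to be uniform near a point.\<close>

lemma scheme_LIMSEQ:
  assumes "0 \<le> s" "sol (-1) s y" "\<And>t. t \<in> {0..s} \<Longrightarrow> y t \<noteq> 0" "zs \<longlonglongrightarrow> y 0"
    and p: "filterlim p at_top sequentially"
  shows "(\<lambda>n. scheme f0 (p n) s (zs n)) \<longlonglongrightarrow> f0 (y s)"
proof -
  have "(\<lambda>n. mesh (p n)) \<longlonglongrightarrow> 0" by (rule filterlim_compose[OF mesh_lim p])
  from scheme_converges[OF _ assms(1-3) mesh_pos this assms(4)]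
  have l: "(\<lambda>n. (step (- mesh (p n)) ^^ nat \<lfloor>s / mesh (p n)\<rfloor>) (zs n)) \<longlonglongrightarrow> y s" by simp
  have "isCont f0 (y s)" using f0 by (simp add: continuous_on_eq_continuous_at del: split_paired_All)
  from isCont_tendsto_compose[OF this l] show ?thesis unfolding scheme_def .
qed

lemma scheme_pointwise:
  assumes "0 \<le> s" "sol (-1) s y" "\<And>t. t \<in> {0..s} \<Longrightarrow> y t \<noteq> 0"
  shows "(\<lambda>n. scheme f0 n s (y 0)) \<longlonglongrightarrow> f0 (y s)" "transported f0 s (y 0) = f0 (y s)"
proof -
  show l: "(\<lambda>n. scheme f0 n s (y 0)) \<longlonglongrightarrow> f0 (y s)"
    using scheme_LIMSEQ[OF assms tendsto_const filterlim_ident] by simp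
  show "transported f0 s (y 0) = f0 (y s)" unfolding transported_def by (rule limI[OF l])
qed

text \<open>One null set serves all times, because a solution that avoids the origin up to T does so
  up to every earlier s.\<close>

lemma AE_scheme_converges:
  assumes T: "0 \<le> T"
  shows "AE z in lborel. \<forall>s\<in>{0..T}. (\<lambda>n. scheme f0 n s z) \<longlonglongrightarrow> transported f0 s z"
proof -
  have "AE z in lborel. \<exists>y. sol (-1) T y \<and> y 0 = z \<and> (\<forall>t\<in>{0..T}. y t \<noteq> 0)"
    by (rule AE_sol_avoids_origin) (use T in auto)
  then show ?thesis
  proof (rule AE_mp, intro AE_I2 impI ballI)
    fix z s assume s: "s \<in> {0..T}"
    assume "\<exists>y. sol (-1) T y \<and> y 0 = z \<and> (\<forall>t\<in>{0..T}. y t \<noteq> 0)"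
    then obtain y where y: "sol (-1) T y" "y 0 = z" "\<forall>t\<in>{0..T}. y t \<noteq> 0" by blast
    have ys: "sol (-1) s y" "\<And>t. t \<in> {0..s} \<Longrightarrow> y t \<noteq> 0" using sol_restrict[OF y(1)] y(3) s by auto
    show "(\<lambda>n. scheme f0 n s z) \<longlonglongrightarrow> transported f0 s z"
      using scheme_pointwise[OF _ ys] s unfolding y(2) by auto
  qed
qed

lemma scheme_bound:
  obtains B where "0 \<le> B" "\<And>n s z. 0 \<le> s \<Longrightarrow> s \<le> T \<Longrightarrow> z \<in> square r \<Longrightarrow> \<bar>scheme f0 n s z\<bar> \<le> B"
proof -
  define S where "S = square (r + (T + 1) * (r + T * M))"
  have "compact S" unfolding S_def square_def by (intro compact_Times) auto
  then have "compact (f0 ` S)" using f0 by (intro compact_continuous_image) (auto intro: continuous_on_subset)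
  then obtain B where B: "\<And>z. z \<in> S \<Longrightarrow> \<bar>f0 z\<bar> \<le> B"
    using compact_imp_bounded[of "f0 ` S"] unfolding bounded_iff by auto
  show ?thesis
  proof (rule that[of "\<bar>B\<bar>"])
    fix n s and z :: "real \<times> real" assume s: "0 \<le> s" "s \<le> T" and z: "z \<in> square r"
    have "real (nat \<lfloor>s / mesh n\<rfloor>) * \<bar>- mesh n\<bar> \<le> T"
      using nat_floor_divide_bounds(1)[OF s(1) mesh_pos] mesh_pos[of n] s(2) by (auto intro: order_trans)
    then have "(step (- mesh n) ^^ nat \<lfloor>s / mesh n\<rfloor>) z \<in> S" unfolding S_def by (rule iter_in_square[OF z])
    from B[OF this] show "\<bar>scheme f0 n s z\<bar> \<le> \<bar>B\<bar>" unfolding scheme_def by linarith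
  qed simp
qed

text \<open>Where the limit does not exist, \<open>lim\<close> returns one fixed unspecified number.\<close>

lemma transported_bound:
  obtains B where "0 \<le> B" "\<And>s z. 0 \<le> s \<Longrightarrow> s \<le> T \<Longrightarrow> z \<in> square r \<Longrightarrow> \<bar>transported f0 s z\<bar> \<le> B"
proof -
  obtain B where B: "0 \<le> B" "\<And>n s z. 0 \<le> s \<Longrightarrow> s \<le> T \<Longrightarrow> z \<in> square r \<Longrightarrow> \<bar>scheme f0 n s z\<bar> \<le> B"
    using scheme_bound[of T r] by blast
  define c :: real where "c = (THE L. False)"
  show ?thesis
  proof (rule that[of "max B \<bar>c\<bar>"])
    fix s and z :: "real \<times> real" assume sz: "0 \<le> s" "s \<le> T" "z \<in> square r"
    show "\<bar>transported f0 s z\<bar> \<le> max B \<bar>c\<bar>"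
    proof (cases "\<exists>L. (\<lambda>n. scheme f0 n s z) \<longlonglongrightarrow> L")
      case True
      then obtain L where L: "(\<lambda>n. scheme f0 n s z) \<longlonglongrightarrow> L" by blast
      have "\<bar>L\<bar> \<le> B" by (rule LIMSEQ_le_const2[OF tendsto_rabs[OF L]]) (use B(2)[OF sz] in auto)
      then show ?thesis using limI[OF L] by (simp add: transported_def)
    next
      case False
      then show ?thesis by (simp add: transported_def lim_def c_def)
    qed
  qed (use B in auto)
qed

text \<open>Time enters only through the number of steps, so the function is a countable patchwork
  of continuous functions of z.\<close>

lemma scheme_measurable: "(\<lambda>x. scheme f0 n (fst x) (snd x)) \<in> borel_measurable borel"
proof -
  have i: "(\<lambda>x :: real \<times> real \<times> real. f0 ((step (- mesh n) ^^ i) (snd x))) \<in> borel_measurable borel"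
    for i
    by (rule measurable_compose[OF _ f0_measurable],
      rule measurable_compose[OF _ iter_measurable], rule borel_measurable_continuous_onI,
      intro continuous_intros)
  have g: "(\<lambda>x::real \<times> real \<times> real. nat \<lfloor>fst x / mesh n\<rfloor>) \<in> measurable borel (count_space UNIV)"
  proof -
    have [measurable]: "(fst :: real \<times> real \<times> real \<Rightarrow> real) \<in> borel_measurable borel"
      by (intro borel_measurable_continuous_onI continuous_intros)
    show ?thesis by measurable
  qed
  show ?thesis unfolding scheme_def
    by (rule measurable_compose_countable[where f = "\<lambda>i x. f0 ((step (- mesh n) ^^ i) (snd x))", OF i g])
qed

lemma scheme_measurable' [measurable]: "scheme f0 n s \<in> borel_measurable borel"
  unfolding scheme_def by measurable

lemma transported_measurable: "(\<lambda>x. transported f0 (fst x) (snd x)) \<in> borel_measurable borel"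
  unfolding transported_def by (intro borel_measurable_lim_metric scheme_measurable)

lemma transported_measurable' [measurable]: "transported f0 s \<in> borel_measurable borel"
  unfolding transported_def by measurable

lemma transported_0: "transported f0 0 = f0"
  by (rule ext) (simp add: transported_def scheme_def)

end

end

section \<open>The weak form\<close>

text \<open>Writes a Riemann sum as an integral. The cell [k * h, (k + 1) * h) carries b k, and
  since the weak form of the scheme sums from k = 1, the interval starts at h and ends one cell
  after K * h.\<close>

lemma has_bochner_integral_step_function:
  fixes b :: "nat \<Rightarrow> real"
  assumes h: "0 < h"
  shows "has_bochner_integral lborel (\<lambda>s. indicator {h..<real (Suc K) * h} s * b (nat \<lfloor>s / h\<rfloor>))
    (h * (\<Sum>k=1..K. b k))"
proof (induction K)
  case 0
  then show ?case by (simp add: has_bochner_integral_zero)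
next
  case (Suc K)
  let ?I = "{real (Suc K) * h..<real (Suc (Suc K)) * h}"
  have "has_bochner_integral lborel (\<lambda>s. indicator ?I s *\<^sub>R b (Suc K)) (measure lborel ?I *\<^sub>R b (Suc K))"
    using h by (intro has_bochner_integral_indicator) (auto simp: emeasure_lborel_Ico)
  moreover have "measure lborel ?I = h"
    using h by (subst measure_lborel_Ico) (auto simp: algebra_simps)
  ultimately have "has_bochner_integral lborel (\<lambda>s. indicator ?I s * b (Suc K)) (h * b (Suc K))"
    by simp
  from has_bochner_integral_add[OF Suc.IH this]
  have "has_bochner_integral lborel (\<lambda>s. indicator {h..<real (Suc K) * h} s * b (nat \<lfloor>s / h\<rfloor>)
      + indicator ?I s * b (Suc K)) (h * (\<Sum>k=1..Suc K. b k))"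
    by (simp add: algebra_simps)
  moreover have "indicator {h..<real (Suc K) * h} s * b (nat \<lfloor>s / h\<rfloor>) + indicator ?I s * b (Suc K)
      = indicator {h..<real (Suc (Suc K)) * h} s * b (nat \<lfloor>s / h\<rfloor>)" for s
  proof (cases "s \<in> ?I")
    case True
    then have "real (Suc K) \<le> s / h" "s / h < real (Suc K) + 1" using h by (simp_all add: field_simps)
    then have "\<lfloor>s / h\<rfloor> = int (Suc K)" by (intro floor_unique) simp_all
    then have f: "nat \<lfloor>s / h\<rfloor> = Suc K" by simp
    have "1 * h \<le> real (Suc K) * h" using h by (intro mult_right_mono) auto
    then have "h \<le> s" using True by simp
    then show ?thesis using True f by (simp add: indicator_def)
  next
    case False
    have "real (Suc K) * h \<le> real (Suc (Suc K)) * h" using h by (intro mult_right_mono) auto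
    then have "indicator {h..<real (Suc K) * h} s = (indicator {h..<real (Suc (Suc K)) * h} s :: real)"
      using False by (auto simp: indicator_def)
    then show ?thesis using False by simp
  qed
  ultimately show ?case by simp
qed

context kinetic_flow
begin

context
  fixes f0 \<phi> :: "real \<times> real \<Rightarrow> real" and \<phi>' :: "real \<times> real \<Rightarrow> real \<times> real \<Rightarrow> real" and K r :: real
  assumes f0: "continuous_on UNIV f0"
    and \<phi>': "\<And>z. (\<phi> has_derivative \<phi>' z) (at z)"
    and K: "\<And>z w. \<bar>\<phi> z - \<phi> w\<bar> \<le> K * norm (z - w)"
    and r: "\<And>z. z \<notin> square r \<Longrightarrow> \<phi> z = 0"
begin

text \<open>The discrete adjoint of the generator: the change of \<phi> under one backward step,
  weighted by the Jacobian of that step, per unit of time.\<close>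

definition discrete_op :: "nat \<Rightarrow> real \<times> real \<Rightarrow> real" where
  "discrete_op n z = (\<phi> z - \<phi> (step (- mesh n) z) * (1 - mesh n * Fv z)) / mesh n"

text \<open>This is v * D_x \<phi> + D_v (F * \<phi>), with the last term expanded by the product
  rule.\<close>

definition transport_op :: "real \<times> real \<Rightarrow> real" where
  "transport_op z = snd z * \<phi>' z (1, 0) + (Fv z * \<phi> z + F z * \<phi>' z (0, 1))"

section \<open>Limit, support and bounds of the discretised operator\<close>

lemma K_nonneg: "0 \<le> K"
  using K[of "(1, 0)" "(0, 0)"] by (simp add: norm_Pair)

lemma \<phi>_measurable [measurable]: "\<phi> \<in> borel_measurable borel"
  using \<phi>' by (intro borel_measurable_continuous_onI) (meson continuous_at_imp_continuous_on has_derivative_continuous)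

lemma discrete_op_measurable [measurable]: "discrete_op n \<in> borel_measurable borel"
  unfolding discrete_op_def by measurable

text \<open>Up to sign this is the difference quotient at 0 of h \<mapsto> \<phi> (step (- h) z) *
  (1 - h * Fv z). The curve h \<mapsto> step (- h) z is differentiable at 0 with velocity -(v, F),
  for fixed z, so the roughness of F in x does not matter.\<close>

lemma discrete_op_LIMSEQ: "(\<lambda>n. discrete_op n z) \<longlonglongrightarrow> transport_op z"
proof -
  define g where "g h = \<phi> (step (- h) z) * (1 - h * Fv z)" for h
  have s: "((\<lambda>h. step (- h) z) has_derivative (\<lambda>h. h *\<^sub>R (- snd z, - F z))) (at 0)"
    unfolding step_def by (auto intro!: derivative_eq_intros simp: algebra_simps)
  have s0: "step (- 0) z = z" by (simp add: step_def)
  have "((\<lambda>h. \<phi> (step (- h) z)) has_derivative (\<lambda>h. \<phi>' z (h *\<^sub>R (- snd z, - F z)))) (at 0)"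
    using has_derivative_compose[OF s, of \<phi> "\<phi>' z"] \<phi>'[of z] unfolding s0 by simp
  moreover have "linear (\<phi>' z)" using \<phi>'[of z] by (rule has_derivative_linear)
  ultimately have d: "((\<lambda>h. \<phi> (step (- h) z)) has_real_derivative \<phi>' z (- snd z, - F z)) (at 0)"
    unfolding has_field_derivative_def by (simp add: linear_scale mult_commute_abs del: scaleR_Pair)
  have e: "\<phi>' z (- snd z, - F z) = - (snd z * \<phi>' z (1, 0) + F z * \<phi>' z (0, 1))"
  proof -
    have "(- snd z, - F z) = (- snd z) *\<^sub>R (1, 0) + (- F z) *\<^sub>R (0, 1)" by simp
    then show ?thesis
      by (simp only: linear_add[OF \<open>linear (\<phi>' z)\<close>] linear_scale[OF \<open>linear (\<phi>' z)\<close>]) simp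
  qed
  have "(g has_real_derivative - transport_op z) (at 0)"
    unfolding g_def by (rule derivative_eq_intros d refl)+ (simp add: s0[simplified] e transport_op_def)
  then have "(\<lambda>h. (g (0 + h) - g 0) / h) \<midarrow>0\<rightarrow> - transport_op z" by (rule DERIV_D)
  moreover have "filterlim mesh (at 0) sequentially"
    using mesh_lim mesh_pos by (auto simp: filterlim_at less_imp_neq[OF mesh_pos, symmetric])
  ultimately have "(\<lambda>n. (g (0 + mesh n) - g 0) / mesh n) \<longlonglongrightarrow> - transport_op z" by (rule filterlim_compose)
  from tendsto_minus[OF this] show ?thesis
    by (simp add: g_def discrete_op_def s0[simplified] minus_divide_left[symmetric] diff_divide_distrib)
qed

lemma transport_op_measurable [measurable]: "transport_op \<in> borel_measurable borel"
  by (rule borel_measurable_LIMSEQ_real[OF discrete_op_LIMSEQ]) simp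

lemma \<phi>_bounded: obtains C where "0 \<le> C" "\<And>z. \<bar>\<phi> z\<bar> \<le> C"
\<comment> \<open>A zero of \<phi> is available at (\<bar>r\<bar> + 1, 0), at distance at most 3 *
  \<bar>r\<bar> + 1 from every point of the square; the Lipschitz bound does the rest.\<close>
proof (rule that[of "K * (3 * \<bar>r\<bar> + 1)"])
  fix z
  have "(\<bar>r\<bar> + 1, 0) \<notin> square r" by (auto simp: mem_square)
  then have z: "\<bar>\<phi> z\<bar> \<le> K * norm (z - (\<bar>r\<bar> + 1, 0))" using K[of z "(\<bar>r\<bar> + 1, 0)"] r by simp
  show "\<bar>\<phi> z\<bar> \<le> K * (3 * \<bar>r\<bar> + 1)"
  proof (cases "z \<in> square r")
    case True
    have "norm (z - (\<bar>r\<bar> + 1, 0)) \<le> \<bar>fst (z - (\<bar>r\<bar> + 1, 0))\<bar> + \<bar>snd (z - (\<bar>r\<bar> + 1, 0))\<bar>"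
      by (metis norm_Pair_le prod.collapse real_norm_def)
    also have "\<dots> \<le> 3 * \<bar>r\<bar> + 1" using True by (auto simp: mem_square)
    finally have "norm (z - (\<bar>r\<bar> + 1, 0)) \<le> 3 * \<bar>r\<bar> + 1" .
    from mult_left_mono[OF this K_nonneg] z show ?thesis by linarith
  next
    case False
    then show ?thesis using r K_nonneg by simp
  qed
qed (use K_nonneg in auto)

text \<open>Steps have length at most 1, so a point sent into \<open>square r\<close> by a backward
  step has velocity at most r + M and position at most 2 * r. One square thus contains the supports
  of \<phi> and of all discrete operators.\<close>

definition support_radius :: real where "support_radius = 2 * \<bar>r\<bar> + M"

lemma \<phi>_support: "z \<notin> square support_radius \<Longrightarrow> \<phi> z = 0"
  by (rule r) (use M_nonneg in \<open>auto simp: mem_square support_radius_def\<close>)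

lemma discrete_op_support: assumes "z \<notin> square support_radius" shows "discrete_op n z = 0"
proof -
  have "step (- mesh n) z \<notin> square r"
  proof
    assume s: "step (- mesh n) z \<in> square r"
    define v where "v = snd (step (- mesh n) z)"
    have z: "snd z = v + mesh n * F z" "fst z = fst (step (- mesh n) z) + mesh n * v"
      by (simp_all add: v_def step_def)
    have v: "\<bar>v\<bar> \<le> r" "\<bar>fst (step (- mesh n) z)\<bar> \<le> r" using s by (simp_all add: v_def mem_square)
    have "\<bar>mesh n * F z\<bar> \<le> 1 * M" "\<bar>mesh n * v\<bar> \<le> 1 * r" unfolding abs_mult
      using mesh_le_1[of n] mesh_pos[of n] F_bound[of z] v(1) by (intro mult_mono; simp)+
    then have "z \<in> square support_radius" unfolding mem_square support_radius_def using v z M_nonneg by linarith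
    with assms show False by simp
  qed
  then show ?thesis using \<phi>_support[OF assms] r by (simp add: discrete_op_def)
qed

text \<open>The division by the mesh is harmless: \<phi> changes by O(mesh) along one step, and the
  Jacobian correction carries a factor mesh. The bound is uniform in n and serves for
  domination.\<close>

lemma discrete_op_bounded: obtains C where "0 \<le> C" "\<And>n z. \<bar>discrete_op n z\<bar> \<le> C"
proof -
  obtain C where C: "0 \<le> C" "\<And>z. \<bar>\<phi> z\<bar> \<le> C" using \<phi>_bounded by blast
  define B where "B = K * (\<bar>support_radius\<bar> + 2 * M) + C * M"
  have B: "0 \<le> B" unfolding B_def using K_nonneg C M_nonneg by simp
  have "\<bar>discrete_op n z\<bar> \<le> B" for n z
  proof (cases "z \<in> square support_radius")
    case True
    let ?w = "step (- mesh n) z"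
    have sw: "\<bar>snd ?w\<bar> \<le> \<bar>support_radius\<bar> + M"
    proof -
      have "\<bar>mesh n * F z\<bar> \<le> 1 * M" unfolding abs_mult
        using mesh_le_1[of n] mesh_pos[of n] F_bound[of z] by (intro mult_mono) auto
      then show ?thesis using True by (auto simp: step_def mem_square)
    qed
    have "\<bar>\<phi> z - \<phi> ?w\<bar> \<le> K * (mesh n * (\<bar>support_radius\<bar> + 2 * M))"
    proof -
      have "norm (z - ?w) \<le> mesh n * (\<bar>snd ?w\<bar> + M)"
        using norm_step_diff[of "- mesh n" z] mesh_pos[of n] by (simp add: norm_minus_commute)
      also have "\<dots> \<le> mesh n * (\<bar>support_radius\<bar> + 2 * M)" using sw mesh_pos[of n] by (intro mult_left_mono) auto
      finally show ?thesis using mult_left_mono[OF _ K_nonneg] K[of z ?w] order_trans by blast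
    qed
    moreover have "\<bar>\<phi> ?w * (mesh n * Fv z)\<bar> \<le> C * (mesh n * M)"
      unfolding abs_mult using C mesh_pos[of n] Fv_bound[of z] by (intro mult_mono) auto
    ultimately have "\<bar>(\<phi> z - \<phi> ?w) + \<phi> ?w * (mesh n * Fv z)\<bar> \<le> mesh n * B"
      using abs_triangle_ineq[of "\<phi> z - \<phi> ?w" "\<phi> ?w * (mesh n * Fv z)"]
      by (simp add: B_def algebra_simps)
    moreover have "discrete_op n z = ((\<phi> z - \<phi> ?w) + \<phi> ?w * (mesh n * Fv z)) / mesh n"
      by (simp add: discrete_op_def algebra_simps)
    ultimately show ?thesis using mesh_pos[of n] by (simp add: abs_divide divide_le_eq mult.commute)
  next
    case False
    then show ?thesis using discrete_op_support B by simp
  qed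
  then show ?thesis using that B by blast
qed

text \<open>The identity is exact for every mesh: each step costs one change of variables, and what
  remains is by construction the discrete operator.\<close>

lemma scheme_weak_form:
  "(\<integral>z. scheme f0 n t z * \<phi> z \<partial>lborel) = (\<integral>z. f0 z * \<phi> z \<partial>lborel) +
    mesh n * (\<Sum>k=1..nat \<lfloor>t / mesh n\<rfloor>. \<integral>z. f0 ((step (- mesh n) ^^ k) z) * discrete_op n z \<partial>lborel)"
proof -
  have m [measurable]: "f0 \<in> borel_measurable borel" using f0 by (rule borel_measurable_continuous_onI)
  define h where "h = mesh n"
  have h: "0 < h" "\<bar>- h\<bar> * M \<le> 1 / 2" unfolding h_def using mesh_le[of n] mesh_pos[of n] by auto
  let ?S = "\<lambda>k. step (- h) ^^ k"
  have c: "\<exists>C. \<forall>z\<in>square support_radius. \<bar>f0 (?S k z)\<bar> \<le> C" for k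
  proof -
    have "compact (square support_radius)" unfolding square_def by (intro compact_Times) auto
    moreover have "continuous_on (square support_radius) (\<lambda>z. f0 (?S k z))"
      by (rule continuous_on_compose2[OF f0 continuous_on_subset[OF continuous_on_iter]]) auto
    ultimately have "compact ((\<lambda>z. f0 (?S k z)) ` square support_radius)" by (rule compact_continuous_image[rotated])
    from compact_imp_bounded[OF this] show ?thesis unfolding bounded_iff by auto
  qed
  obtain C1 where C1: "0 \<le> C1" "\<And>z. \<bar>\<phi> z\<bar> \<le> C1" using \<phi>_bounded by blast
  obtain C2 where C2: "0 \<le> C2" "\<And>n z. \<bar>discrete_op n z\<bar> \<le> C2" using discrete_op_bounded by blast
  have i1: "integrable lborel (\<lambda>z. f0 (?S k z) * \<phi> z)" for k
  proof -
    obtain C where "\<forall>z\<in>square support_radius. \<bar>f0 (?S k z)\<bar> \<le> C" using c by blast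
    then show ?thesis
      by (intro integrable_square[of _ support_radius "\<bar>C\<bar> * C1"]) (use C1 \<phi>_support in \<open>auto simp: abs_mult intro!: mult_mono\<close>)
  qed
  have i2: "integrable lborel (\<lambda>z. f0 (?S k z) * discrete_op n z)" for k
  proof -
    obtain C where "\<forall>z\<in>square support_radius. \<bar>f0 (?S k z)\<bar> \<le> C" using c by blast
    then show ?thesis
      by (intro integrable_square[of _ support_radius "\<bar>C\<bar> * C2"]) (use C2 discrete_op_support in \<open>auto simp: abs_mult intro!: mult_mono\<close>)
  qed
  have "(\<integral>z. f0 (?S j z) * \<phi> z \<partial>lborel) = (\<integral>z. f0 z * \<phi> z \<partial>lborel) +
      h * (\<Sum>k=1..j. \<integral>z. f0 (?S k z) * discrete_op n z \<partial>lborel)" for j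
  proof (induction j)
    case (Suc j)
    \<comment> \<open>The substitution z \<mapsto> step (- h) z prepends a step to the iteration, so
      the step lands on \<phi> and on the count j simultaneously.\<close>
    have "(\<integral>z. f0 (?S j z) * \<phi> z \<partial>lborel)
        = (\<integral>z. (1 + - h * Fv z) * (f0 (?S j (step (- h) z)) * \<phi> (step (- h) z)) \<partial>lborel)"
      by (subst integral_step[OF h(2)]) simp_all
    also have "\<dots> = (\<integral>z. f0 (?S (Suc j) z) * \<phi> z - h * (f0 (?S (Suc j) z) * discrete_op n z) \<partial>lborel)"
    proof (rule Bochner_Integration.integral_cong[OF refl])
      fix z
      have "h * discrete_op n z = \<phi> z - \<phi> (step (- h) z) * (1 - h * Fv z)"
        using h by (simp add: discrete_op_def h_def)
      then have "f0 (?S (Suc j) z) * \<phi> z - f0 (?S (Suc j) z) * (h * discrete_op n z)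
          = f0 (?S (Suc j) z) * (\<phi> (step (- h) z) * (1 - h * Fv z))"
        by (simp only: right_diff_distrib)
      then show "(1 + - h * Fv z) * (f0 (?S j (step (- h) z)) * \<phi> (step (- h) z))
          = f0 (?S (Suc j) z) * \<phi> z - h * (f0 (?S (Suc j) z) * discrete_op n z)"
        by (simp add: funpow_Suc_right algebra_simps del: funpow.simps)
    qed
    also have "\<dots> = (\<integral>z. f0 (?S (Suc j) z) * \<phi> z \<partial>lborel) - h * (\<integral>z. f0 (?S (Suc j) z) * discrete_op n z \<partial>lborel)"
      by (subst Bochner_Integration.integral_diff[OF i1 integrable_mult_right[OF i2]]) simp
    finally show ?case using Suc.IH by (simp add: algebra_simps del: funpow.simps)
  qed simp
  then show ?thesis unfolding scheme_def h_def .
qed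

text \<open>Dominated convergence is applied twice, in z at each fixed time and then in time to the
  resulting integrals, which are bounded uniformly in n.\<close>

lemma transported_weak_form:
  assumes t: "0 \<le> t"
  shows "(\<integral>z. transported f0 t z * \<phi> z \<partial>lborel) = (\<integral>z. f0 z * \<phi> z \<partial>lborel) +
    (LBINT s:{0..t}. LBINT z. transported f0 s z * transport_op z)"
proof -
  note [measurable] = scheme_measurable'[OF f0] transported_measurable'[OF f0]
  \<comment> \<open>Time t + 1 leaves room for the last cell of the step function, which may reach
    beyond t.\<close>
  obtain B where B: "0 \<le> B" "\<And>n s z. 0 \<le> s \<Longrightarrow> s \<le> t + 1 \<Longrightarrow> z \<in> square support_radius \<Longrightarrow> \<bar>scheme f0 n s z\<bar> \<le> B"
    using scheme_bound[OF f0, of "t + 1" support_radius] by blast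
  obtain C1 where C1: "0 \<le> C1" "\<And>z. \<bar>\<phi> z\<bar> \<le> C1" using \<phi>_bounded by blast
  obtain C2 where C2: "0 \<le> C2" "\<And>n z. \<bar>discrete_op n z\<bar> \<le> C2" using discrete_op_bounded by blast
  have scheme_discrete_op: "norm (scheme f0 n s z * discrete_op n z) \<le> (B * C2) * indicator (square support_radius) z"
    if "s \<in> {0..t + 1}" for n s z
    using that B(1) B(2)[of s z n] C2(1) C2(2)[of n z] discrete_op_support[of z n]
    by (auto simp: indicator_def abs_mult intro!: mult_mono)
  have dom: "integrable lborel (\<lambda>z. C * indicator (square support_radius) z :: real)" for C
    by (rule integrable_square[of _ support_radius "\<bar>C\<bar>"]) auto
  have ae: "AE z in lborel. \<forall>s\<in>{0..t + 1}. (\<lambda>n. scheme f0 n s z) \<longlonglongrightarrow> transported f0 s z"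
    using t by (intro AE_scheme_converges[OF f0]) auto
  have lhs: "(\<lambda>n. \<integral>z. scheme f0 n t z * \<phi> z \<partial>lborel) \<longlonglongrightarrow> (\<integral>z. transported f0 t z * \<phi> z \<partial>lborel)"
  proof (rule integral_dominated_convergence[where w = "\<lambda>z. (B * C1) * indicator (square support_radius) z"])
    show "AE z in lborel. (\<lambda>n. scheme f0 n t z * \<phi> z) \<longlonglongrightarrow> transported f0 t z * \<phi> z"
      using ae by eventually_elim (use t in \<open>auto intro!: tendsto_intros\<close>)
    show "AE z in lborel. norm (scheme f0 n t z * \<phi> z) \<le> B * C1 * indicator (square support_radius) z" for n
    proof (rule AE_I2)
      fix z
      show "norm (scheme f0 n t z * \<phi> z) \<le> B * C1 * indicator (square support_radius) z"
        using B(1) B(2)[of t z n] C1(1) C1(2)[of z] t \<phi>_support[of z]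
        by (auto simp: indicator_def abs_mult intro!: mult_mono)
    qed
  qed (use dom in auto)
  define I where "I n s = (\<integral>z. scheme f0 n s z * discrete_op n z \<partial>lborel)" for n s
  define A where "A = measure lborel (square support_radius)"
  have I_lim: "(\<lambda>n. I n s) \<longlonglongrightarrow> (\<integral>z. transported f0 s z * transport_op z \<partial>lborel)" if s: "s \<in> {0..t + 1}" for s
    unfolding I_def
  proof (rule integral_dominated_convergence[where w = "\<lambda>z. (B * C2) * indicator (square support_radius) z"])
    show "AE z in lborel. (\<lambda>n. scheme f0 n s z * discrete_op n z) \<longlonglongrightarrow> transported f0 s z * transport_op z"
      using ae by eventually_elim (use s discrete_op_LIMSEQ in \<open>auto intro!: tendsto_intros\<close>)
    show "AE z in lborel. norm (scheme f0 n s z * discrete_op n z) \<le> B * C2 * indicator (square support_radius) z" for n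
      by (rule AE_I2) (rule scheme_discrete_op[OF s])
  qed (use dom in auto)
  have I_bound: "\<bar>I n s\<bar> \<le> B * C2 * A" if s: "s \<in> {0..t + 1}" for n s
  proof -
    have b: "norm (scheme f0 n s z * discrete_op n z) \<le> (B * C2) * indicator (square support_radius) z" for z
      by (rule scheme_discrete_op[OF s])
    have "\<bar>I n s\<bar> \<le> (\<integral>z. (B * C2) * indicator (square support_radius) z \<partial>lborel)"
      unfolding I_def
    proof (rule integral_abs_bound_integral[OF _ dom b[unfolded real_norm_def]])
      show "integrable lborel (\<lambda>z. scheme f0 n s z * discrete_op n z)"
        by (rule Bochner_Integration.integrable_bound[OF dom[of "B * C2"]]) (use b B C2 in \<open>auto intro!: AE_I2\<close>)
    qed
    then show ?thesis by (simp add: A_def)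
  qed
  \<comment> \<open>The range of the Riemann sum seen as an integral: it omits the first cell and
    overshoots t by at most one mesh width, so it converges to {0..t} except perhaps at the two end
    points.\<close>
  define J where "J n = {mesh n..<real (Suc (nat \<lfloor>t / mesh n\<rfloor>)) * mesh n}" for n
  have J: "J n \<subseteq> {0..t + 1}" for n
    using nat_floor_divide_bounds(1)[OF t mesh_pos, of n] mesh_pos[of n] mesh_le_1[of n]
    unfolding J_def by (auto simp: algebra_simps)
  have Jlim: "(\<lambda>n. indicator (J n) s :: real) \<longlonglongrightarrow> indicator {0..t} s" if "s \<noteq> 0" "s \<noteq> t" for s
  proof -
    have b: "t < real (Suc (nat \<lfloor>t / mesh n\<rfloor>)) * mesh n" "real (Suc (nat \<lfloor>t / mesh n\<rfloor>)) * mesh n \<le> t + mesh n" for n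
      using nat_floor_divide_bounds[OF t mesh_pos, of n] by (auto simp: algebra_simps)
    have "\<forall>\<^sub>F n in sequentially. mesh n < \<bar>s\<bar>" "\<forall>\<^sub>F n in sequentially. mesh n < \<bar>s - t\<bar>"
      using order_tendstoD(2)[OF mesh_lim] that by auto
    then have "\<forall>\<^sub>F n in sequentially. indicator {0..t} s = (indicator (J n) s :: real)"
    proof eventually_elim
      case (elim n)
      then show ?case using b[of n] mesh_pos[of n] that unfolding J_def indicator_def by auto
    qed
    then show ?thesis by (rule tendsto_eventually[OF eventually_mono]) simp
  qed
  have I_step: "I n s = (\<integral>z. f0 ((step (- mesh n) ^^ nat \<lfloor>s / mesh n\<rfloor>) z) * discrete_op n z \<partial>lborel)" for n s
    by (simp add: I_def scheme_def)
  have I_meas [measurable]: "I n \<in> borel_measurable borel" for n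
  proof -
    have "(\<lambda>s. (\<lambda>k. \<integral>z. f0 ((step (- mesh n) ^^ k) z) * discrete_op n z \<partial>lborel) (nat \<lfloor>s / mesh n\<rfloor>)) \<in> borel_measurable borel"
      by (rule measurable_compose[where N = "count_space UNIV"]) auto
    then show ?thesis unfolding I_step .
  qed
  have J_meas [measurable]: "J n \<in> sets borel" for n unfolding J_def by simp
  define W where "W s = (\<integral>z. transported f0 s z * transport_op z \<partial>lborel)" for s
  have W_meas: "(\<lambda>s. indicator {0..t} s * W s) \<in> borel_measurable borel"
  proof (rule borel_measurable_LIMSEQ_real)
    \<comment> \<open>The cut-off confines s to times at which I n s is known to converge to W
      s.\<close>
    show "(\<lambda>n. indicator {0..t} s * I n s) \<longlonglongrightarrow> indicator {0..t} s * W s" for s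
      using I_lim[of s] by (auto simp: indicator_def W_def)
  qed measurable
  have rhs: "(\<lambda>n. \<integral>s. indicator (J n) s * I n s \<partial>lborel) \<longlonglongrightarrow> (\<integral>s. indicator {0..t} s * W s \<partial>lborel)"
  proof (rule integral_dominated_convergence[where w = "\<lambda>s. (B * C2 * A) * indicator {0..t + 1} s"])
    show "AE s in lborel. (\<lambda>n. indicator (J n) s * I n s) \<longlonglongrightarrow> indicator {0..t} s * W s"
      using AE_lborel_singleton[of 0] AE_lborel_singleton[of t]
    proof eventually_elim
      case (elim s)
      show ?case
      proof (cases "s \<in> {0..t + 1}")
        case True
        then show ?thesis unfolding W_def using elim by (intro tendsto_mult Jlim I_lim) auto
      next
        case False
        then have "s \<notin> J n" for n using J by blast
        then show ?thesis using False by auto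
      qed
    qed
    show "AE s in lborel. norm (indicator (J n) s * I n s) \<le> B * C2 * A * indicator {0..t + 1} s" for n
      using I_bound[of _ n] J[of n] B(1) C2(1) by (intro AE_I2) (auto simp: indicator_def abs_mult A_def)
    show "integrable lborel (\<lambda>s. (B * C2 * A) * indicator {0..t + 1} s :: real)"
      using t by (intro integrable_mult_right integrable_real_indicator) (auto simp: emeasure_lborel_Icc)
  qed (use W_meas in auto)
  have "(\<integral>z. scheme f0 n t z * \<phi> z \<partial>lborel) = (\<integral>z. f0 z * \<phi> z \<partial>lborel)
      + (\<integral>s. indicator (J n) s * I n s \<partial>lborel)" for n
    unfolding scheme_weak_form J_def I_step
    by (subst has_bochner_integral_integral_eq[OF has_bochner_integral_step_function[OF mesh_pos,
      where b = "\<lambda>k. \<integral>z. f0 ((step (- mesh n) ^^ k) z) * discrete_op n z \<partial>lborel"]]) simp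
  then have "(\<lambda>n. \<integral>z. scheme f0 n t z * \<phi> z \<partial>lborel)
      \<longlonglongrightarrow> (\<integral>z. f0 z * \<phi> z \<partial>lborel) + (\<integral>s. indicator {0..t} s * W s \<partial>lborel)"
    using tendsto_add[OF tendsto_const rhs] by simp
  from LIMSEQ_unique[OF lhs this] show ?thesis
    by (simp add: set_lebesgue_integral_def W_def)
qed

end

end

section \<open>Uniqueness away from the origin\<close>

definition signed_powr :: "real \<Rightarrow> real \<Rightarrow> real" where
  "signed_powr \<alpha> x = sgn x * \<bar>x\<bar> powr \<alpha>"

lemma signed_powr_minus: "signed_powr \<alpha> (- x) = - signed_powr \<alpha> x"
  by (simp add: signed_powr_def sgn_minus)

lemma abs_signed_powr: "\<bar>signed_powr \<alpha> x\<bar> = \<bar>x\<bar> powr \<alpha>"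
  by (cases "x = 0") (simp_all add: signed_powr_def abs_mult abs_sgn_eq)

lemma continuous_on_signed_powr:
  assumes "0 < \<alpha>"
  shows "continuous_on UNIV (signed_powr \<alpha>)"
proof -
  have "isCont (signed_powr \<alpha>) x" for x
  proof (cases "x = 0")
    case True
    have "((\<lambda>x. \<bar>x\<bar> powr \<alpha>) \<longlongrightarrow> \<bar>0\<bar> powr \<alpha>) (at (0::real))"
      by (intro tendsto_powr' tendsto_intros) (use assms in auto)
    then have "((\<lambda>x. \<bar>signed_powr \<alpha> x\<bar>) \<longlongrightarrow> 0) (at 0)" unfolding abs_signed_powr by simp
    then show ?thesis
      unfolding True isCont_def tendsto_rabs_zero_iff by (simp add: signed_powr_def[of \<alpha> 0])
  next
    case False
    have "((\<lambda>y. sgn y * \<bar>y\<bar> powr \<alpha>) \<longlongrightarrow> sgn x * \<bar>x\<bar> powr \<alpha>) (at x)"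
      by (intro tendsto_intros) (use False in auto)
    then show ?thesis unfolding isCont_def signed_powr_def .
  qed
  then show ?thesis by (simp add: continuous_at_imp_continuous_on)
qed

text \<open>The derivative \<alpha> * z powr (\<alpha> - 1) decreases in z, so it is largest at the
  point nearest to 0. The constant is kept explicit in \<xi> because its rate of blow-up as \<xi>
  tends to 0 is what decides uniqueness.\<close>

lemma signed_powr_lipschitz_near:
  assumes \<alpha>: "0 < \<alpha>" "\<alpha> \<le> 1" and \<xi>: "\<xi> \<noteq> 0"
    and x: "\<bar>x - \<xi>\<bar> \<le> \<bar>\<xi>\<bar> / 2" and y: "\<bar>y - \<xi>\<bar> \<le> \<bar>\<xi>\<bar> / 2"
  shows "\<bar>signed_powr \<alpha> x - signed_powr \<alpha> y\<bar> \<le> \<alpha> * (\<bar>\<xi>\<bar> / 2) powr (\<alpha> - 1) * \<bar>x - y\<bar>"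
proof -
  have pos: "\<bar>signed_powr \<alpha> x - signed_powr \<alpha> y\<bar> \<le> \<alpha> * (\<xi> / 2) powr (\<alpha> - 1) * \<bar>x - y\<bar>"
    if \<xi>: "\<xi> > 0" and x: "\<bar>x - \<xi>\<bar> \<le> \<xi> / 2" and y: "\<bar>y - \<xi>\<bar> \<le> \<xi> / 2" for x y \<xi>
  proof -
    have ge: "\<xi> / 2 \<le> x" "\<xi> / 2 \<le> y" using x y by linarith+
    have "norm (x powr \<alpha> - y powr \<alpha>) \<le> \<alpha> * (\<xi> / 2) powr (\<alpha> - 1) * norm (x - y)"
    proof (rule field_differentiable_bound[where S = "{\<xi> / 2..}"])
      fix z assume z: "z \<in> {\<xi> / 2..}"
      then have "0 < z" using \<xi> by auto
      then show "((\<lambda>z. z powr \<alpha>) has_field_derivative \<alpha> * z powr (\<alpha> - 1)) (at z within {\<xi> / 2..})"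
        by (rule has_field_derivative_at_within[OF has_real_derivative_powr])
      have "z powr (\<alpha> - 1) \<le> (\<xi> / 2) powr (\<alpha> - 1)"
        using z \<xi> \<alpha> by (intro powr_mono2') auto
      then show "norm (\<alpha> * z powr (\<alpha> - 1)) \<le> \<alpha> * (\<xi> / 2) powr (\<alpha> - 1)"
        using \<alpha> by (simp add: abs_mult)
    qed (use ge in auto)
    moreover have "0 < x" "0 < y" using ge \<xi> by linarith+
    ultimately show ?thesis by (simp add: signed_powr_def)
  qed
  show ?thesis
  proof (cases "\<xi> > 0")
    case True
    then show ?thesis using pos[of \<xi> x y] x y by simp
  next
    case False
    then have "- \<xi> > 0" using \<xi> by simp
    moreover have "\<bar>- x - - \<xi>\<bar> \<le> - \<xi> / 2" "\<bar>- y - - \<xi>\<bar> \<le> - \<xi> / 2" using x y False by auto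
    ultimately show ?thesis
      using pos[of "- \<xi>" "- x" "- y"] False unfolding signed_powr_minus
      by (simp add: abs_minus_commute)
  qed
qed

lemma derivative_bound_imp_le:
  fixes g :: "real \<Rightarrow> real"
  assumes "a \<le> t" "g a = 0"
    and "\<And>u. u \<in> {a..t} \<Longrightarrow> (g has_real_derivative g' u) (at u within {a..t})"
    and "\<And>u. u \<in> {a..t} \<Longrightarrow> \<bar>g' u\<bar> \<le> B"
  shows "\<bar>g t\<bar> \<le> B * (t - a)"
  using field_differentiable_bound[of "{a..t}" g g' B t a] assms by simp

locale rough_field = kinetic_field +
  fixes \<theta> :: "real \<times> real \<Rightarrow> real" and \<alpha> K C :: real
  assumes F_eq: "F z = \<theta> z * signed_powr \<alpha> (fst z)"
    and \<alpha>: "0 < \<alpha>" "\<alpha> \<le> 1"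
    and \<theta>_lipschitz: "\<bar>\<theta> z - \<theta> w\<bar> \<le> K * norm (z - w)"
    and \<theta>_bound: "\<bar>\<theta> z\<bar> \<le> C"
begin

lemma sol_components:
  assumes "sol \<sigma> T y" "t \<in> {0..T}"
  shows "((\<lambda>t. fst (y t)) has_real_derivative \<sigma> * snd (y t)) (at t within {0..T})"
    and "((\<lambda>t. snd (y t)) has_real_derivative \<sigma> * F (y t)) (at t within {0..T})"
proof -
  have "(y has_derivative (\<lambda>h. h *\<^sub>R (\<sigma> *\<^sub>R G (y t)))) (at t within {0..T})"
    using assms by (simp add: sol_def has_vector_derivative_def)
  from has_derivative_fst[OF this] has_derivative_snd[OF this]
  show "((\<lambda>t. fst (y t)) has_real_derivative \<sigma> * snd (y t)) (at t within {0..T})"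
    and "((\<lambda>t. snd (y t)) has_real_derivative \<sigma> * F (y t)) (at t within {0..T})"
    by (simp_all add: has_field_derivative_def G_def mult_commute_abs)
qed

text \<open>At a point with \<open>fst z \<noteq> 0\<close> the field is locally Lipschitz. At \<open>(0, v)\<close> with \<open>v \<noteq> 0\<close> both
  solutions leave the singular line at speed about \<open>v\<close>, so at time \<open>t\<close> the Lipschitz constant of
  \<open>signed_powr \<alpha>\<close> between them is of order \<open>t powr (\<alpha> - 1)\<close>; the factor \<open>t\<close> in
  \<open>\<bar>x - y\<bar> \<le> t * sup \<bar>v - w\<bar>\<close> compensates it.\<close>

lemma local_uniqueness:
  assumes \<sigma>: "\<bar>\<sigma>\<bar> = 1" and a: "0 \<le> a" "a < T" and y1: "sol \<sigma> T y1" and y2: "sol \<sigma> T y2"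
    and eq: "y1 a = y2 a" and ne: "y1 a \<noteq> 0"
  obtains c where "a < c" "c \<le> T" "\<And>t. t \<in> {a..c} \<Longrightarrow> y1 t = y2 t"
proof -
  define x v y w where "x t = fst (y1 t)" and "v t = snd (y1 t)"
    and "y t = fst (y2 t)" and "w t = snd (y2 t)" for t
  note defs = x_def v_def y_def w_def
  have sub: "(g has_real_derivative D) (at t within {a..c})"
    if "(g has_real_derivative D) (at t within {0..T})" "c \<le> T" for g D t c
    using that(1) by (rule DERIV_subset) (use that a in auto)
  have dx: "(x has_real_derivative \<sigma> * v t) (at t within {a..c})"
    and dv: "(v has_real_derivative \<sigma> * F (y1 t)) (at t within {a..c})"
    and dy: "(y has_real_derivative \<sigma> * w t) (at t within {a..c})"
    and dw: "(w has_real_derivative \<sigma> * F (y2 t)) (at t within {a..c})"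
    if "t \<in> {a..c}" "c \<le> T" for t c
    using sol_components[OF y1, of t] sol_components[OF y2, of t] that a
    unfolding defs by (auto intro: sub)
  have cont: "continuous_on {0..T} x" "continuous_on {0..T} v" "continuous_on {0..T} y" "continuous_on {0..T} w"
    unfolding defs using sol_continuous_on[OF y1] sol_continuous_on[OF y2] by (auto intro!: continuous_intros)
  have near: "\<exists>c>a. c \<le> T \<and> (\<forall>t\<in>{a..c}. \<bar>g t - g a\<bar> \<le> e)"
    if gc: "continuous_on {0..T} g" "0 < e" for g :: "real \<Rightarrow> real" and e
  proof -
    obtain d where d: "d > 0" "\<And>t. t \<in> {0..T} \<Longrightarrow> dist t a < d \<Longrightarrow> dist (g t) (g a) < e"
      using gc(1)[unfolded continuous_on_iff, rule_format, of a e] gc(2) a by auto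
    have "\<bar>g t - g a\<bar> \<le> e" if "t \<in> {a..min T (a + d / 2)}" for t
      using d(2)[of t] that a d(1) by (simp add: dist_real_def)
    then show ?thesis using a d(1) by (intro exI[of _ "min T (a + d / 2)"]) auto
  qed
  have near2: "\<exists>c>a. c \<le> T \<and> c \<le> a + 1 \<and> (\<forall>t\<in>{a..c}. \<bar>g t - g a\<bar> \<le> e \<and> \<bar>g' t - g' a\<bar> \<le> e)"
    if g: "continuous_on {0..T} g" "continuous_on {0..T} g'" "0 < e" for g g' :: "real \<Rightarrow> real" and e
  proof -
    obtain c1 c2 where "c1 > a" "c1 \<le> T" "\<forall>t\<in>{a..c1}. \<bar>g t - g a\<bar> \<le> e"
      "c2 > a" "c2 \<le> T" "\<forall>t\<in>{a..c2}. \<bar>g' t - g' a\<bar> \<le> e"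
      using near[OF g(1,3)] near[OF g(2,3)] by blast
    then show ?thesis by (intro exI[of _ "min (min c1 c2) (a + 1)"]) auto
  qed
  have ini: "x a = y a" "v a = w a" using eq by (simp_all add: defs)
  \<comment> \<open>A common form for the regular and the transversal case: positions that separate
    at most linearly, with slope E, have signed powers that differ by O(E). The condition c \<le> a
    + 1 allows factors t - a to be dropped.\<close>
  have "\<exists>c>a. c \<le> T \<and> c \<le> a + 1 \<and> (\<exists>B\<ge>0. \<forall>t\<in>{a<..c}. \<forall>E. \<bar>x t - y t\<bar> \<le> E * (t - a) \<longrightarrow>
      \<bar>signed_powr \<alpha> (x t) - signed_powr \<alpha> (y t)\<bar> \<le> B * E)"
  proof (cases "x a = 0")
    case False
    then obtain c where c: "c > a" "c \<le> T" "c \<le> a + 1"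
      "\<And>t. t \<in> {a..c} \<Longrightarrow> \<bar>x t - x a\<bar> \<le> \<bar>x a\<bar> / 2 \<and> \<bar>y t - y a\<bar> \<le> \<bar>x a\<bar> / 2"
      using near2[OF cont(1,3), of "\<bar>x a\<bar> / 2"] by auto
    have "\<bar>signed_powr \<alpha> (x t) - signed_powr \<alpha> (y t)\<bar> \<le> \<alpha> * (\<bar>x a\<bar> / 2) powr (\<alpha> - 1) * E"
      if t: "t \<in> {a<..c}" and E: "\<bar>x t - y t\<bar> \<le> E * (t - a)" for t E
    proof -
      have "0 \<le> E * (t - a)" using E by linarith
      then have "0 \<le> E" using t by (simp add: zero_le_mult_iff)
      then have "E * (t - a) \<le> E * 1" using t c by (intro mult_left_mono) auto
      then have "\<bar>x t - y t\<bar> \<le> E" using E by linarith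
      then have "\<alpha> * (\<bar>x a\<bar> / 2) powr (\<alpha> - 1) * \<bar>x t - y t\<bar> \<le> \<alpha> * (\<bar>x a\<bar> / 2) powr (\<alpha> - 1) * E"
        using \<alpha> by (intro mult_left_mono) auto
      moreover have "\<bar>signed_powr \<alpha> (x t) - signed_powr \<alpha> (y t)\<bar>
          \<le> \<alpha> * (\<bar>x a\<bar> / 2) powr (\<alpha> - 1) * \<bar>x t - y t\<bar>"
        using c(4)[of t] t ini by (intro signed_powr_lipschitz_near[OF \<alpha> False]) auto
      ultimately show ?thesis by linarith
    qed
    then show ?thesis using c \<alpha>
      by (intro exI[of _ c] conjI exI[of _ "\<alpha> * (\<bar>x a\<bar> / 2) powr (\<alpha> - 1)"]) auto
  next
    case True
    define m where "m = \<bar>v a\<bar> / 2"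
    have "v a \<noteq> 0" using True ne by (auto simp: defs prod_eq_iff)
    then have m: "0 < m" by (simp add: m_def)
    obtain c where c: "c > a" "c \<le> T" "c \<le> a + 1"
      "\<And>t. t \<in> {a..c} \<Longrightarrow> \<bar>v t - v a\<bar> \<le> m \<and> \<bar>w t - w a\<bar> \<le> m"
      using near2[OF cont(2,4) m] by auto
    have "\<bar>signed_powr \<alpha> (x t) - signed_powr \<alpha> (y t)\<bar> \<le> \<alpha> * m powr (\<alpha> - 1) * E"
      if t: "t \<in> {a<..c}" and E: "\<bar>x t - y t\<bar> \<le> E * (t - a)" for t E
    proof -
      \<comment> \<open>The position reached with the velocity frozen at time a. As m is half of
        \<bar>v a\<bar> and both velocities stay within m of v a, both positions stay within m * (t
        - a) = \<bar>\<xi>\<bar> / 2 of \<xi>, on one side of the singular line.\<close>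
      define \<xi> where "\<xi> = \<sigma> * v a * (t - a)"
      have \<xi>: "\<bar>\<xi>\<bar> / 2 = m * (t - a)" "\<xi> \<noteq> 0"
        using \<sigma> t \<open>v a \<noteq> 0\<close> by (auto simp: \<xi>_def m_def abs_mult)
      have lin: "\<bar>g t - \<xi>\<bar> \<le> m * (t - a)"
        if g: "g a = 0" "\<And>u. u \<in> {a..t} \<Longrightarrow> (g has_real_derivative \<sigma> * k u) (at u within {a..t})"
          "\<And>u. u \<in> {a..t} \<Longrightarrow> \<bar>k u - v a\<bar> \<le> m" for g k
      proof -
        have "\<bar>g t - \<sigma> * v a * (t - a)\<bar> \<le> m * (t - a)"
        proof (rule derivative_bound_imp_le[where g = "\<lambda>t. g t - \<sigma> * v a * (t - a)"])
          fix u assume u: "u \<in> {a..t}"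
          show "((\<lambda>t. g t - \<sigma> * v a * (t - a)) has_real_derivative \<sigma> * (k u - v a)) (at u within {a..t})"
            by (auto intro!: derivative_eq_intros g(2) u simp: algebra_simps)
          show "\<bar>\<sigma> * (k u - v a)\<bar> \<le> m" using g(3)[OF u] \<sigma> by (simp add: abs_mult)
        qed (use t g in auto)
        then show ?thesis by (simp add: \<xi>_def)
      qed
      have "\<bar>x t - \<xi>\<bar> \<le> \<bar>\<xi>\<bar> / 2" "\<bar>y t - \<xi>\<bar> \<le> \<bar>\<xi>\<bar> / 2"
        unfolding \<xi>(1) using True ini t c dx dy by (auto intro!: lin[of x v] lin[of y w])
      then have "\<bar>signed_powr \<alpha> (x t) - signed_powr \<alpha> (y t)\<bar> \<le> \<alpha> * (m * (t - a)) powr (\<alpha> - 1) * \<bar>x t - y t\<bar>"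
        using signed_powr_lipschitz_near[OF \<alpha> \<xi>(2)] unfolding \<xi>(1) by auto
      also have "\<dots> \<le> \<alpha> * (m * (t - a)) powr (\<alpha> - 1) * (E * (t - a))"
        using E \<alpha> by (intro mult_left_mono) auto
      also have "\<dots> = \<alpha> * m powr (\<alpha> - 1) * (E * (t - a) powr \<alpha>)"
      proof -
        have "(m * (t - a)) powr (\<alpha> - 1) = m powr (\<alpha> - 1) * (t - a) powr (\<alpha> - 1)"
          using t m by (simp add: powr_mult)
        moreover have "(t - a) powr (\<alpha> - 1) * (t - a) = (t - a) powr \<alpha>"
          using t powr_mult_base[of "t - a" "\<alpha> - 1"] by (simp add: mult.commute)
        ultimately show ?thesis by (metis mult.assoc mult.left_commute)
      qed
      also have "\<dots> \<le> \<alpha> * m powr (\<alpha> - 1) * (E * 1)"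
      proof -
        have "0 \<le> E * (t - a)" using E by linarith
        then have "0 \<le> E" using t by (simp add: zero_le_mult_iff)
        moreover have "(t - a) powr \<alpha> \<le> 1" using t c \<alpha> by (intro powr_le1) auto
        ultimately show ?thesis using \<alpha> by (intro mult_left_mono) auto
      qed
      finally show ?thesis by simp
    qed
    then show ?thesis using c \<alpha>
      by (intro exI[of _ c] conjI exI[of _ "\<alpha> * m powr (\<alpha> - 1)"]) auto
  qed
  then obtain c0 B where c0: "a < c0" "c0 \<le> T" "c0 \<le> a + 1" and B: "0 \<le> B"
    "\<And>t E. t \<in> {a<..c0} \<Longrightarrow> \<bar>x t - y t\<bar> \<le> E * (t - a) \<Longrightarrow>
      \<bar>signed_powr \<alpha> (x t) - signed_powr \<alpha> (y t)\<bar> \<le> B * E"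
    by blast
  have "compact ((\<lambda>t. signed_powr \<alpha> (x t)) ` {0..T})"
    by (intro compact_continuous_image continuous_on_compose2[OF continuous_on_signed_powr[OF \<alpha>(1)] cont(1)]) auto
  from compact_imp_bounded[OF this]
  obtain P where "\<forall>t\<in>{0..T}. \<bar>signed_powr \<alpha> (x t)\<bar> \<le> P"
    unfolding bounded_iff by auto
  then have P: "\<And>t. t \<in> {0..T} \<Longrightarrow> \<bar>signed_powr \<alpha> (x t)\<bar> \<le> P" by blast
  have P0: "0 \<le> P" using P[of a] a by (auto intro: order_trans[OF abs_ge_zero])
  have K0: "0 \<le> K" using \<theta>_lipschitz[of "(1, 0)" "(0, 0)"] by (simp add: norm_Pair)
  have C0: "0 \<le> C" using \<theta>_bound[of 0] by linarith
  define D where "D = 2 * K * P + C * B"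
  have D0: "0 \<le> D" using K0 P0 C0 B by (simp add: D_def)
  \<comment> \<open>So short that D * (c - a) < 1, where D collects the variation of \<theta> and
    that of the signed power.\<close>
  define c where "c = min c0 (a + 1 / (2 * D + 1))"
  have c: "a < c" "c \<le> c0" "c \<le> T" "D * (c - a) < 1"
  proof -
    show "a < c" "c \<le> c0" "c \<le> T" using c0 D0 by (auto simp: c_def)
    have "D * (c - a) \<le> D * (1 / (2 * D + 1))" using D0 by (intro mult_left_mono) (auto simp: c_def)
    also have "\<dots> < 1" using D0 by (simp add: field_simps)
    finally show "D * (c - a) < 1" .
  qed
  have "continuous_on {a..c} (\<lambda>t. \<bar>v t - w t\<bar>)"
    using a c by (intro continuous_intros continuous_on_subset[OF cont(2)] continuous_on_subset[OF cont(4)]) auto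
  \<comment> \<open>Contraction at a maximum point: if E is the largest velocity difference,
    positions differ by at most E * (t - a), hence forces by at most D * E, and integrating gives E
    \<le> E * (D * (c - a)), which forces E = 0.\<close>
  then obtain s where s: "s \<in> {a..c}" "\<And>t. t \<in> {a..c} \<Longrightarrow> \<bar>v t - w t\<bar> \<le> \<bar>v s - w s\<bar>"
    using continuous_attains_sup[of "{a..c}" "\<lambda>t. \<bar>v t - w t\<bar>"] c(1) by auto
  define E where "E = \<bar>v s - w s\<bar>"
  have xy: "\<bar>x t - y t\<bar> \<le> E * (t - a)" if t: "t \<in> {a..c}" for t
  proof (rule derivative_bound_imp_le[where g = "\<lambda>t. x t - y t"])
    fix u assume u: "u \<in> {a..t}"
    show "((\<lambda>t. x t - y t) has_real_derivative \<sigma> * (v u - w u)) (at u within {a..t})"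
      using DERIV_diff[OF dx[of u t] dy[of u t]] u t c by (simp add: right_diff_distrib)
    show "\<bar>\<sigma> * (v u - w u)\<bar> \<le> E" using s(2)[of u] u t \<sigma> by (simp add: abs_mult E_def)
  qed (use t ini in auto)
  have FF: "\<bar>F (y1 t) - F (y2 t)\<bar> \<le> D * E" if t: "t \<in> {a..c}" for t
  proof (cases "t = a")
    case True
    then show ?thesis using eq D0 by (simp add: E_def)
  next
    case False
    have E0: "0 \<le> E" by (simp add: E_def)
    have "E * (t - a) \<le> E * 1" using t c c0 E0 by (intro mult_left_mono) auto
    then have "\<bar>x t - y t\<bar> \<le> E" using xy[OF t] by linarith
    moreover have "\<bar>v t - w t\<bar> \<le> E" using s(2)[OF t] by (simp add: E_def)
    moreover have "norm (y1 t - y2 t) \<le> \<bar>fst (y1 t - y2 t)\<bar> + \<bar>snd (y1 t - y2 t)\<bar>"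
      by (metis norm_Pair_le prod.collapse real_norm_def)
    ultimately have "norm (y1 t - y2 t) \<le> 2 * E" by (simp add: defs)
    from mult_left_mono[OF this K0] have "\<bar>\<theta> (y1 t) - \<theta> (y2 t)\<bar> \<le> K * (2 * E)"
      using \<theta>_lipschitz[of "y1 t" "y2 t"] by linarith
    then have 1: "\<bar>(\<theta> (y1 t) - \<theta> (y2 t)) * signed_powr \<alpha> (x t)\<bar> \<le> K * (2 * E) * P"
      unfolding abs_mult using P[of t] t a c K0 E0 by (intro mult_mono) auto
    have 2: "\<bar>\<theta> (y2 t) * (signed_powr \<alpha> (x t) - signed_powr \<alpha> (y t))\<bar> \<le> C * (B * E)"
      unfolding abs_mult using \<theta>_bound B(2)[of t E] xy[OF t] t c False C0 by (intro mult_mono) auto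
    have "F (y1 t) - F (y2 t) = (\<theta> (y1 t) - \<theta> (y2 t)) * signed_powr \<alpha> (x t)
        + \<theta> (y2 t) * (signed_powr \<alpha> (x t) - signed_powr \<alpha> (y t))"
      by (simp add: F_eq defs algebra_simps)
    then have "\<bar>F (y1 t) - F (y2 t)\<bar> \<le> K * (2 * E) * P + C * (B * E)" using 1 2 by linarith
    then show ?thesis by (simp add: D_def algebra_simps)
  qed
  have "\<bar>v s - w s\<bar> \<le> D * E * (s - a)"
  proof (rule derivative_bound_imp_le[where g = "\<lambda>t. v t - w t"])
    fix u assume u: "u \<in> {a..s}"
    show "((\<lambda>t. v t - w t) has_real_derivative \<sigma> * (F (y1 u) - F (y2 u))) (at u within {a..s})"
      using DERIV_diff[OF dv[of u s] dw[of u s]] u s c by (simp add: right_diff_distrib)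
    show "\<bar>\<sigma> * (F (y1 u) - F (y2 u))\<bar> \<le> D * E" using FF[of u] u s(1) \<sigma> by (simp add: abs_mult)
  qed (use s ini in auto)
  also have "\<dots> \<le> E * (D * (c - a))"
  proof -
    have "D * E * (s - a) \<le> D * E * (c - a)" using s(1) D0 by (intro mult_left_mono) (auto simp: E_def)
    then show ?thesis by (simp add: algebra_simps)
  qed
  finally have "E \<le> E * (D * (c - a))" by (simp add: E_def)
  moreover have "E * (D * (c - a)) < E * 1" if "0 < E"
    using c(4) that by (intro mult_strict_left_mono) auto
  ultimately have "E = 0" by (cases "0 < E") (auto simp: E_def)
  have "y1 t = y2 t" if t: "t \<in> {a..c}" for t
    using xy[OF t] s(2)[OF t] unfolding E_def[symmetric] \<open>E = 0\<close> by (simp add: defs prod_eq_iff)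
  then show ?thesis using that[of c] c by blast
qed

text \<open>At the first time of disagreement the solutions still agree by continuity; as the first
  avoids the origin there, so does the second, and local uniqueness extends the agreement.\<close>

lemma uniqueness:
  assumes \<sigma>: "\<bar>\<sigma>\<bar> = 1" and T: "0 \<le> T" and y1: "sol \<sigma> T y1" and y2: "sol \<sigma> T y2"
    and eq: "y1 0 = y2 0" and ne: "\<And>t. t \<in> {0..T} \<Longrightarrow> y1 t \<noteq> 0"
  shows "y1 T = y2 T"
proof (rule ccontr)
  assume T': "y1 T \<noteq> y2 T"
  define A where "A = {t \<in> {0..T}. y1 t \<noteq> y2 t}"
  have A: "A \<noteq> {}" "bdd_below A" using T T' by (auto simp: A_def)
  define s where "s = Inf A"
  have s: "0 \<le> s" "s \<le> T"
  proof -
    show "0 \<le> s" unfolding s_def by (rule cInf_greatest[OF A(1)]) (simp add: A_def)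
    show "s \<le> T" unfolding s_def by (rule cInf_lower[OF _ A(2)]) (use T T' in \<open>simp add: A_def\<close>)
  qed
  have below: "y1 t = y2 t" if t: "0 \<le> t" "t < s" for t
  proof (rule ccontr)
    assume "y1 t \<noteq> y2 t"
    then have "t \<in> A" using t s by (simp add: A_def)
    from cInf_lower[OF this A(2)] show False using t by (simp add: s_def)
  qed
  have "continuous_on {0..T} (\<lambda>t. y1 t - y2 t)"
    using sol_continuous_on[OF y1] sol_continuous_on[OF y2] by (intro continuous_intros)
  then have cl: "closed {t \<in> {0..T}. y1 t - y2 t = 0}"
    by (intro continuous_closed_preimage_constant) auto
  have eqs: "y1 s = y2 s"
  proof (cases "s = 0")
    case False
    then have "s \<in> closure {0..<s}" using s by (simp add: closure_atLeastLessThan)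
    moreover have "{0..<s} \<subseteq> {t \<in> {0..T}. y1 t - y2 t = 0}" using below s by auto
    ultimately have "s \<in> {t \<in> {0..T}. y1 t - y2 t = 0}" using closure_minimal[OF _ cl] by blast
    then show ?thesis by simp
  qed (use eq in simp)
  have "s \<noteq> T" using T' eqs by auto
  then have "s < T" using s by simp
  have "y1 s \<noteq> 0" using ne s by simp
  obtain c where c: "s < c" "\<And>t. t \<in> {s..c} \<Longrightarrow> y1 t = y2 t"
    using local_uniqueness[OF \<sigma> s(1) \<open>s < T\<close> y1 y2 eqs \<open>y1 s \<noteq> 0\<close>] by blast
  have "c \<le> t" if "t \<in> A" for t
  proof (rule ccontr)
    assume "\<not> c \<le> t"
    then have "y1 t = y2 t" using below[of t] c(2)[of t] that by (cases "t < s") (auto simp: A_def)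
    then show False using that by (simp add: A_def)
  qed
  then have "c \<le> s" unfolding s_def using A by (intro cInf_greatest)
  then show False using c by simp
qed

end

sublocale rough_field \<subseteq> kinetic_flow
  by unfold_locales (rule uniqueness)

section \<open>Smooth functions\<close>

lemma smooth_imp_continuous_on: "smooth f \<Longrightarrow> continuous_on UNIV f"
  unfolding smooth_def by (metis C_diff.simps(1))

lemma smooth_imp_C1:
  assumes "smooth f"
  shows "(f has_derivative frechet_derivative f (at z)) (at z)"
    and "continuous_on UNIV (\<lambda>z. frechet_derivative f (at z) h)"
proof -
  have "C_diff (Suc 0) f" using assms by (simp add: smooth_def)
  then show "(f has_derivative frechet_derivative f (at z)) (at z)"
    and "continuous_on UNIV (\<lambda>z. frechet_derivative f (at z) h)"
    unfolding frechet_derivative_works[symmetric] C_diff.simps by blast+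
qed

lemma smooth_compactly_supported_bounds:
  assumes f: "smooth_compactly_supported f"
  shows "\<exists>K r. 0 < r \<and> (\<forall>z w. \<bar>f z - f w\<bar> \<le> K * norm (z - w)) \<and> (\<forall>z. \<bar>f z\<bar> \<le> K) \<and>
    (\<forall>z. \<bar>frechet_derivative f (at z) (0, 1)\<bar> \<le> K) \<and>
    (\<forall>z. r < norm z \<longrightarrow> f z = 0) \<and> (\<forall>z h. r < norm z \<longrightarrow> frechet_derivative f (at z) h = 0)"
proof -
  let ?D = "\<lambda>z. frechet_derivative f (at z)"
  have sm: "smooth f" and cpt: "compact (closure {z. f z \<noteq> 0})"
    using f by (auto simp: smooth_compactly_supported_def)
  note D = smooth_imp_C1[OF sm]
  obtain r where r: "0 < r" "closure {z. f z \<noteq> 0} \<subseteq> ball 0 r"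
    using bounded_subset_ballD[OF compact_imp_bounded[OF cpt], of 0] by metis
  have f0: "f z = 0" if "r < norm z" for z
  proof (rule ccontr)
    assume "f z \<noteq> 0"
    then have "z \<in> closure {z. f z \<noteq> 0}" by (intro closure_subset[THEN subsetD]) simp
    then have "z \<in> ball 0 r" using r(2) by blast
    then show False using that by simp
  qed
  have D0: "?D z h = 0" if z: "r < norm z" for z h
  proof -
    have "open {z :: real \<times> real. r < norm z}" by (intro open_Collect_less continuous_intros)
    then have "(f has_derivative (\<lambda>_. 0)) (at z)"
      by (rule has_derivative_transform_within_open[of "\<lambda>_. 0", rotated]) (use z f0 in auto)
    then show ?thesis using has_derivative_unique[OF D(1)[of z]] by metis
  qed
  have bdd: "\<exists>B. \<forall>z. \<bar>g z\<bar> \<le> B" if "continuous_on UNIV g" "\<And>z. r < norm z \<Longrightarrow> g z = 0"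
    for g :: "real \<times> real \<Rightarrow> real"
  proof -
    have "compact (g ` cball 0 r)" using that(1) by (intro compact_continuous_image) (auto intro: continuous_on_subset)
    from compact_imp_bounded[OF this] obtain B where B: "\<forall>z\<in>cball 0 r. \<bar>g z\<bar> \<le> B"
      unfolding bounded_iff by auto
    have "\<bar>g z\<bar> \<le> \<bar>B\<bar>" for z
      using B[rule_format, of z] that(2)[of z] by (cases "norm z \<le> r") auto
    then show ?thesis by blast
  qed
  obtain B0 where B0: "\<And>z. \<bar>f z\<bar> \<le> B0" using bdd[OF smooth_imp_continuous_on[OF sm] f0] by blast
  obtain B1 where B1: "\<And>z. \<bar>?D z (1, 0)\<bar> \<le> B1" using bdd[OF D(2) D0] by blast
  obtain B2 where B2: "\<And>z. \<bar>?D z (0, 1)\<bar> \<le> B2" using bdd[OF D(2) D0] by blast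
  have B: "0 \<le> B0" "0 \<le> B1" "0 \<le> B2" using B0[of 0] B1[of 0] B2[of 0] by linarith+
  have lip: "norm (f z - f w) \<le> (B1 + B2) * norm (z - w)" for z w
  proof (rule differentiable_bound[of UNIV])
    fix z show "(f has_derivative ?D z) (at z within UNIV)" using D by simp
    show "onorm (?D z) \<le> B1 + B2"
    proof (rule onorm_le)
      fix h :: "real \<times> real"
      have l: "linear (?D z)" using D(1) by (rule has_derivative_linear)
      have "?D z h = ?D z (fst h *\<^sub>R (1, 0) + snd h *\<^sub>R (0, 1))" by simp
      also have "\<dots> = fst h * ?D z (1, 0) + snd h * ?D z (0, 1)"
        by (simp only: linear_add[OF l] linear_scale[OF l] real_scaleR_def)
      also have "\<bar>\<dots>\<bar> \<le> norm h * B1 + norm h * B2"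
        using norm_fst_le[of "fst h" "snd h"] norm_snd_le[of "snd h" "fst h"] B1[of z] B2[of z] B
        by (intro order_trans[OF abs_triangle_ineq] add_mono) (auto simp: abs_mult intro!: mult_mono)
      finally show "norm (?D z h) \<le> (B1 + B2) * norm h" by (simp add: algebra_simps)
    qed
  qed auto
  show ?thesis
  proof (rule exI[of _ "B0 + B1 + B2"], rule exI[of _ r], intro conjI allI impI)
    fix z w :: "real \<times> real"
    have "(B1 + B2) * norm (z - w) \<le> (B0 + B1 + B2) * norm (z - w)" using B by (intro mult_right_mono) auto
    then show "\<bar>f z - f w\<bar> \<le> (B0 + B1 + B2) * norm (z - w)" using lip[of z w] by simp
    show "\<bar>f z\<bar> \<le> B0 + B1 + B2" "\<bar>?D z (0, 1)\<bar> \<le> B0 + B1 + B2"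
      using B0[of z] B2[of z] B by linarith+
  qed (use r f0 D0 in auto)
qed

lemma has_real_derivative_fst_snd:
  assumes "(f has_derivative D) (at z)"
  shows "((\<lambda>x. f (x, snd z)) has_real_derivative D (1, 0)) (at (fst z))"
    and "((\<lambda>v. f (fst z, v)) has_real_derivative D (0, 1)) (at (snd z))"
proof -
  have l: "linear D" using assms by (rule has_derivative_linear)
  have "((\<lambda>x. (x, snd z)) has_derivative (\<lambda>h. (h, 0))) (at (fst z))"
    "((\<lambda>v. (fst z, v)) has_derivative (\<lambda>h. (0, h))) (at (snd z))"
    by (auto intro!: derivative_eq_intros)
  from this[THEN has_derivative_compose, of f D] assms
  have d: "((\<lambda>x. f (x, snd z)) has_derivative (\<lambda>h. D (h, 0))) (at (fst z))"
    "((\<lambda>v. f (fst z, v)) has_derivative (\<lambda>h. D (0, h))) (at (snd z))"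
    by simp_all
  have e: "(\<lambda>h. D (h, 0)) = (*) (D (1, 0))" "(\<lambda>h. D (0, h)) = (*) (D (0, 1))"
  proof (rule_tac [!] ext)
    fix h :: real
    have "(h, 0) = h *\<^sub>R (1, 0 :: real)" "(0, h) = h *\<^sub>R (0 :: real, 1)" by simp_all
    then show "D (h, 0) = D (1, 0) * h" "D (0, h) = D (0, 1) * h"
      by (simp_all only: linear_scale[OF l] real_scaleR_def mult.commute)
  qed
  then show "((\<lambda>x. f (x, snd z)) has_real_derivative D (1, 0)) (at (fst z))"
    and "((\<lambda>v. f (fst z, v)) has_real_derivative D (0, 1)) (at (snd z))"
    using d unfolding has_field_derivative_def e by blast+
qed

text \<open>The singular factor depends on x only, so differentiation in v falls on \<theta> alone
  and leaves a continuous, compactly supported function.\<close>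

lemma rough_field_smooth:
  assumes \<theta>: "smooth_compactly_supported \<theta>" and \<alpha>: "0 < \<alpha>" "\<alpha> \<le> 1"
  obtains M K C where "rough_field (\<lambda>(x, v). \<theta> (x, v) * sgn x * \<bar>x\<bar> powr \<alpha>)
    (\<lambda>z. frechet_derivative \<theta> (at z) (0, 1) * signed_powr \<alpha> (fst z)) M \<theta> \<alpha> K C"
proof -
  let ?D = "\<lambda>z. frechet_derivative \<theta> (at z)"
  let ?F = "\<lambda>(x, v). \<theta> (x, v) * sgn x * \<bar>x\<bar> powr \<alpha>"
  have sm: "smooth \<theta>" using \<theta> by (simp add: smooth_compactly_supported_def)
  obtain K r where "0 < r \<and> (\<forall>z w. \<bar>\<theta> z - \<theta> w\<bar> \<le> K * norm (z - w)) \<and> (\<forall>z. \<bar>\<theta> z\<bar> \<le> K) \<and>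
      (\<forall>z. \<bar>?D z (0, 1)\<bar> \<le> K) \<and>
      (\<forall>z. r < norm z \<longrightarrow> \<theta> z = 0) \<and> (\<forall>z h. r < norm z \<longrightarrow> ?D z h = 0)"
    using smooth_compactly_supported_bounds[OF \<theta>] by blast
  then have K: "0 < r" "\<And>z w. \<bar>\<theta> z - \<theta> w\<bar> \<le> K * norm (z - w)" "\<And>z. \<bar>\<theta> z\<bar> \<le> K"
    "\<And>z. \<bar>?D z (0, 1)\<bar> \<le> K"
    "\<And>z. r < norm z \<Longrightarrow> \<theta> z = 0" "\<And>z h. r < norm z \<Longrightarrow> ?D z h = 0"
    by blast+
  have K0: "0 \<le> K" using K(3)[of 0] by linarith
  have F: "?F z = \<theta> z * signed_powr \<alpha> (fst z)" for z
    by (cases z) (simp add: signed_powr_def)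
  have sp: "continuous_on UNIV (\<lambda>z :: real \<times> real. signed_powr \<alpha> (fst z))"
    by (intro continuous_on_compose2[OF continuous_on_signed_powr[OF \<alpha>(1)]] continuous_intros) auto
  \<comment> \<open>Used with \<theta> and with its v-derivative, both of which vanish beyond r;
    where they do not, \<bar>fst z\<bar> \<le> r bounds the signed power.\<close>
  have bound: "\<bar>g z * signed_powr \<alpha> (fst z)\<bar> \<le> K * r powr \<alpha>"
    if "\<bar>g z\<bar> \<le> K" "r < norm z \<Longrightarrow> g z = 0" for g :: "real \<times> real \<Rightarrow> real" and z
  proof (cases "r < norm z")
    case True
    then show ?thesis using that K0 by simp
  next
    case False
    then have "\<bar>fst z\<bar> \<le> r" using norm_fst_le[of "fst z" "snd z"] by simp
    then show ?thesis unfolding abs_mult abs_signed_powr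
      using that(1) K0 \<alpha> by (intro mult_mono powr_mono2) auto
  qed
  have "rough_field ?F (\<lambda>z. ?D z (0, 1) * signed_powr \<alpha> (fst z)) (K * r powr \<alpha>) \<theta> \<alpha> K K"
  proof unfold_locales
    show "continuous_on UNIV ?F"
      unfolding F by (intro continuous_intros sp smooth_imp_continuous_on[OF sm])
    show "continuous_on UNIV (\<lambda>z. ?D z (0, 1) * signed_powr \<alpha> (fst z))"
      by (intro continuous_intros sp smooth_imp_C1[OF sm])
    show "\<bar>?F z\<bar> \<le> K * r powr \<alpha>" for z unfolding F using K by (intro bound) auto
    show "\<bar>?D z (0, 1) * signed_powr \<alpha> (fst z)\<bar> \<le> K * r powr \<alpha>" for z using K by (intro bound) auto
    show "((\<lambda>v. ?F (x, v)) has_real_derivative ?D (x, v) (0, 1) * signed_powr \<alpha> (fst (x, v))) (at v)" for x v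
      unfolding F using has_real_derivative_fst_snd(2)[OF smooth_imp_C1(1)[OF sm], of "(x, v)"]
      by (auto intro!: derivative_eq_intros)
  qed (use F \<alpha> K in auto)
  then show ?thesis by (rule that)
qed

context kinetic_flow
begin

lemma weak_transport_solution_transported:
  assumes f0: "continuous_on UNIV f0"
  shows "weak_transport_solution F f0 (transported f0)"
  unfolding weak_transport_solution_def
proof (intro conjI allI impI)
  have "{0..} \<times> UNIV \<in> sets (borel :: (real \<times> real \<times> real) measure)"
    by (intro borel_closed closed_Times) auto
  then show "set_borel_measurable borel ({0..} \<times> UNIV) (\<lambda>(t, z). transported f0 t z)"
    unfolding set_borel_measurable_def case_prod_beta
    by (intro borel_measurable_scaleR borel_measurable_indicator transported_measurable[OF f0])
next
  fix T r :: real
  obtain B where "0 \<le> B" "\<And>s z. 0 \<le> s \<Longrightarrow> s \<le> T \<Longrightarrow> z \<in> square r \<Longrightarrow> \<bar>transported f0 s z\<bar> \<le> B"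
    using transported_bound[OF f0, of T r] by blast
  moreover have "z \<in> square r" if "z \<in> cball 0 r" for z
    using that norm_fst_le[of "fst z" "snd z"] norm_snd_le[of "snd z" "fst z"] unfolding mem_square by simp
  ultimately show "\<exists>M. \<forall>t\<in>{0..T}. \<forall>z\<in>cball 0 r. \<bar>transported f0 t z\<bar> \<le> M"
    by (meson atLeastAtMost_iff)
next
  show "transported f0 0 = f0" by (rule transported_0[OF f0])
next
  fix \<phi> :: "real \<times> real \<Rightarrow> real" and t :: real
  assume \<phi>: "smooth_compactly_supported \<phi>" and t: "0 \<le> t"
  let ?D = "\<lambda>z. frechet_derivative \<phi> (at z)"
  have sm: "smooth \<phi>" using \<phi> by (simp add: smooth_compactly_supported_def)
  obtain K r where "0 < r \<and> (\<forall>z w. \<bar>\<phi> z - \<phi> w\<bar> \<le> K * norm (z - w)) \<and> (\<forall>z. r < norm z \<longrightarrow> \<phi> z = 0)"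
    using smooth_compactly_supported_bounds[OF \<phi>] by blast
  then have K: "0 < r" "\<And>z w. \<bar>\<phi> z - \<phi> w\<bar> \<le> K * norm (z - w)" "\<And>z. r < norm z \<Longrightarrow> \<phi> z = 0"
    by blast+
  have sup: "\<phi> z = 0" if "z \<notin> square r" for z
  proof (rule K(3))
    show "r < norm z"
      using that norm_fst_le[of "fst z" "snd z"] norm_snd_le[of "snd z" "fst z"] unfolding mem_square by auto
  qed
  have "deriv (\<lambda>x. \<phi> (x, snd z)) (fst z) = ?D z (1, 0)" for z
    by (intro DERIV_imp_deriv has_real_derivative_fst_snd smooth_imp_C1[OF sm])
  moreover have "deriv (\<lambda>v. F (fst z, v) * \<phi> (fst z, v)) (snd z) = Fv z * \<phi> z + F z * ?D z (0, 1)" for z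
    using F_deriv[of "fst z" "snd z"] has_real_derivative_fst_snd(2)[OF smooth_imp_C1(1)[OF sm], of z]
    by (intro DERIV_imp_deriv) (auto intro!: derivative_eq_intros)
  ultimately show "(LBINT z. transported f0 t z * \<phi> z) = (LBINT z. f0 z * \<phi> z) +
      (LBINT s:{0..t}. LBINT z. transported f0 s z *
        (snd z * deriv (\<lambda>x. \<phi> (x, snd z)) (fst z) + deriv (\<lambda>v. F (fst z, v) * \<phi> (fst z, v)) (snd z)))"
    using transported_weak_form[OF f0 smooth_imp_C1(1)[OF sm] K(2) sup t]
    by (simp add: transport_op_def[OF f0 smooth_imp_C1(1)[OF sm] K(2) sup])
qed

end

section \<open>Solutions of the system and the discontinuity\<close>

lemma AE_lborel_imp_ex_ball:
  fixes c :: "'a::euclidean_space"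
  assumes "AE y in lborel. P y" "0 < e"
  shows "\<exists>y\<in>ball c e. P y"
proof (rule ccontr)
  assume n: "\<not> (\<exists>y\<in>ball c e. P y)"
  have "AE y in lborel. y \<notin> ball c e"
    using assms(1) by eventually_elim (use n in blast)
  then have "ball c e \<in> null_sets lborel" using AE_iff_null_sets[of "ball c e" lborel] by simp
  then have "measure lborel (ball c e) = 0" by (simp add: measure_def null_setsD1)
  then show False using content_ball_pos[OF assms(2), of c] by simp
qed

section \<open>Local existence and uniqueness\<close>

context kinetic_flow
begin

lemma solves_system_imp_sol:
  assumes s: "solves_system F J x v" and \<sigma>: "\<bar>\<sigma>\<bar> = 1" and J: "\<And>t. t \<in> {0..T} \<Longrightarrow> \<sigma> * t \<in> J"
  shows "sol \<sigma> T (\<lambda>t. (x (\<sigma> * t), v (\<sigma> * t)))"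
  unfolding sol_def
proof
  fix t assume t: "t \<in> {0..T}"
  have sub: "(*) \<sigma> ` {0..T} \<subseteq> J" using J by auto
  have d: "((*) \<sigma> has_real_derivative \<sigma>) (at t within {0..T})"
    by (auto intro!: derivative_eq_intros)
  have chain: "((\<lambda>t. g (\<sigma> * t)) has_vector_derivative \<sigma> * D) (at t within {0..T})"
    if "(g has_real_derivative D) (at (\<sigma> * t) within J)" for g D
    using DERIV_image_chain[OF DERIV_subset[OF that sub] d]
    by (simp add: o_def has_real_derivative_iff_has_vector_derivative mult.commute)
  have "(x has_real_derivative v (\<sigma> * t)) (at (\<sigma> * t) within J)"
    "(v has_real_derivative F (x (\<sigma> * t), v (\<sigma> * t))) (at (\<sigma> * t) within J)"
    using s J[OF t] unfolding solves_system_def by blast+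
  from has_vector_derivative_Pair[OF this[THEN chain]]
  show "((\<lambda>t. (x (\<sigma> * t), v (\<sigma> * t))) has_vector_derivative \<sigma> *\<^sub>R G (x (\<sigma> * t), v (\<sigma> * t))) (at t within {0..T})"
    by (simp add: G_def)
qed

lemma solves_systemI:
  assumes "\<And>t. t \<in> J \<Longrightarrow> (y has_vector_derivative G (y t)) (at t within J)"
  shows "solves_system F J (\<lambda>t. fst (y t)) (\<lambda>t. snd (y t))"
  unfolding solves_system_def
proof (intro ballI conjI)
  fix t assume "t \<in> J"
  from assms[OF this, unfolded has_vector_derivative_def]
  have d: "(y has_derivative (\<lambda>h. h *\<^sub>R G (y t))) (at t within J)" .
  from has_derivative_fst[OF d] has_derivative_snd[OF d]
  show "((\<lambda>t. fst (y t)) has_real_derivative snd (y t)) (at t within J)"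
    "((\<lambda>t. snd (y t)) has_real_derivative F (fst (y t), snd (y t))) (at t within J)"
    by (simp_all add: has_field_derivative_def G_def mult_commute_abs)
qed

text \<open>A forward and a reversed backward limit of the scheme are glued at time 0, where both
  one-sided derivatives equal G z. Existence up to time 1 for every z comes from the global bound on
  F.\<close>

lemma existence:
  obtains y where "y 0 = z" "\<And>t. t \<in> {-1..1} \<Longrightarrow> (y has_vector_derivative G (y t)) (at t within {-1..1})"
proof -
  have ex: "\<exists>y. sol \<sigma> 1 y \<and> y 0 = z" if "\<bar>\<sigma>\<bar> = 1" for \<sigma>
    using scheme_subsequence_converges[OF zero_le_one that, of mesh "\<lambda>_. z" z, OF mesh_pos mesh_lim tendsto_const] by blast
  obtain p where p: "sol 1 1 p" "p 0 = z" using ex[of 1] by auto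
  obtain m where m: "sol (-1) 1 m" "m 0 = z" using ex[of "-1"] by auto
  define y where "y t = (if t \<in> {0..1} then p t else m (- t))" for t :: real
  have y: "(y has_vector_derivative (if t \<in> {0..1} then G (p t) else G (m (- t)))) (at t within {-1..1})"
    if t: "t \<in> {-1..1}" for t
    unfolding y_def
  proof (rule has_vector_derivative_If_within_closures[where T = "{-1..0}"])
    have c: "closure {0..1} \<inter> closure {-1..0} = {0 :: real}" by auto
    show "t \<in> {0..1} \<union> {-1..0}" "{-1..1} = {0..1} \<union> {-1..0 :: real}" using t by auto
    show "(p has_vector_derivative G (p t)) (at t within {0..1} \<union> closure {0..1} \<inter> closure {-1..0})"
      if "t \<in> {0..1} \<union> closure {0..1} \<inter> closure {-1..0}"
      using p(1) that unfolding c sol_def by (auto simp: insert_absorb)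
    show "((\<lambda>t. m (- t)) has_vector_derivative G (m (- t))) (at t within {-1..0} \<union> closure {0..1} \<inter> closure {-1..0})"
      if "t \<in> {-1..0} \<union> closure {0..1} \<inter> closure {-1..0}"
    proof -
      have t: "- t \<in> {0..1}" using that unfolding c by auto
      have e: "{-1..0} \<union> closure {0..1} \<inter> closure {-1..0} = {-1..0 :: real}" unfolding c by auto
      have i: "uminus ` {-1..0} = {0..1 :: real}" by simp
      have "(m has_vector_derivative - G (m (- t))) (at (- t) within uminus ` {-1..0})"
        using m(1) t unfolding i sol_def by auto
      moreover have "(uminus has_vector_derivative -1) (at t within {-1..0})"
        by (auto intro!: derivative_eq_intros)
      ultimately have "((m \<circ> uminus) has_vector_derivative (-1) *\<^sub>R (- G (m (- t)))) (at t within {-1..0})"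
        by (intro vector_diff_chain_within)
      then show ?thesis unfolding e by (simp add: o_def)
    qed
    show "p t = m (- t)" "G (p t) = G (m (- t))" if "t \<in> closure {0..1}" "t \<in> closure {-1..0}"
      using that p m by auto
  qed
  show ?thesis
  proof (rule that[of y])
    show "y 0 = z" by (simp add: y_def p)
    show "(y has_vector_derivative G (y t)) (at t within {-1..1})" if "t \<in> {-1..1}" for t
    proof -
      have "G (y t) = (if t \<in> {0..1} then G (p t) else G (m (- t)))" by (simp add: y_def)
      then show ?thesis using y[OF that] by simp
    qed
  qed
qed

lemma unique_local_solutions_on:
  assumes D: "open D" "0 \<notin> D"
  shows "unique_local_solutions_on F D"
  unfolding unique_local_solutions_on_def
proof (intro allI impI conjI ballI)
  fix x0 v0 assume z: "(x0, v0) \<in> D"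
  obtain y where y: "y 0 = (x0, v0)"
    "\<And>t. t \<in> {-1..1} \<Longrightarrow> (y has_vector_derivative G (y t)) (at t within {-1..1})"
    using existence[of "(x0, v0)"] by blast
  have "continuous_on {-1..1} y" using y(2) by (rule continuous_on_vector_derivative)
  then have "continuous (at 0 within {-1..1}) y" by (simp add: continuous_on_eq_continuous_within)
  then have "\<forall>\<^sub>F t in at 0 within {-1..1}. y t \<in> D"
    using D(1) z unfolding continuous_within y(1) by (rule topological_tendstoD)
  then obtain d where d: "d > 0" "\<And>t. t \<in> {-1..1} \<Longrightarrow> t \<noteq> 0 \<Longrightarrow> dist t 0 < d \<Longrightarrow> y t \<in> D"
    unfolding eventually_at by blast
  define e where "e = min 1 d"
  have "0 < e" using d by (simp add: e_def)
  moreover have "solves_system F {-e<..<e} (\<lambda>t. fst (y t)) (\<lambda>t. snd (y t))"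
  proof (rule solves_systemI)
    fix t assume "t \<in> {-e<..<e}"
    then show "(y has_vector_derivative G (y t)) (at t within {-e<..<e})"
      by (intro has_vector_derivative_within_subset[OF y(2)]) (auto simp: e_def)
  qed
  moreover have "(fst (y t), snd (y t)) \<in> D" if "t \<in> {-e<..<e}" for t
    using d(2)[of t] that z y(1) by (cases "t = 0") (auto simp: e_def)
  ultimately show "\<exists>\<epsilon>>0. \<exists>x v. solves_system F {-\<epsilon><..<\<epsilon>} x v \<and> x 0 = x0 \<and> v 0 = v0 \<and>
      (\<forall>t\<in>{-\<epsilon><..<\<epsilon>}. (x t, v t) \<in> D)"
    using y(1) by (intro exI[of _ e] conjI exI[of _ "\<lambda>t. fst (y t)"] exI[of _ "\<lambda>t. snd (y t)"]) auto
next
  fix x0 v0 J x v y w t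
  assume "(x0, v0) \<in> D" and h: "is_interval J \<and> 0 \<in> J \<and>
      solves_system F J x v \<and> x 0 = x0 \<and> v 0 = v0 \<and> (\<forall>t\<in>J. (x t, v t) \<in> D) \<and>
      solves_system F J y w \<and> y 0 = x0 \<and> w 0 = v0 \<and> (\<forall>t\<in>J. (y t, w t) \<in> D)" and t: "t \<in> J"
  define \<sigma> where "\<sigma> = (if 0 \<le> t then 1 else - 1 :: real)"
  have \<sigma>: "\<bar>\<sigma>\<bar> = 1" "\<sigma> * \<bar>t\<bar> = t" by (auto simp: \<sigma>_def)
  have J: "\<sigma> * s \<in> J" if "s \<in> {0..\<bar>t\<bar>}" for s
  proof (cases "0 \<le> t")
    case True
    then show ?thesis using h t that mem_is_interval_1_I[of J 0 t "\<sigma> * s"] by (auto simp: \<sigma>_def)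
  next
    case False
    then show ?thesis using h t that mem_is_interval_1_I[of J t 0 "\<sigma> * s"] by (auto simp: \<sigma>_def)
  qed
  have sol: "sol \<sigma> \<bar>t\<bar> (\<lambda>s. (x (\<sigma> * s), v (\<sigma> * s)))" "sol \<sigma> \<bar>t\<bar> (\<lambda>s. (y (\<sigma> * s), w (\<sigma> * s)))"
    using h J \<sigma> by (auto intro!: solves_system_imp_sol)
  have "(x (\<sigma> * s), v (\<sigma> * s)) \<noteq> 0" if "s \<in> {0..\<bar>t\<bar>}" for s
    using h J[OF that] D(2) by metis
  from unique[OF \<sigma>(1) _ sol _ this]
  have "(x (\<sigma> * \<bar>t\<bar>), v (\<sigma> * \<bar>t\<bar>)) = (y (\<sigma> * \<bar>t\<bar>), w (\<sigma> * \<bar>t\<bar>))" using h by simp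
  then show "x t = y t" "v t = w t" unfolding \<sigma>(2) by auto
qed

text \<open>Convergence along arbitrary starting points and mesh indices excludes any sequence of
  counterexamples, so the scheme is close to f0 (y t) uniformly on a ball for all fine meshes. The
  limit inherits this wherever it exists, that is almost everywhere.\<close>

lemma transported_near:
  assumes f0: "continuous_on UNIV f0" and t: "0 \<le> t"
    and y: "sol (-1) t y" "\<And>s. s \<in> {0..t} \<Longrightarrow> y s \<noteq> 0" and e: "0 < e"
  obtains d where "0 < d" "AE z in lborel. z \<in> ball (y 0) d \<longrightarrow> \<bar>transported f0 t z - f0 (y t)\<bar> \<le> e"
proof -
  have "\<exists>N. \<forall>z\<in>ball (y 0) (inverse (real (Suc N))). \<forall>m\<ge>N. \<bar>scheme f0 m t z - f0 (y t)\<bar> < e"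
  proof (rule ccontr)
    assume "\<not> ?thesis"
    then have "\<forall>N. \<exists>z m. z \<in> ball (y 0) (inverse (real (Suc N))) \<and> m \<ge> N \<and> \<not> \<bar>scheme f0 m t z - f0 (y t)\<bar> < e"
      by blast
    then obtain zs p where zp: "\<And>N. zs N \<in> ball (y 0) (inverse (real (Suc N)))" "\<And>N. p N \<ge> N"
      "\<And>N. \<not> \<bar>scheme f0 (p N) t (zs N) - f0 (y t)\<bar> < e"
      by metis
    have "zs \<longlonglongrightarrow> y 0"
    proof (rule metric_tendsto_imp_tendsto[OF LIMSEQ_inverse_real_of_nat])
      show "\<forall>\<^sub>F N in sequentially. dist (zs N) (y 0) \<le> dist (inverse (real (Suc N))) 0"
        using zp(1) by (auto simp: dist_commute intro!: always_eventually less_imp_le)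
    qed
    moreover have "filterlim p at_top sequentially"
      by (rule filterlim_at_top_mono[OF filterlim_ident]) (use zp(2) in auto)
    ultimately have "(\<lambda>N. scheme f0 (p N) t (zs N)) \<longlonglongrightarrow> f0 (y t)"
      using scheme_LIMSEQ[OF f0 t y] by blast
    then have "\<forall>\<^sub>F N in sequentially. \<bar>scheme f0 (p N) t (zs N) - f0 (y t)\<bar> < e"
      using e by (auto dest: tendstoD simp: dist_real_def)
    then show False using zp(3) by (auto dest: eventually_happens)
  qed
  then obtain N where N: "\<And>z m. z \<in> ball (y 0) (inverse (real (Suc N))) \<Longrightarrow> m \<ge> N \<Longrightarrow> \<bar>scheme f0 m t z - f0 (y t)\<bar> < e"
    by blast
  show ?thesis
  proof (rule that)
    show "0 < inverse (real (Suc N))" by simp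
    show "AE z in lborel. z \<in> ball (y 0) (inverse (real (Suc N))) \<longrightarrow> \<bar>transported f0 t z - f0 (y t)\<bar> \<le> e"
      using AE_scheme_converges[OF f0 t]
    proof eventually_elim
      case (elim z)
      have "(\<lambda>n. \<bar>scheme f0 n t z - f0 (y t)\<bar>) \<longlonglongrightarrow> \<bar>transported f0 t z - f0 (y t)\<bar>"
        using elim t by (intro tendsto_intros) auto
      then show ?case
        using N[of z] by (intro impI LIMSEQ_le_const2) (auto intro: less_imp_le)
    qed
  qed
qed

text \<open>The curve q runs in reversed time, so its shift by s > 0 is the backward path from q s;
  it avoids the origin even though q 0 may be the origin. This fixes f near q s, and continuity of h
  carries the value to q 0.\<close>

lemma continuous_representative_value:
  assumes f0: "continuous_on UNIV f0" and h: "AE z in lborel. h z = transported f0 t0 z" "isCont h (q 0)"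
    and t0: "0 < t0" "t0 < T"
    and q: "\<And>u. u \<in> {0..<T} \<Longrightarrow> (q has_vector_derivative - G (q u)) (at u within {0..})"
    and q0: "\<And>u. u \<in> {0<..<T} \<Longrightarrow> q u \<noteq> 0"
  shows "h (q 0) = f0 (q t0)"
proof (rule ccontr)
  assume ne: "h (q 0) \<noteq> f0 (q t0)"
  \<comment> \<open>A third each for the oscillation of h near q 0, the error of f near q s, and the
    change of f0 from q (s + t0) to q t0.\<close>
  define e where "e = \<bar>h (q 0) - f0 (q t0)\<bar> / 3"
  have e: "0 < e" using ne by (simp add: e_def)
  obtain d where d: "d > 0" "\<And>z. dist z (q 0) < d \<Longrightarrow> dist (h z) (h (q 0)) < e"
    using h(2) e unfolding continuous_at_eps_delta by blast
  have cont: "continuous (at u within {0..}) q" if "u \<in> {0..<T}" for u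
    using q[OF that] by (rule has_vector_derivative_continuous)
  have "(q \<longlongrightarrow> q 0) (at 0 within {0..})" using cont[of 0] t0 unfolding continuous_within by simp
  then have "(q \<longlongrightarrow> q 0) (at_right 0)" by (rule tendsto_mono[OF at_le, rotated]) auto
  then have e1: "\<forall>\<^sub>F s in at_right 0. dist (q s) (q 0) < d / 2"
    using d(1) by (intro tendstoD) auto
  have "((\<lambda>s. q (s + t0)) \<longlongrightarrow> q t0) (at_right 0)"
  proof -
    have "at t0 within {0..} = at t0" by (rule at_within_interior) (use t0 in simp)
    then have "(q \<longlongrightarrow> q t0) (at t0)" using cont[of t0] t0 unfolding continuous_within by simp
    moreover have "filterlim (\<lambda>s. s + t0) (at t0) (at_right 0)"
      unfolding filterlim_at by (auto intro!: tendsto_eq_intros eventually_at_right_less simp: eventually_at_filter)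
    ultimately show ?thesis by (rule filterlim_compose)
  qed
  moreover have "isCont f0 (q t0)" using f0 by (simp add: continuous_on_eq_continuous_at del: split_paired_All)
  ultimately have "((\<lambda>s. f0 (q (s + t0))) \<longlongrightarrow> f0 (q t0)) (at_right 0)"
    by (rule isCont_tendsto_compose[rotated])
  then have e2: "\<forall>\<^sub>F s in at_right 0. dist (f0 (q (s + t0))) (f0 (q t0)) < e" using e by (rule tendstoD)
  have e3: "\<forall>\<^sub>F s in at_right 0. 0 < s \<and> s < T - t0"
    using t0 by (auto simp: eventually_at_right_field intro!: exI[of _ "T - t0"])
  \<comment> \<open>The gap between t0 and T leaves room for the shift: the path from q s must still
    last for time t0.\<close>
  obtain s where s: "dist (q s) (q 0) < d / 2" "dist (f0 (q (s + t0))) (f0 (q t0)) < e" "0 < s" "s < T - t0"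
    using eventually_happens'[OF trivial_limit_at_right_real eventually_conj[OF e1 eventually_conj[OF e2 e3]]] by auto
  define y where "y t = q (s + t)" for t
  have "sol (-1) t0 y" unfolding sol_def
  proof
    fix t assume t: "t \<in> {0..t0}"
    have "(q has_vector_derivative - G (y t)) (at (s + t) within (+) s ` {0..t0})"
      unfolding y_def by (rule has_vector_derivative_within_subset[OF q]) (use s t in auto)
    moreover have "((+) s has_vector_derivative 1) (at t within {0..t0})"
      by (auto intro!: derivative_eq_intros)
    ultimately have "((q \<circ> (+) s) has_vector_derivative 1 *\<^sub>R - G (y t)) (at t within {0..t0})"
      by (intro vector_diff_chain_within)
    then show "(y has_vector_derivative - 1 *\<^sub>R G (y t)) (at t within {0..t0})"
      by (simp add: y_def[abs_def] o_def)
  qed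
  moreover have "y t \<noteq> 0" if "t \<in> {0..t0}" for t
    unfolding y_def using that s by (intro q0) auto
  ultimately obtain c where c: "0 < c"
    "AE z in lborel. z \<in> ball (y 0) c \<longrightarrow> \<bar>transported f0 t0 z - f0 (y t0)\<bar> \<le> e"
    using transported_near[OF f0, of t0 y e] t0 e by auto
  have "AE z in lborel. h z = transported f0 t0 z \<and> (z \<in> ball (y 0) c \<longrightarrow> \<bar>transported f0 t0 z - f0 (y t0)\<bar> \<le> e)"
    using h(1) c(2) by eventually_elim simp
  from AE_lborel_imp_ex_ball[OF this, of "min c (d / 2)" "y 0"]
  obtain z where z: "z \<in> ball (y 0) (min c (d / 2))" "\<bar>h z - f0 (y t0)\<bar> \<le> e"
    using c(1) d(1) by auto
  have "dist z (q 0) < d"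
    using z(1) s(1) dist_triangle[of z "q 0" "q s"] by (simp add: y_def dist_commute)
  then have "\<bar>h z - h (q 0)\<bar> < e" using d(2) by (simp add: dist_real_def)
  moreover have "\<bar>f0 (y t0) - f0 (q t0)\<bar> < e" using s(2) by (simp add: y_def dist_real_def)
  ultimately have "\<bar>h (q 0) - f0 (q t0)\<bar> < 3 * e" using z(2) by linarith
  then show False by (simp add: e_def)
qed

lemma essentially_discontinuous_transported:
  assumes f0: "continuous_on UNIV f0" and t0: "0 < t0" "t0 < T"
    and q: "\<And>i u. u \<in> {0..<T} \<Longrightarrow> (q i has_vector_derivative - G (q i u)) (at u within {0..})"
    and q0: "\<And>i u. u \<in> {0<..<T} \<Longrightarrow> q i u \<noteq> 0" "\<And>i. q i 0 = z"
    and ne: "f0 (q i t0) \<noteq> f0 (q j t0)"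
  shows "essentially_discontinuous_at (transported f0 t0) z"
  unfolding essentially_discontinuous_at_def
proof
  assume "\<exists>h. (AE y in lborel. h y = transported f0 t0 y) \<and> isCont h z"
  then obtain h where h: "AE y in lborel. h y = transported f0 t0 y" "isCont h z" by blast
  have "h z = f0 (q i t0)" for i
    using continuous_representative_value[OF f0 h(1) _ t0 q q0(1)] h(2) q0(2) by metis
  then show False using ne by metis
qed

end

section \<open>The explicit solutions\<close>

text \<open>The explicit solutions reach base 0 when they come to rest, so the one-sided derivative
  at 0 is needed as well; the difference quotient there is a power with exponent b - 1 > 0.\<close>

lemma has_real_derivative_powr_right:
  assumes "1 < b" "0 \<le> u"
  shows "((\<lambda>u. u powr b) has_real_derivative b * u powr (b - 1)) (at u within {0..})"
proof (cases "u = 0")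
  case True
  have "((\<lambda>y. y powr (b - 1)) \<longlongrightarrow> 0 powr (b - 1)) (at 0 within {0..})"
    by (rule tendsto_powr2) (use assms in \<open>auto simp: eventually_at_filter\<close>)
  moreover have "\<forall>\<^sub>F y in at 0 within {0..}. y powr (b - 1) = (y powr b - 0 powr b) / (y - 0)"
    by (auto simp: eventually_at_filter powr_diff intro!: always_eventually)
  ultimately have "((\<lambda>y. (y powr b - 0 powr b) / (y - 0)) \<longlongrightarrow> 0 powr (b - 1)) (at 0 within {0..})"
    by (rule Lim_transform_eventually)
  then show ?thesis unfolding True has_field_derivative_iff by simp
next
  case False
  then show ?thesis using assms by (intro has_field_derivative_at_within[OF has_real_derivative_powr]) simp
qed

context kinetic_flow
begin

text \<open>At time t0 the curve may be at the origin, where uniqueness fails. Before t0 it is away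
  from the origin, so competitors agree with it on {0..<t0}, and continuity settles the last
  instant.\<close>

lemma time_reversed_solution:
  assumes q: "\<And>u. u \<in> {0..t0} \<Longrightarrow> (q has_vector_derivative - G (q u)) (at u within {0..})"
    and q0: "\<And>u. u \<in> {0<..t0} \<Longrightarrow> q u \<noteq> 0"
  shows "solves_system F {0..t0} (\<lambda>t. fst (q (t0 - t))) (\<lambda>t. snd (q (t0 - t)))"
    and "\<And>x v t. solves_system F {0..t0} x v \<Longrightarrow> (x 0, v 0) = q t0 \<Longrightarrow> t \<in> {0..t0} \<Longrightarrow>
      (x t, v t) = q (t0 - t)"
proof -
  have d: "((\<lambda>t. q (t0 - t)) has_vector_derivative G (q (t0 - t))) (at t within {0..t0})" if t: "t \<in> {0..t0}" for t
  proof -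
    have "(q has_vector_derivative - G (q (t0 - t))) (at (t0 - t) within (\<lambda>t. t0 - t) ` {0..t0})"
      by (rule has_vector_derivative_within_subset[OF q]) (use t in auto)
    moreover have "((\<lambda>t. t0 - t) has_vector_derivative -1) (at t within {0..t0})"
      by (auto intro!: derivative_eq_intros)
    ultimately have "((q \<circ> (\<lambda>t. t0 - t)) has_vector_derivative (-1) *\<^sub>R - G (q (t0 - t))) (at t within {0..t0})"
      by (intro vector_diff_chain_within)
    then show ?thesis by (simp add: o_def)
  qed
  then show s: "solves_system F {0..t0} (\<lambda>t. fst (q (t0 - t))) (\<lambda>t. snd (q (t0 - t)))"
    by (rule solves_systemI)
  fix x v t assume xv: "solves_system F {0..t0} x v" "(x 0, v 0) = q t0" and t: "t \<in> {0..t0}"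
  have sol: "sol 1 t0 (\<lambda>t. q (t0 - t))" using d by (simp add: sol_def)
  have sol': "sol 1 t0 (\<lambda>t. (x t, v t))" using solves_system_imp_sol[OF xv(1), of 1 t0] by simp
  have below: "q (t0 - t) = (x t, v t)" if "t \<in> {0..<t0}" for t
    using unique[of 1 t "\<lambda>t. q (t0 - t)" "\<lambda>t. (x t, v t)"] sol_restrict[OF sol, of t]
      sol_restrict[OF sol', of t] q0 xv(2) that by auto
  show "(x t, v t) = q (t0 - t)"
  proof (cases "t = t0")
    case False
    then show ?thesis using below[of t] t by simp
  next
    case True
    have c: "closed {t \<in> {0..t0}. q (t0 - t) - (x t, v t) = 0}"
    proof (rule continuous_closed_preimage_constant)
      show "continuous_on {0..t0} (\<lambda>t. q (t0 - t) - (x t, v t))"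
        by (intro continuous_on_diff sol_continuous_on[OF sol] sol_continuous_on[OF sol'])
    qed simp
    show ?thesis
    proof (cases "t0 = 0")
      case True
      then show ?thesis using xv(2) \<open>t = t0\<close> by simp
    next
      case False
      then have "t0 \<in> closure {0..<t0}" using t by (simp add: closure_atLeastLessThan)
      moreover have "{0..<t0} \<subseteq> {t \<in> {0..t0}. q (t0 - t) - (x t, v t) = 0}" using below by auto
      ultimately have "t0 \<in> {t \<in> {0..t0}. q (t0 - t) - (x t, v t) = 0}" using closure_minimal[OF _ c] by blast
      then show ?thesis using \<open>t = t0\<close> by simp
    qed
  qed
qed

end

theorem proposition3:
  fixes \<alpha> \<beta> A0 R :: real
  assumes "1 / 2 < \<alpha>" and "\<alpha> < 1" and "R > 0"
    and "\<beta> = 2 / (1 - \<alpha>)"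
    and "A0 = (1 / (\<beta> * (\<beta> - 1))) powr (1 / (1 - \<alpha>))"
  shows "A0 = ((1 - \<alpha>)\<^sup>2 / (2 * (1 + \<alpha>))) powr (1 / (1 - \<alpha>)) \<and>
    (\<exists>\<tau>>0. \<forall>\<theta> F. smooth_compactly_supported \<theta> \<and> (\<forall>z\<in>ball 0 R. \<theta> z = 1) \<and>
        F = (\<lambda>(x, v). \<theta> (x, v) * sgn x * \<bar>x\<bar> powr \<alpha>) \<longrightarrow>
      (\<forall>D. open D \<and> connected D \<and> (0, 0) \<notin> D \<longrightarrow> unique_local_solutions_on F D) \<and>
      (\<forall>t0. 0 < t0 \<and> t0 < \<tau> \<longrightarrow>
        (\<forall>A\<in>{A0, - A0}. \<forall>X V.
          X = (\<lambda>t. A * (t0 - t) powr \<beta>) \<and> V = (\<lambda>t. - A * \<beta> * (t0 - t) powr (\<beta> - 1)) \<longrightarrow>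
            solves_system F {0..t0} X V \<and>
            X 0 = A * t0 powr \<beta> \<and> V 0 = - A * \<beta> * t0 powr (\<beta> - 1) \<and>
            (\<forall>x v. solves_system F {0..t0} x v \<and>
                x 0 = A * t0 powr \<beta> \<and> v 0 = - A * \<beta> * t0 powr (\<beta> - 1) \<longrightarrow>
                (\<forall>t\<in>{0..t0}. x t = X t \<and> v t = V t)) \<and>
            X t0 = 0 \<and> V t0 = 0) \<and>
        (\<forall>f0. smooth f0 \<and>
            f0 (A0 * t0 powr \<beta>, - A0 * \<beta> * t0 powr (\<beta> - 1))
              \<noteq> f0 (- A0 * t0 powr \<beta>, A0 * \<beta> * t0 powr (\<beta> - 1)) \<longrightarrow>
          (\<exists>f. weak_transport_solution F f0 f \<and>
               essentially_discontinuous_at (f t0) (0, 0)))))"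
proof -
  define c where "c = 1 / (\<beta> * (\<beta> - 1))"
  \<comment> \<open>The last identity balances the exponents in x'' = x powr \<alpha> for x = A * u
    powr \<beta>; \<beta> > 2 makes the velocity differentiable at the instant of rest.\<close>
  have \<beta>: "\<beta> > 2" "\<beta> - 1 = (1 + \<alpha>) / (1 - \<alpha>)" "\<alpha> * \<beta> = \<beta> - 2"
    using assms(1,2) unfolding assms(4) by (simp_all add: field_simps)
  have c: "c = (1 - \<alpha>)\<^sup>2 / (2 * (1 + \<alpha>))" "0 < c"
    using assms(1,2) \<beta>(1) unfolding c_def \<beta>(2) by (simp_all add: assms(4) power2_eq_square)
  have A0: "A0 = c powr (1 / (1 - \<alpha>))" unfolding assms(5) c_def ..
  have "c \<noteq> 0" using c(2) by simp
  then have A0pos: "0 < A0" unfolding A0 powr_gt_zero .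
  \<comment> \<open>The balance of coefficients in the same equation.\<close>
  have A0\<alpha>: "A0 powr \<alpha> = A0 * (\<beta> * (\<beta> - 1))"
  proof -
    have "A0 powr (\<alpha> - 1) = c powr (1 / (1 - \<alpha>) * (\<alpha> - 1))" unfolding A0 by (rule powr_powr)
    also have "1 / (1 - \<alpha>) * (\<alpha> - 1) = - 1" using assms(2) by (simp add: field_simps)
    also have "c powr (- 1) = \<beta> * (\<beta> - 1)" using c(2) by (simp add: powr_minus c_def)
    finally show ?thesis using powr_mult_base[of A0 "\<alpha> - 1"] A0pos by simp
  qed
  \<comment> \<open>Here u = t0 - t is the time left before reaching the origin; in this variable
    the curves do not depend on t0.\<close>
  define q where "q A u = (A * u powr \<beta>, - A * \<beta> * u powr (\<beta> - 1))" for A u :: real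
  have q_0: "q A 0 = 0" for A by (simp add: q_def zero_prod_def)
  have q_pos: "q A u \<noteq> 0" if "A \<noteq> 0" "0 < u" for A u
    using that by (simp add: q_def zero_prod_def)
  have q_deriv: "(q A has_vector_derivative (A * (\<beta> * u powr (\<beta> - 1)), - A * \<beta> * ((\<beta> - 1) * u powr (\<beta> - 2)))) (at u within {0..})"
    if "0 \<le> u" for A u
  proof -
    have 1: "((\<lambda>u. A * u powr \<beta>) has_real_derivative A * (\<beta> * u powr (\<beta> - 1))) (at u within {0..})"
      by (rule DERIV_cmult[OF has_real_derivative_powr_right]) (use \<beta> that in auto)
    have 2: "((\<lambda>u. - A * \<beta> * u powr (\<beta> - 1)) has_real_derivative - A * \<beta> * ((\<beta> - 1) * u powr (\<beta> - 1 - 1))) (at u within {0..})"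
      by (rule DERIV_cmult[OF has_real_derivative_powr_right]) (use \<beta> that in auto)
    have e: "\<beta> - 1 - 1 = \<beta> - 2" by simp
    show ?thesis
      using has_vector_derivative_Pair[OF 1[unfolded has_real_derivative_iff_has_vector_derivative]
        2[unfolded has_real_derivative_iff_has_vector_derivative]]
      unfolding q_def[abs_def] e .
  qed
  have force: "signed_powr \<alpha> (A * u powr \<beta>) = A * \<beta> * ((\<beta> - 1) * u powr (\<beta> - 2))"
    if "A \<in> {A0, - A0}" "0 \<le> u" for A u
  proof (cases "u = 0")
    case True
    then show ?thesis by (simp add: signed_powr_def)
  next
    case False
    have p: "signed_powr \<alpha> (A0 * u powr \<beta>) = A0 * \<beta> * ((\<beta> - 1) * u powr (\<beta> - 2))"
      using False that A0pos A0\<alpha> \<beta>(3) by (simp add: signed_powr_def powr_mult powr_powr mult.commute)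
    show ?thesis using that(1) p by (auto simp: signed_powr_minus)
  qed
  \<comment> \<open>The arcs up to u = d lie in the ball on which every admissible \<theta> equals
    1, so d can be chosen before \<theta> and serves as \<tau>.\<close>
  have "\<exists>d>0. \<forall>u. 0 \<le> u \<and> u < d \<longrightarrow> norm (q A0 u) < R"
  proof -
    have "continuous (at 0 within {0..}) (q A0)"
      using q_deriv[of 0 A0] by (intro has_vector_derivative_continuous) auto
    then obtain d where "d > 0" "\<forall>u\<in>{0..}. dist u 0 < d \<longrightarrow> dist (q A0 u) (q A0 0) < R"
      using assms(3) unfolding continuous_within_eps_delta by blast
    then show ?thesis by (intro exI[of _ d]) (auto simp: q_0)
  qed
  then obtain d where d: "d > 0" "\<And>u. 0 \<le> u \<Longrightarrow> u < d \<Longrightarrow> norm (q A0 u) < R" by blast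
  have q_ball: "q A u \<in> ball 0 R" if "A \<in> {A0, - A0}" "0 \<le> u" "u < d" for A u
  proof -
    have "q (- A0) u = - q A0 u" by (simp add: q_def)
    then have "norm (q A u) = norm (q A0 u)" using that(1) by auto
    then show ?thesis using d(2) that by simp
  qed
  have main: "(\<forall>D. open D \<and> connected D \<and> (0, 0) \<notin> D \<longrightarrow> unique_local_solutions_on F D) \<and>
      (\<forall>t0. 0 < t0 \<and> t0 < d \<longrightarrow>
        (\<forall>A\<in>{A0, - A0}. \<forall>X V.
          X = (\<lambda>t. A * (t0 - t) powr \<beta>) \<and> V = (\<lambda>t. - A * \<beta> * (t0 - t) powr (\<beta> - 1)) \<longrightarrow>
            solves_system F {0..t0} X V \<and>
            X 0 = A * t0 powr \<beta> \<and> V 0 = - A * \<beta> * t0 powr (\<beta> - 1) \<and>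
            (\<forall>x v. solves_system F {0..t0} x v \<and>
                x 0 = A * t0 powr \<beta> \<and> v 0 = - A * \<beta> * t0 powr (\<beta> - 1) \<longrightarrow>
                (\<forall>t\<in>{0..t0}. x t = X t \<and> v t = V t)) \<and>
            X t0 = 0 \<and> V t0 = 0) \<and>
        (\<forall>f0. smooth f0 \<and>
            f0 (A0 * t0 powr \<beta>, - A0 * \<beta> * t0 powr (\<beta> - 1))
              \<noteq> f0 (- A0 * t0 powr \<beta>, A0 * \<beta> * t0 powr (\<beta> - 1)) \<longrightarrow>
          (\<exists>f. weak_transport_solution F f0 f \<and>
               essentially_discontinuous_at (f t0) (0, 0))))"
    if \<theta>: "smooth_compactly_supported \<theta>" "\<forall>z\<in>ball 0 R. \<theta> z = 1"
      and F: "F = (\<lambda>(x, v). \<theta> (x, v) * sgn x * \<bar>x\<bar> powr \<alpha>)" for \<theta> F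
  proof -
    obtain M K C where "rough_field F
        (\<lambda>z. frechet_derivative \<theta> (at z) (0, 1) * signed_powr \<alpha> (fst z)) M \<theta> \<alpha> K C"
      using rough_field_smooth[OF \<theta>(1), of \<alpha>] assms(1,2) unfolding F by auto
    then interpret rough_field F "\<lambda>z. frechet_derivative \<theta> (at z) (0, 1) * signed_powr \<alpha> (fst z)" M \<theta> \<alpha> K C .
    have q': "(q A has_vector_derivative - G (q A u)) (at u within {0..})"
      if "A \<in> {A0, - A0}" "0 \<le> u" "u < d" for A u
    proof -
      have "F (q A u) = A * \<beta> * ((\<beta> - 1) * u powr (\<beta> - 2))"
        using \<theta>(2) q_ball[OF that] force[OF that(1,2)] unfolding F_eq by (simp add: q_def)
      then show ?thesis using q_deriv[OF that(2), of A] by (simp add: G_def q_def mult.assoc)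
    qed
    show ?thesis
    proof (intro conjI allI impI ballI)
      fix D :: "(real \<times> real) set" assume "open D \<and> connected D \<and> (0, 0) \<notin> D"
      then show "unique_local_solutions_on F D"
        by (intro unique_local_solutions_on) (auto simp: zero_prod_def)
    next
      fix t0 A X V
      assume t0: "0 < t0 \<and> t0 < d" and A: "A \<in> {A0, - A0}"
        and XV: "X = (\<lambda>t. A * (t0 - t) powr \<beta>) \<and> V = (\<lambda>t. - A * \<beta> * (t0 - t) powr (\<beta> - 1))"
      have "A \<noteq> 0" using A A0pos by auto
      have X: "X = (\<lambda>t. fst (q A (t0 - t)))" "V = (\<lambda>t. snd (q A (t0 - t)))"
        using XV by (simp_all add: q_def)
      note rev = time_reversed_solution[of t0 "q A"]
      show "solves_system F {0..t0} X V"
        unfolding X using t0 A q' q_pos \<open>A \<noteq> 0\<close> by (intro rev(1)) auto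
      show "X 0 = A * t0 powr \<beta>" "V 0 = - A * \<beta> * t0 powr (\<beta> - 1)" "X t0 = 0" "V t0 = 0"
        using XV by simp_all
      fix x v t
      assume xv: "solves_system F {0..t0} x v \<and> x 0 = A * t0 powr \<beta> \<and> v 0 = - A * \<beta> * t0 powr (\<beta> - 1)"
        and t: "t \<in> {0..t0}"
      have "(x t, v t) = q A (t0 - t)"
        using xv t t0 A q' q_pos \<open>A \<noteq> 0\<close> by (intro rev(2)) (auto simp: q_def)
      then show "x t = X t" "v t = V t" by (simp_all add: X prod_eq_iff)
    next
      fix t0 f0
      assume t0: "0 < t0 \<and> t0 < d" and f0: "smooth f0 \<and>
            f0 (A0 * t0 powr \<beta>, - A0 * \<beta> * t0 powr (\<beta> - 1))
              \<noteq> f0 (- A0 * t0 powr \<beta>, A0 * \<beta> * t0 powr (\<beta> - 1))"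
      have cont: "continuous_on UNIV f0" using f0 by (simp add: smooth_imp_continuous_on)
      define Q where "Q b = q (if b then A0 else - A0)" for b
      have "essentially_discontinuous_at (transported f0 t0) (0, 0)"
      proof (rule essentially_discontinuous_transported[OF cont, of t0 d Q _ True False])
        show "(Q b has_vector_derivative - G (Q b u)) (at u within {0..})" if "u \<in> {0..<d}" for b u
          unfolding Q_def using that by (intro q') auto
        show "Q b u \<noteq> 0" if "u \<in> {0<..<d}" for b u
          unfolding Q_def using that A0pos by (intro q_pos) auto
        show "Q b 0 = (0, 0)" for b by (simp add: Q_def q_0 zero_prod_def)
        show "f0 (Q True t0) \<noteq> f0 (Q False t0)" using f0 by (simp add: Q_def q_def)
      qed (use t0 in auto)
      then show "\<exists>f. weak_transport_solution F f0 f \<and> essentially_discontinuous_at (f t0) (0, 0)"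
        using weak_transport_solution_transported[OF cont] by blast
    qed
  qed
  show ?thesis
    by (rule conjI[OF A0[unfolded c(1)]], rule exI[of _ d], rule conjI[OF d(1)],
      intro allI impI, elim conjE, rule main)
qed

end
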